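(* Let $g_1,\dots,g_s:\mathbb{R}^n\times\mathbb{R}^m\to\mathbb{R}$ be continuously differentiable functions that are quasi-convex in the second variable $z$, and let $\xi$ be an $m$-dimensional random vector with continuous density $f_\xi$. Let $\bar x\in\mathbb{R}^n$ satisfy $g_i(\bar x,0)<0$ for all $i=1,\dots,s$, and suppose that the family $(g_i)$ satisfies the $\eta$-growth condition for inequality systems at $\bar x$. Assume moreover that $\operatorname{int}\{z\in\mathbb{R}^m:g_i(x,z)\le0\}=\{z\in\mathbb{R}^m:g_i(x,z)<0\}$ for all $i$ and all $x$ in some neighbourhood of $\bar x$. Then there is a neighbourhood $U'$ of $\bar x$ such that the probability function $$\varphi(x)=\mathbb{P}\big(\omega\in\Omega:\ g_i(x,\xi(\omega))\le0\ \ \forall i=1,\dots,s\big)$$ is locally Lipschitz around every $x\in U'$ and $$\partial\varphi(x)\subseteq-\int_{F_g(x)}\bigcup_{i\in T_x(v)}\left\{\frac{\theta(\rho_g(x,v),v)\,\nabla_xg_i(x,\rho_g(x,v)Lv)}{\langle\nabla_zg_i(x,\rho_g(x,v)Lv),Lv\rangle}\right\}d\mu_\zeta(v)\quad\text{for all }x\in U',$$ where $T_x(v)=\{i:\rho_{g_i}(x,v)=\rho_g(x,v)\}$. Furthermore, if for all $x\in U'$ one has $\#T_x(v)=1$ for $\mu_\zeta$-almost every $v\in F_g(x)$, then $\varphi$ is continuously differentiable on $U'$ and $$\nabla\varphi(x)=-\int_{F_g(x)}\theta(\rho_g(x,v),v)\,\frac{\nabla_xg_{T_x(v)}(x,\rho_g(x,v)Lv)}{\langle\nabla_zg_{T_x(v)}(x,\rho_g(x,v)Lv),Lv\rangle}\,d\mu_\zeta(v)\quad\text{for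 all }x\in U',$$ where $g_{T_x(v)}$ denotes $g_i$ for the unique $i\in T_x(v)$.
   Context: $\mathbb{S}^{m-1}$ is the Euclidean unit sphere of $\mathbb{R}^m$, $\mu_\zeta$ the uniform probability measure on it, $L$ a fixed nonsingular $m\times m$ matrix, and $\theta(r,v)=\frac{2\pi^{m/2}|\det L|}{\Gamma(m/2)}r^{m-1}f_\xi(rLv)$. $g(x,z)=\max_{1\le i\le s}g_i(x,z)$; $F_g(x)=\{v\in\mathbb{S}^{m-1}:\exists r\ge0,\ g(x,rLv)=0\}$; $\rho_{g_i}(x,v)=\sup\{r>0:g_i(x,rLv)\le0\}\in[0,+\infty]$; $\rho_g(x,v)=\min_i\rho_{g_i}(x,v)$. $\eta$-growth condition for inequality systems at $\bar x$: there is a non-decreasing $\eta:\mathbb{R}\to[0,+\infty)$ with $\lim_{\|z\|\to\infty}\|z\|^mf_\xi(z)\eta(\|z\|)=0$ and some $l>0$ such that for all $i=1,\dots,s$, all $x\in\mathbb{B}_{1/l}(\bar x)$ (closed ball) and all $z$ with $g_i(x,z)=0$: $\nabla_zg_i(x,z)\ne0$ and $\|\nabla_xg_i(x,z)\|\le l\,\eta(\|z\|)\,\|\nabla_zg_i(x,z)\|$. $\partial\varphi(x)$ is the limiting (Mordukhovich) subdifferential: the set of limits of $x_k^*\in\hat\partial\varphi(x_k)$ with $x_k\to x$, $\varphi(x_k)\to\varphi(x)$, where $\hat\partial\varphi(x)=\{x^*:\liminf_{x'\to x}(\varphi(x')-\varphi(x)-\langle x^*,x'-x\rangle)/\|x'-x\|\ge0\}$.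 The integral of a set-valued map is the set of integrals of its integrable selections. *)

theory Defs
  imports "HOL-Probability.Probability"
begin

definition C1_on :: "'a::real_inner set \<Rightarrow> ('a \<Rightarrow> real) \<Rightarrow> bool" where
  "C1_on U f \<longleftrightarrow> (\<exists>D. (\<forall>x\<in>U. GDERIV f x :> D x) \<and> continuous_on U D)"

definition grad :: "('a::real_inner \<Rightarrow> real) \<Rightarrow> 'a \<Rightarrow> 'a" where
  "grad f x = (THE D. GDERIV f x :> D)"

definition quasiconvex_on :: "'a::real_vector set \<Rightarrow> ('a \<Rightarrow> real) \<Rightarrow> bool" where
  "quasiconvex_on S f \<longleftrightarrow> convex S \<and>
     (\<forall>x\<in>S. \<forall>y\<in>S. \<forall>t\<in>{0..1}. f ((1 - t) *\<^sub>R x + t *\<^sub>R y) \<le> max (f x) (f y))"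

definition frechet_subdifferential :: "('a::real_inner \<Rightarrow> real) \<Rightarrow> 'a \<Rightarrow> 'a set" where
  "frechet_subdifferential \<phi> x =
     {d. 0 \<le> Liminf (at x) (\<lambda>y. ereal ((\<phi> y - \<phi> x - d \<bullet> (y - x)) / norm (y - x)))}"

definition limiting_subdifferential :: "('a::real_inner \<Rightarrow> real) \<Rightarrow> 'a \<Rightarrow> 'a set" where
  "limiting_subdifferential \<phi> x =
     {d. \<exists>X D. X \<longlonglongrightarrow> x \<and> (\<lambda>k. \<phi> (X k)) \<longlonglongrightarrow> \<phi> x \<and>
           (\<forall>k::nat. D k \<in> frechet_subdifferential \<phi> (X k)) \<and> D \<longlonglongrightarrow> d}"

definition set_valued_integral ::
  "'a measure \<Rightarrow> 'a set \<Rightarrow> ('a \<Rightarrow> 'b::{banach, second_countable_topology} set) \<Rightarrow> 'b set" where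
  "set_valued_integral M A \<Phi> =
     {(LINT v:A|M. h v) | h. set_integrable M A h \<and> (\<forall>v\<in>A. h v \<in> \<Phi> v)}"

text \<open>
  The uniform distribution on the unit sphere is the law of \<open>z / \<parallel>z\<parallel>\<close> for \<open>z\<close> uniformly
  distributed in the unit ball, i.e. the normalized surface (cone) measure. It is a Borel measure
  on the whole space, concentrated on the sphere.
\<close>

definition uniform_sphere :: "'a::euclidean_space measure" where
  "uniform_sphere = distr (uniform_measure lborel (ball 0 1)) borel (\<lambda>z. z /\<^sub>R norm z)"

lemma emeasure_unit_ball:
  "emeasure lborel (ball (0::'a::euclidean_space) 1) \<noteq> 0"
  "emeasure lborel (ball (0::'a) 1) \<noteq> \<infinity>"
proof -
  have "negligible (ball (0::'a) 1) \<longleftrightarrow> False"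
    using open_not_negligible[of "ball (0::'a) 1"] by simp
  then show "emeasure lborel (ball (0::'a) 1) \<noteq> 0"
    by (auto simp: negligible_iff_emeasure0 emeasure_lborel_UNIV)
  show "emeasure lborel (ball (0::'a) 1) \<noteq> \<infinity>"
    using emeasure_lborel_ball_finite[of "0::'a" 1] by auto
qed

lemma prob_space_uniform_sphere: "prob_space (uniform_sphere :: 'a::euclidean_space measure)"
  unfolding uniform_sphere_def
  by (intro prob_space.prob_space_distr prob_space_uniform_measure emeasure_unit_ball) simp

lemma AE_uniform_sphere: "AE v in (uniform_sphere :: 'a::euclidean_space measure). v \<in> sphere 0 1"
proof -
  have "AE z in lborel. z \<noteq> (0::'a)"
    by (rule AE_lborel_singleton)
  then have "AE z in uniform_measure lborel (ball (0::'a) 1). z /\<^sub>R norm z \<in> sphere 0 1"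
    by (intro AE_uniform_measureI) auto
  then show ?thesis
    unfolding uniform_sphere_def by (subst AE_distr_iff) auto
qed

definition max_fun :: "('k::finite \<Rightarrow> 'a \<Rightarrow> 'b \<Rightarrow> real) \<Rightarrow> 'a \<Rightarrow> 'b \<Rightarrow> real" where
  "max_fun g x z = Max (range (\<lambda>i. g i x z))"

definition F_set :: "real^'m^'m \<Rightarrow> ('a \<Rightarrow> real^'m \<Rightarrow> real) \<Rightarrow> 'a \<Rightarrow> (real^'m) set" where
  "F_set L h x = {v \<in> sphere 0 1. \<exists>r\<ge>0. h x (r *\<^sub>R (L *v v)) = 0}"

text \<open>The value lies in \<open>[0, \<infinity>]\<close>; in particular the supremum of the empty set is \<open>0\<close>.\<close>

definition rho :: "real^'m^'m \<Rightarrow> ('a \<Rightarrow> real^'m \<Rightarrow> real) \<Rightarrow> 'a \<Rightarrow> real^'m \<Rightarrow> ennreal" where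
  "rho L h x v = (SUP r\<in>{r. 0 < r \<and> h x (r *\<^sub>R (L *v v)) \<le> 0}. ennreal r)"

definition rho_min ::
  "real^'m^'m \<Rightarrow> ('k::finite \<Rightarrow> 'a \<Rightarrow> real^'m \<Rightarrow> real) \<Rightarrow> 'a \<Rightarrow> real^'m \<Rightarrow> ennreal" where
  "rho_min L g x v = Min (range (\<lambda>i. rho L (g i) x v))"

definition T_set ::
  "real^'m^'m \<Rightarrow> ('k::finite \<Rightarrow> 'a \<Rightarrow> real^'m \<Rightarrow> real) \<Rightarrow> 'a \<Rightarrow> real^'m \<Rightarrow> 'k set" where
  "T_set L g x v = {i. rho L (g i) x v = rho_min L g x v}"

definition theta :: "real^'m^'m \<Rightarrow> (real^'m \<Rightarrow> real) \<Rightarrow> real \<Rightarrow> real^'m \<Rightarrow> real" where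
  "theta L f r v =
     2 * pi powr (real CARD('m) / 2) * \<bar>det L\<bar> / Gamma (real CARD('m) / 2)
       * r ^ (CARD('m) - 1) * f (r *\<^sub>R (L *v v))"

text \<open>
  The integrand for the index \<open>i\<close>. It is only integrated over \<open>v \<in> F_set L (max_fun g) x\<close> for \<open>x\<close>
  near the reference point, where \<open>rho_min L g x v\<close> is finite, so \<open>enn2real\<close> loses nothing.
\<close>

definition grad_integrand ::
  "real^'m^'m \<Rightarrow> (real^'m \<Rightarrow> real) \<Rightarrow> ('k::finite \<Rightarrow> 'a::real_inner \<Rightarrow> real^'m \<Rightarrow> real)
    \<Rightarrow> 'a \<Rightarrow> real^'m \<Rightarrow> 'k \<Rightarrow> 'a" where
  "grad_integrand L f g x v i =
     (let r = enn2real (rho_min L g x v); z = r *\<^sub>R (L *v v)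
      in (theta L f r v / (grad (\<lambda>w. g i x w) z \<bullet> (L *v v))) *\<^sub>R grad (\<lambda>y. g i y z) x)"

definition eta_growth ::
  "(real^'m \<Rightarrow> real) \<Rightarrow> ('k::finite \<Rightarrow> 'a::real_inner \<Rightarrow> real^'m \<Rightarrow> real) \<Rightarrow> 'a \<Rightarrow> bool" where
  "eta_growth f g xbar \<longleftrightarrow>
     (\<exists>\<eta> :: real \<Rightarrow> real. \<exists>l>0.
        mono \<eta> \<and> (\<forall>t. 0 \<le> \<eta> t) \<and>
        ((\<lambda>z. norm z ^ CARD('m) * f z * \<eta> (norm z)) \<longlongrightarrow> 0) at_infinity \<and>
        (\<forall>i. \<forall>x\<in>cball xbar (1 / l). \<forall>z. g i x z = 0 \<longrightarrow>
           grad (\<lambda>w. g i x w) z \<noteq> 0 \<and>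
           norm (grad (\<lambda>y. g i y z) x) \<le> l * \<eta> (norm z) * norm (grad (\<lambda>w. g i x w) z)))"

end

theory Submission
  imports Defs
begin

text \<open>
  In polar coordinates \<open>\<phi> x\<close> is the spherical mean of \<open>e_min x v\<close>, the minimum over \<open>i\<close> of the
  radial integrals \<open>e i x v\<close> of \<open>\<theta>\<close> up to the radius \<open>\<rho> i x v\<close>. Quasi-convexity and the growth
  condition make each \<open>e i\<close> continuously differentiable in \<open>x\<close>, with a gradient \<open>G i\<close> that is bounded
  uniformly in \<open>v\<close> and vanishes where the radius is infinite. For a measurable selection \<open>s\<close> of
  active indices at \<open>x\<close>, the mean of \<open>e (s v) y v\<close> is a differentiable majorant of \<open>\<phi> y\<close> that
  touches it at \<open>x\<close>, so a Frechet subgradient at \<open>x\<close> can only be the integral of \<open>G (s v) x v\<close>.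
  Limits of such subgradients are again integrals of selections because the set of these integrals
  is closed: by Lyapunov's convexity theorem and induction on faces when the measure is diffuse
  (\<open>m \<ge> 2\<close>), and because it is finite when the sphere has two points.
\<close>

section \<open>Lyapunov's convexity theorem\<close>

text \<open>The main obstacle is the passage to limits of subgradients: selections attached to
  nearby points need not converge, and a weak limit of the selected gradients would in general only
  be a convex combination of the \<open>G i x v\<close>. Upper semicontinuity of the active sets
  lets each nearby selection be replaced by one that is active at \<open>x\<close>, with
  asymptotically the same integral; the rest of the limit argument is then closedness of a set that
  no longer varies. The other delicate place is an infinite radius, where there is no radius to
  differentiate. There \<open>e i\<close> has its largest possible value, the mass of the whole ray,
  while the growth condition makes the gradients at neighbouring points small. So \<open>e i\<close>
  has arbitrarily small local Lipschitz constants there, hence gradient 0, and \<open>G i\<close>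
  stays continuous. The integrand has the denominator \<open>Dz\<close> . \<open>L *v v\<close>,
  which could degenerate for rays almost tangent to the level set. A common ball of radius \<delta>
  inside all sublevel sets excludes this and yields the uniform bound on \<open>G\<close>.\<close>

definition halves :: "'a measure \<Rightarrow> ('a \<Rightarrow> real) set \<Rightarrow> bool" where
  "halves M S \<longleftrightarrow> (\<forall>A\<in>sets M. \<exists>B\<in>sets M. B \<subseteq> A \<and>
     (\<forall>h\<in>S. (LINT v:B|M. h v) = (LINT v:A|M. h v) / 2))"

lemma integrable_imp_set_integrable:
  fixes h :: "'a \<Rightarrow> 'b::{banach, second_countable_topology}"
  shows "integrable M h \<Longrightarrow> A \<in> sets M \<Longrightarrow> set_integrable M A h"
  unfolding set_integrable_def by (rule integrable_mult_indicator)

lemma set_integral_Diff: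
  fixes h :: "'a \<Rightarrow> 'b::{banach, second_countable_topology}"
  assumes "integrable M h" "A \<in> sets M" "B \<in> sets M" "B \<subseteq> A"
  shows "(LINT v:A - B|M. h v) = (LINT v:A|M. h v) - (LINT v:B|M. h v)"
proof -
  have "(LINT v:(A - B) \<union> B|M. h v) = (LINT v:A - B|M. h v) + (LINT v:B|M. h v)"
    using assms by (intro set_integral_Un integrable_imp_set_integrable) auto
  moreover have "(A - B) \<union> B = A" using assms by auto
  ultimately show ?thesis by simp
qed

text \<open>Halving is demanded of every measurable set, so the pieces of a bisection can be
  bisected again. This gives sets at all dyadic times, and unions of these fill in the real times.
  The resulting continuum of subsets serves the intermediate value argument for the next coordinate
  as well as Lyapunov's theorem itself.\<close>

lemma halves_chain:
  assumes hv: "halves M S" and int: "\<And>h. h \<in> S \<Longrightarrow> integrable M h" and A: "A \<in> sets M"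
  obtains E :: "real \<Rightarrow> 'a set" where "\<And>t. E t \<in> sets M" "\<And>t. E t \<subseteq> A" "mono E"
    "\<And>t h. 0 \<le> t \<Longrightarrow> t \<le> 1 \<Longrightarrow> h \<in> S \<Longrightarrow> (LINT v:E t|M. h v) = t * (LINT v:A|M. h v)"
proof -
  obtain half where half: "\<And>A. A \<in> sets M \<Longrightarrow> half A \<in> sets M" "\<And>A. A \<in> sets M \<Longrightarrow> half A \<subseteq> A"
    "\<And>A h. A \<in> sets M \<Longrightarrow> h \<in> S \<Longrightarrow> (LINT v:half A|M. h v) = (LINT v:A|M. h v) / 2"
    using hv unfolding halves_def by metis
  \<comment> \<open>\<open>D k j\<close> belongs to the time j / 2^k: level k + 1 keeps the sets of
    level k at even indices and adds half of the gap between two neighbours at odd ones. Setting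
    \<open>D 0 j\<close> to \<open>A\<close> for all j > 0 keeps the chain increasing beyond the
    index 2^k.\<close>
  define D :: "nat \<Rightarrow> nat \<Rightarrow> 'a set" where
    "D = rec_nat (\<lambda>j. if j = 0 then {} else A)
      (\<lambda>k Dk j. if even j then Dk (j div 2)
        else Dk (j div 2) \<union> half (Dk (Suc (j div 2)) - Dk (j div 2)))"
  have D0: "D 0 j = (if j = 0 then {} else A)" for j by (simp add: D_def)
  have DS: "D (Suc k) j = (if even j then D k (j div 2)
        else D k (j div 2) \<union> half (D k (Suc (j div 2)) - D k (j div 2)))" for k j
    by (simp add: D_def)
  have meas: "D k j \<in> sets M" for k j
    by (induction k arbitrary: j) (auto simp: D0 DS A intro!: half sets.Un sets.Diff)
  have step: "D k j \<subseteq> D k (Suc j)" for k j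
  proof (induction k arbitrary: j)
    case (Suc k)
    show ?case
    proof (cases "even j")
      case False
      then have "Suc j div 2 = Suc (j div 2)" by presburger
      with False show ?thesis
        using half(2)[of "D k (Suc (j div 2)) - D k (j div 2)"] meas Suc[of "j div 2"]
        by (auto simp: DS)
    qed (auto simp: DS)
  qed (auto simp: D0)
  have mono_D: "i \<le> j \<Longrightarrow> D k i \<subseteq> D k j" for i j k
    using lift_Suc_mono_le[of "D k"] step by auto
  have sub_A: "D k j \<subseteq> A" for k j
  proof (induction k arbitrary: j)
    case (Suc k)
    have "half (D k (Suc (j div 2)) - D k (j div 2)) \<subseteq> D k (Suc (j div 2))"
      using half(2)[of "D k (Suc (j div 2)) - D k (j div 2)"] meas by auto
    then show ?case
      using Suc[of "j div 2"] Suc[of "Suc (j div 2)"] unfolding DS by auto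
  qed (auto simp: D0)
  have val: "(LINT v:D k j|M. h v) = real j / 2 ^ k * (LINT v:A|M. h v)" if "j \<le> 2 ^ k" "h \<in> S" for j k h
    using that(1)
  proof (induction k arbitrary: j)
    case 0
    then have "j = 0 \<or> j = 1" by auto
    then show ?case by (auto simp: D0 set_lebesgue_integral_def)
  next
    case (Suc k)
    show ?case
    proof (cases "even j")
      case True
      then obtain i where "j = 2 * i" by blast
      then show ?thesis using Suc by (simp add: DS field_simps)
    next
      case False
      then obtain i where i: "j = 2 * i + 1" by (metis oddE)
      let ?d = "D k (Suc i) - D k i"
      have le: "Suc i \<le> 2 ^ k" using Suc.prems i by simp
      have "(LINT v:D (Suc k) j|M. h v) = (LINT v:D k i \<union> half ?d|M. h v)"
        using i by (simp add: DS)
      also have "\<dots> = (LINT v:D k i|M. h v) + (LINT v:half ?d|M. h v)"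
        using half(1,2)[of ?d] meas int[OF that(2)]
        by (intro set_integral_Un integrable_imp_set_integrable) auto
      also have "(LINT v:half ?d|M. h v) = (LINT v:?d|M. h v) / 2"
        using half(3)[of ?d] meas that by auto
      also have "(LINT v:?d|M. h v) = (LINT v:D k (Suc i)|M. h v) - (LINT v:D k i|M. h v)"
        by (intro set_integral_Diff meas int step that)
      finally show ?thesis using Suc.IH[OF le] Suc.IH[of i] le i by (simp add: field_simps)
    qed
  qed
  \<comment> \<open>The dyadic approximations of t from below give increasing sets, because 2
    floor(t 2^k) \<le> floor(t 2^(k+1)). The integral over the union is therefore the limit of the
    dyadic ones.\<close>
  define E where "E t = (\<Union>k. D k (nat \<lfloor>t * 2 ^ k\<rfloor>))" for t :: real
  show ?thesis
  proof
    show "E t \<in> sets M" for t unfolding E_def using meas by auto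
    show "E t \<subseteq> A" for t unfolding E_def using sub_A by auto
    show "mono E" unfolding E_def
      by (intro monoI UN_mono mono_D) (auto intro!: nat_mono floor_mono mult_right_mono)
    fix t :: real and h assume t: "0 \<le> t" "t \<le> 1" and h: "h \<in> S"
    define j where "j k = nat \<lfloor>t * 2 ^ k\<rfloor>" for k
    have j_real: "real (j k) = of_int \<lfloor>t * 2 ^ k\<rfloor>" for k using t by (simp add: j_def)
    have j_le: "j k \<le> 2 ^ k" for k
    proof -
      have "t * 2 ^ k \<le> 2 ^ k" using t by (simp add: mult_left_le_one_le)
      then have "real (j k) \<le> 2 ^ k" unfolding j_real by linarith
      then show ?thesis by (metis of_nat_le_iff of_nat_numeral of_nat_power)
    qed
    have "D k (j k) \<subseteq> D (Suc k) (j (Suc k))" for k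
    proof -
      have "2 * \<lfloor>t * 2 ^ k\<rfloor> \<le> \<lfloor>t * 2 ^ Suc k\<rfloor>" by (simp add: le_floor_iff)
      then have "2 * j k \<le> j (Suc k)" unfolding j_def using t by linarith
      then have "D (Suc k) (2 * j k) \<subseteq> D (Suc k) (j (Suc k))" by (rule mono_D)
      then show ?thesis by (simp add: DS)
    qed
    then have inc: "incseq (\<lambda>k. D k (j k))" by (rule incseq_SucI)
    have "(\<lambda>k. LINT v:D k (j k)|M. h v) \<longlonglongrightarrow> (LINT v:(\<Union>k. D k (j k))|M. h v)"
      by (rule set_integral_cont_up[OF meas inc])
        (auto intro!: integrable_imp_set_integrable int h meas)
    moreover have "(\<lambda>k. LINT v:D k (j k)|M. h v) \<longlonglongrightarrow> t * (LINT v:A|M. h v)"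
    proof -
      have "(\<lambda>k. of_int \<lfloor>t * 2 ^ k\<rfloor> / 2 ^ k :: real) \<longlonglongrightarrow> t"
      proof (rule tendsto_sandwich)
        have "(t * 2 ^ k - 1) / 2 ^ k \<le> of_int \<lfloor>t * 2 ^ k\<rfloor> / 2 ^ k" for k :: nat
          by (intro divide_right_mono) (linarith, simp)
        then show "\<forall>\<^sub>F k in sequentially. t - (1/2) ^ k \<le> of_int \<lfloor>t * 2 ^ k\<rfloor> / 2 ^ k"
          by (auto simp: field_simps)
        have "of_int \<lfloor>t * 2 ^ k\<rfloor> / 2 ^ k \<le> t" for k :: nat
          by (simp add: divide_le_eq)
        then show "\<forall>\<^sub>F k in sequentially. of_int \<lfloor>t * 2 ^ k\<rfloor> / 2 ^ k \<le> t" by simp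
        show "(\<lambda>k. t - (1/2) ^ k) \<longlonglongrightarrow> t"
          using tendsto_diff[OF tendsto_const LIMSEQ_power_zero[of "1/2::real"], of t] by simp
      qed simp
      then have "(\<lambda>k. of_int \<lfloor>t * 2 ^ k\<rfloor> / 2 ^ k * (LINT v:A|M. h v)) \<longlonglongrightarrow> t * (LINT v:A|M. h v)"
        by (rule tendsto_mult_right)
      then show ?thesis using val[OF j_le h] by (simp add: j_real)
    qed
    ultimately show "(LINT v:E t|M. h v) = t * (LINT v:A|M. h v)"
      unfolding E_def j_def by (rule LIMSEQ_unique)
  qed
qed

context finite_measure
begin

text \<open>Moving continuously from a half \<open>B\<close> of \<open>A\<close> to \<open>A - B\<close> through halves of \<open>A\<close> sends the integral
  of \<open>h\<close> from one side of its half value to the other.\<close>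

lemma halves_insert:
  assumes hv: "halves M S" and one: "(\<lambda>_. 1) \<in> S" and int: "\<And>h. h \<in> S \<Longrightarrow> integrable M h"
    and h: "integrable M h" and bd: "\<And>v. v \<in> space M \<Longrightarrow> \<bar>h v\<bar> \<le> C"
  shows "halves M (insert h S)"
  unfolding halves_def
proof
  fix A assume A: "A \<in> sets M"
  have "\<exists>B\<in>sets M. B \<subseteq> A \<and> (\<forall>h\<in>S. (LINT v:B|M. h v) = (LINT v:A|M. h v) / 2)"
    by (rule bspec[OF hv[unfolded halves_def] A])
  then obtain B where B: "B \<in> sets M" "B \<subseteq> A"
    and B_eq: "\<And>h. h \<in> S \<Longrightarrow> (LINT v:B|M. h v) = (LINT v:A|M. h v) / 2"
    by (elim bexE conjE) simp
  have AB: "A - B \<in> sets M" using A B by auto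
  obtain E where E: "\<And>t. E t \<in> sets M" "\<And>t. E t \<subseteq> B" "mono E"
    "\<And>t h. 0 \<le> t \<Longrightarrow> t \<le> 1 \<Longrightarrow> h \<in> S \<Longrightarrow> (LINT v:E t|M. h v) = t * (LINT v:B|M. h v)"
    by (rule halves_chain[OF hv int B(1)]) auto
  obtain F where F: "\<And>t. F t \<in> sets M" "\<And>t. F t \<subseteq> A - B" "mono F"
    "\<And>t h. 0 \<le> t \<Longrightarrow> t \<le> 1 \<Longrightarrow> h \<in> S \<Longrightarrow> (LINT v:F t|M. h v) = t * (LINT v:A - B|M. h v)"
    by (rule halves_chain[OF hv int AB]) auto
  have cont: "continuous_on {0..1} (\<lambda>t. LINT v:X t|M. h v)"
    if X: "\<And>t. X t \<in> sets M" "mono X" and Y: "Y \<in> sets M"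
      "\<And>t h. 0 \<le> t \<Longrightarrow> t \<le> 1 \<Longrightarrow> h \<in> S \<Longrightarrow> (LINT v:X t|M. h v) = t * (LINT v:Y|M. h v)"
    for X :: "real \<Rightarrow> 'a set" and Y
  proof -
    have C: "0 \<le> \<bar>C\<bar> * measure M Y" by simp
    \<comment> \<open>As the constant 1 lies in \<open>S\<close>, the measure of
      \<open>X t - X s\<close> is t - s times that of \<open>Y\<close>; boundedness of
      \<open>h\<close> turns this into a Lipschitz estimate.\<close>
    have key: "\<bar>(LINT v:X t|M. h v) - (LINT v:X s|M. h v)\<bar> \<le> \<bar>C\<bar> * measure M Y * (t - s)"
      if st: "0 \<le> s" "s \<le> t" "t \<le> 1" for s t
    proof -
      have sub: "X s \<subseteq> X t" using X(2) st by (auto dest: monoD)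
      have "\<bar>(LINT v:X t|M. h v) - (LINT v:X s|M. h v)\<bar> = \<bar>LINT v:X t - X s|M. h v\<bar>"
        using set_integral_Diff[OF h X(1) X(1) sub] by simp
      also have "\<dots> \<le> (LINT v:X t - X s|M. \<bar>h v\<bar>)"
        using set_integral_norm_bound[OF integrable_imp_set_integrable[OF h, of "X t - X s"]] X by auto
      also have "\<dots> \<le> (LINT v:X t - X s|M. \<bar>C\<bar> * 1)"
        unfolding set_lebesgue_integral_def
      proof (rule integral_mono)
        show "integrable M (\<lambda>x. indicator (X t - X s) x *\<^sub>R \<bar>h x\<bar>)"
          "integrable M (\<lambda>x. indicator (X t - X s) x *\<^sub>R (\<bar>C\<bar> * 1))"
          using X(1) h by (intro integrable_mult_indicator; auto)+
        fix v assume "v \<in> space M"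
        then show "indicator (X t - X s) v *\<^sub>R \<bar>h v\<bar> \<le> indicator (X t - X s) v *\<^sub>R (\<bar>C\<bar> * 1)"
          using bd[of v] by (auto split: split_indicator)
      qed
      also have "\<dots> = \<bar>C\<bar> * ((LINT v:X t|M. 1) - (LINT v:X s|M. 1))"
        by (subst set_integral_mult_right, subst set_integral_Diff) (use X sub in auto)
      also have "\<dots> = \<bar>C\<bar> * measure M Y * (t - s)"
        using Y(2)[OF _ _ one, of t] Y(2)[OF _ _ one, of s] st Y(1)
        by (simp add: set_lebesgue_integral_def algebra_simps)
      finally show ?thesis .
    qed
    have "(\<bar>C\<bar> * measure M Y)-lipschitz_on {0..1} (\<lambda>t. LINT v:X t|M. h v)"
    proof (rule lipschitz_onI)
      fix s t :: real assume "s \<in> {0..1}" "t \<in> {0..1}"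
      then show "dist (LINT v:X s|M. h v) (LINT v:X t|M. h v) \<le> \<bar>C\<bar> * measure M Y * dist s t"
        using key[of s t] key[of t s]
        by (cases "s \<le> t") (auto simp: dist_real_def abs_minus_commute)
    qed (rule C)
    then show ?thesis by (rule lipschitz_on_continuous_on)
  qed
  \<comment> \<open>\<open>G t\<close> trades \<open>E t\<close> inside \<open>B\<close> for
    \<open>F t\<close> outside. For functions in \<open>S\<close> both \<open>B\<close> and
    \<open>A - B\<close> carry half of the integral over \<open>A\<close>, so the loss and the gain
    cancel and every \<open>G t\<close> is again a half of \<open>A\<close>.\<close>
  define G where "G t = (B - E t) \<union> F t" for t
  have G: "G t \<in> sets M" "G t \<subseteq> A" for t using E(1,2)[of t] F(1,2)[of t] B unfolding G_def by auto
  have G_eq: "(LINT v:G t|M. k v) = (LINT v:B|M. k v) - (LINT v:E t|M. k v) + (LINT v:F t|M. k v)"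
    if "integrable M k" for k :: "'a \<Rightarrow> real" and t
  proof -
    have "(LINT v:G t|M. k v) = (LINT v:B - E t|M. k v) + (LINT v:F t|M. k v)"
      unfolding G_def using E(1,2)[of t] F(1,2)[of t] B that
      by (intro set_integral_Un integrable_imp_set_integrable) auto
    then show ?thesis using set_integral_Diff[OF that B(1) E(1) E(2)] by simp
  qed
  have AB_eq: "(LINT v:A - B|M. k v) = (LINT v:A|M. k v) - (LINT v:B|M. k v)" if "integrable M k" for k :: "'a \<Rightarrow> real"
    using set_integral_Diff[OF that A B] .
  \<comment> \<open>\<open>E 0\<close> and \<open>F 0\<close> need not be empty, and
    \<open>E 1\<close> and \<open>F 1\<close> need not exhaust \<open>B\<close> and
    \<open>A - B\<close>. Since 1 lies in \<open>S\<close>, they do so up to null sets, which do not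
    affect the integral of \<open>h\<close>.\<close>
  have null: "(LINT v:N|M. h v) = 0" if "N \<in> sets M" "(LINT v:N|M. 1::real) = 0" for N
  proof -
    have "measure M N = 0" using that by (simp add: set_lebesgue_integral_def)
    then have "AE v in M. v \<notin> N" using that by (intro AE_not_in null_setsI) (auto simp: emeasure_eq_measure)
    then have "AE v in M. indicator N v *\<^sub>R h v = 0" by eventually_elim auto
    then show ?thesis unfolding set_lebesgue_integral_def by (rule integral_eq_zero_AE)
  qed
  have E0: "(LINT v:E 0|M. h v) = 0" by (rule null[OF E(1)]) (use E(4)[OF _ _ one] in simp)
  have F0: "(LINT v:F 0|M. h v) = 0" by (rule null[OF F(1)]) (use F(4)[OF _ _ one] in simp)
  have E1: "(LINT v:E 1|M. h v) = (LINT v:B|M. h v)"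
    using set_integral_Diff[OF h B(1) E(1) E(2), of 1] null[of "B - E 1"] B E(1)
      set_integral_Diff[OF int[OF one] B(1) E(1) E(2), of 1] E(4)[OF _ _ one, of 1] by simp
  have F1: "(LINT v:F 1|M. h v) = (LINT v:A - B|M. h v)"
    using set_integral_Diff[OF h AB F(1) F(2), of 1] null[of "A - B - F 1"] AB F(1)
      set_integral_Diff[OF int[OF one] AB F(1) F(2), of 1] F(4)[OF _ _ one, of 1] by simp
  have contG: "continuous_on {0..1} (\<lambda>t. LINT v:G t|M. h v)"
    unfolding G_eq[OF h]
    by (intro continuous_intros cont[OF E(1) E(3) B(1) E(4)] cont[OF F(1) F(3) AB F(4)])
  have G0: "(LINT v:G 0|M. h v) = (LINT v:B|M. h v)" using G_eq[OF h, of 0] E0 F0 by simp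
  have G1: "(LINT v:G 1|M. h v) = (LINT v:A|M. h v) - (LINT v:B|M. h v)"
    using G_eq[OF h, of 1] E1 F1 AB_eq[OF h] by simp
  have "\<exists>t. 0 \<le> t \<and> t \<le> 1 \<and> (LINT v:G t|M. h v) = (LINT v:A|M. h v) / 2"
  proof (cases "(LINT v:B|M. h v) \<le> (LINT v:A|M. h v) / 2")
    case True
    then show ?thesis
      using IVT'[OF _ _ _ contG, of "(LINT v:A|M. h v) / 2"] G0 G1 by auto
  next
    case False
    then show ?thesis
      using IVT2'[OF _ _ _ contG, of "(LINT v:A|M. h v) / 2"] G0 G1 by auto
  qed
  then obtain t where t: "0 \<le> t" "t \<le> 1" "(LINT v:G t|M. h v) = (LINT v:A|M. h v) / 2" by blast
  have "(LINT v:G t|M. k v) = (LINT v:A|M. k v) / 2" if "k \<in> S" for k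
    using G_eq[OF int[OF that], of t] E(4)[OF t(1,2) that] F(4)[OF t(1,2) that] B_eq[OF that] AB_eq[OF int[OF that]]
    by (simp add: field_simps)
  with t(3) G[of t] show "\<exists>B\<in>sets M. B \<subseteq> A \<and> (\<forall>h\<in>insert h S. (LINT v:B|M. h v) = (LINT v:A|M. h v) / 2)"
    by (intro bexI[of _ "G t"]) simp_all
qed

text \<open>Level sets of \<open>p\<close> are null, so the distribution function of
  \<open>p\<close> restricted to \<open>A\<close> is continuous and attains half of its limit at
  infinity. The sublevel set of \<open>p\<close> at that point is the required half.\<close>

lemma halves_one:
  assumes p[measurable]: "p \<in> borel_measurable M"
    and diffuse: "\<And>c::real. measure M {v \<in> space M. p v = c} = 0"
  shows "halves M {\<lambda>_. 1}"
  unfolding halves_def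
proof
  fix A assume A[measurable]: "A \<in> sets M"
  define N where "N = distr (restrict_space M A) borel p"
  have AM: "A \<inter> space M = A" using sets.sets_into_space[OF A] by auto
  have pA[measurable]: "p \<in> borel_measurable (restrict_space M A)"
    by (simp add: measurable_restrict_space1)
  have N: "measure N X = measure M {v \<in> A. p v \<in> X}" if "X \<in> sets borel" for X
  proof -
    have "measure N X = measure (restrict_space M A) (p -` X \<inter> A)"
      unfolding N_def using that A AM by (subst measure_distr) (auto simp: space_restrict_space)
    also have "\<dots> = measure M (p -` X \<inter> A)"
      using A AM by (subst measure_restrict_space) auto
    also have "p -` X \<inter> A = {v \<in> A. p v \<in> X}" by auto
    finally show ?thesis .
  qed
  interpret R: finite_measure "restrict_space M A"
    using A by (intro finite_measure_restrict_space finite_measure_axioms) (auto simp: AM)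
  interpret N: finite_borel_measure N
    unfolding N_def by (intro finite_borel_measure.intro R.finite_measure_distr finite_borel_measure_axioms.intro) auto
  have contN: "isCont (cdf N) x" for x
  proof -
    have "measure M {v \<in> A. p v = x} \<le> measure M {v \<in> space M. p v = x}"
      using sets.sets_into_space[OF A] by (intro finite_measure_mono) auto
    then have "measure N {x} = 0"
      using diffuse[of x] N[of "{x}"] by (simp add: measure_le_0_iff)
    then show ?thesis using N.isCont_cdf by simp
  qed
  have top: "(cdf N \<longlongrightarrow> measure M A) at_top"
    using N.cdf_lim_at_top N[of UNIV] by (simp add: N_def)
  have bot: "(cdf N \<longlongrightarrow> 0) at_bot" by (rule N.cdf_lim_at_bot)
  have "\<exists>B\<in>sets M. B \<subseteq> A \<and> measure M B = measure M A / 2"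
  proof (cases "measure M A = 0")
    case True
    then show ?thesis using A by auto
  next
    case False
    then have pos: "measure M A > 0" by (simp add: zero_less_measure_iff)
    have "\<forall>\<^sub>F x in at_bot. cdf N x < measure M A / 2" using bot pos by (intro order_tendstoD) auto
    then obtain a where a: "\<And>x. x \<le> a \<Longrightarrow> cdf N x < measure M A / 2" by (auto simp: eventually_at_bot_linorder)
    have "\<forall>\<^sub>F x in at_top. cdf N x > measure M A / 2" using top pos by (intro order_tendstoD) auto
    then obtain b where b: "\<And>x. x \<ge> b \<Longrightarrow> cdf N x > measure M A / 2" by (auto simp: eventually_at_top_linorder)
    have "\<exists>x. a \<le> x \<and> x \<le> max a b \<and> cdf N x = measure M A / 2"
      using a[of a] b[of "max a b"] contN
      by (intro IVT) (auto intro: less_imp_le)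
    then obtain x where "cdf N x = measure M A / 2" by blast
    then have "measure M {v \<in> A. p v \<le> x} = measure M A / 2"
      using N[of "{..x}"] by (simp add: cdf_def)
    moreover have "{v \<in> A. p v \<le> x} \<in> sets M"
    proof -
      have "{v \<in> A. p v \<le> x} = {v \<in> space M. v \<in> A \<and> p v \<le> x}"
        using sets.sets_into_space[OF A] by auto
      then show ?thesis by simp
    qed
    ultimately show ?thesis by (intro bexI[of _ "{v \<in> A. p v \<le> x}"]) auto
  qed
  then show "\<exists>B\<in>sets M. B \<subseteq> A \<and> (\<forall>h\<in>{\<lambda>_. 1::real}. (LINT v:B|M. h v) = (LINT v:A|M. h v) / 2)"
    using A by (auto simp: set_lebesgue_integral_def intro!: bexI)
qed

text \<open>Only the segment from 0 to the full integral is claimed, which is what is needed to mix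
  two selections. The induction over \<open>Basis\<close> adds one coordinate of \<open>h\<close> at
  a time, starting from the constant 1, which \<open>halves_insert\<close> requires.\<close>

lemma Lyapunov_convexity:
  fixes h :: "'a \<Rightarrow> 'c::euclidean_space"
  assumes p: "p \<in> borel_measurable M" "\<And>c::real. measure M {v \<in> space M. p v = c} = 0"
    and h: "h \<in> borel_measurable M" "\<And>v. v \<in> space M \<Longrightarrow> norm (h v) \<le> C"
    and t: "0 \<le> t" "t \<le> 1"
  obtains B where "B \<in> sets M" "(LINT v:B|M. h v) = t *\<^sub>R (\<integral>v. h v \<partial>M)"
proof -
  have int_h: "integrable M h"
    using h by (intro integrable_const_bound[of _ C]) auto
  have comp: "integrable M (\<lambda>v. h v \<bullet> b)" for b using int_h by auto
  have "halves M (insert (\<lambda>_. 1) ((\<lambda>b v. h v \<bullet> b) ` X))" if "X \<subseteq> Basis" for X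
    using finite_subset[OF that finite_Basis] that
  proof (induction X rule: finite_induct)
    case empty
    then show ?case using halves_one[OF p] by simp
  next
    case (insert b X)
    have "halves M (insert (\<lambda>v. h v \<bullet> b) (insert (\<lambda>_. 1) ((\<lambda>b v. h v \<bullet> b) ` X)))"
    proof (rule halves_insert[where C = C])
      show "halves M (insert (\<lambda>_. 1) ((\<lambda>b v. h v \<bullet> b) ` X))" using insert by auto
      show "\<bar>h v \<bullet> b\<bar> \<le> C" if "v \<in> space M" for v
        using Basis_le_norm[of b "h v"] h(2)[OF that] insert.prems by auto
    qed (use comp in auto)
    then show ?case by (simp add: insert_commute)
  qed
  from this[of Basis] have hv: "halves M (insert (\<lambda>_. 1) ((\<lambda>b v. h v \<bullet> b) ` Basis))" by simp
  obtain E where E: "\<And>t. E t \<in> sets M"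
    "\<And>t k. 0 \<le> t \<Longrightarrow> t \<le> 1 \<Longrightarrow> k \<in> insert (\<lambda>_. 1) ((\<lambda>b v. h v \<bullet> b) ` Basis) \<Longrightarrow>
      (LINT v:E t|M. k v) = t * (LINT v:space M|M. k v)"
    by (rule halves_chain[OF hv _ sets.top]) (use comp in auto)
  have "(LINT v:E t|M. h v) = t *\<^sub>R (LINT v:space M|M. h v)"
  proof (rule euclidean_eqI)
    fix b :: 'c assume b: "b \<in> Basis"
    have *: "(LINT v:X|M. h v) \<bullet> b = (LINT v:X|M. h v \<bullet> b)" if "X \<in> sets M" for X
      using integral_inner_left[of b M "\<lambda>v. indicator X v *\<^sub>R h v"] integrable_mult_indicator[OF that int_h]
      by (simp add: set_lebesgue_integral_def)
    show "(LINT v:E t|M. h v) \<bullet> b = (t *\<^sub>R (LINT v:space M|M. h v)) \<bullet> b"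
      using E(2)[OF t, of "\<lambda>v. h v \<bullet> b"] b by (simp add: * E(1))
  qed
  then show ?thesis using that[OF E(1)] set_integral_space[OF int_h] by simp
qed

end

section \<open>Integrals of measurable selections\<close>

text \<open>Indices are selected rather than vectors: they form a finite type, so measurability
  refers to the discrete sigma-algebra and a selection composes with any family of integrands.
  Membership is demanded at every point, not almost everywhere, to match
  \<open>set_valued_integral\<close>.\<close>

definition selections :: "'a measure \<Rightarrow> ('a \<Rightarrow> 'k set) \<Rightarrow> ('a \<Rightarrow> 'k) set" where
  "selections M T = {s \<in> measurable M (count_space UNIV). \<forall>v\<in>space M. s v \<in> T v}"

lemma selectionsD:
  assumes "s \<in> selections M T"
  shows "s \<in> measurable M (count_space UNIV)" "v \<in> space M \<Longrightarrow> s v \<in> T v"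
  using assms by (auto simp: selections_def)

lemma measurable_finite_set_valued:
  fixes T :: "'a \<Rightarrow> 'k::finite set"
  assumes [measurable]: "\<And>i. Measurable.pred M (\<lambda>v. i \<in> T v)"
  shows "T \<in> measurable M (count_space UNIV)"
proof -
  have "T -` {X} \<inter> space M \<in> sets M" for X
  proof -
    have "T -` {X} \<inter> space M = {v \<in> space M. \<forall>i. i \<in> T v \<longleftrightarrow> i \<in> X}" by auto
    also have "\<dots> \<in> sets M" by measurable
    finally show ?thesis .
  qed
  then show ?thesis by (simp add: measurable_count_space_eq2)
qed

text \<open>Since \<open>T\<close> is measurable into a discrete space, any function of
  \<open>T v\<close> is measurable, in particular the choice of an element.\<close>

lemma some_in_selections:
  fixes T :: "'a \<Rightarrow> 'k::finite set"
  assumes [measurable]: "T \<in> measurable M (count_space UNIV)" and ne: "\<And>v. v \<in> space M \<Longrightarrow> T v \<noteq> {}"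
  shows "(\<lambda>v. SOME i. i \<in> T v) \<in> selections M T"
  unfolding selections_def using ne by (auto simp: some_in_eq)

text \<open>Repairs an index function that is admissible only for a different set-valued map,
  leaving it unchanged wherever it already lies in \<open>T\<close>. It serves both the closedness
  proof and the limit of subgradients.\<close>

lemma redirect_in_selections:
  fixes T :: "'a \<Rightarrow> 'k::finite set"
  assumes T[measurable]: "T \<in> measurable M (count_space UNIV)"
    and s: "s \<in> measurable M (count_space UNIV)" and s0: "s0 \<in> selections M T"
  shows "(\<lambda>v. if s v \<in> T v then s v else s0 v) \<in> selections M T"
proof -
  note [measurable] = s selectionsD(1)[OF s0]
  have [measurable]: "Measurable.pred M (\<lambda>v. s v \<in> T v)"
    by (rule measurable_compose_countable[OF _ s]) measurable
  show ?thesis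
    unfolding selections_def using selectionsD(2)[OF s0] by auto
qed

locale bounded_selections = finite_measure M
  for M :: "'a measure" +
  fixes H :: "'k::finite \<Rightarrow> 'a \<Rightarrow> 'c::euclidean_space" and C :: real
  assumes H_meas[measurable]: "\<And>i. H i \<in> borel_measurable M"
    and H_bd: "\<And>i v. v \<in> space M \<Longrightarrow> norm (H i v) \<le> C"
begin

lemma measurable_selected [measurable (raw)]:
  "s \<in> measurable M (count_space UNIV) \<Longrightarrow> (\<lambda>v. H (s v) v) \<in> borel_measurable M"
  by (rule measurable_compose_countable[OF H_meas])

lemma integrable_selected: "s \<in> measurable M (count_space UNIV) \<Longrightarrow> integrable M (\<lambda>v. H (s v) v)"
  by (rule integrable_const_bound[of _ C]) (use H_bd in auto)

abbreviation integrals :: "('a \<Rightarrow> 'k set) \<Rightarrow> 'c set" where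
  "integrals T \<equiv> (\<lambda>s. \<integral>v. H (s v) v \<partial>M) ` selections M T"

text \<open>A convex combination is realised by using \<open>s1\<close> on a set \<open>B\<close>
  and \<open>s2\<close> elsewhere, where Lyapunov's theorem for the difference of the two integrands
  provides \<open>B\<close>.\<close>

lemma convex_integrals:
  assumes p: "p \<in> borel_measurable M" "\<And>c::real. measure M {v \<in> space M. p v = c} = 0"
  shows "convex (integrals T)"
proof (rule convexI, elim imageE)
  fix x y u w s1 s2 assume uw: "0 \<le> u" "0 \<le> w" "u + w = (1::real)"
    and x: "x = (\<integral>v. H (s1 v) v \<partial>M)" and y: "y = (\<integral>v. H (s2 v) v \<partial>M)"
    and s: "s1 \<in> selections M T" "s2 \<in> selections M T"
  note [measurable] = s[THEN selectionsD(1)]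
  let ?h = "\<lambda>v. H (s1 v) v - H (s2 v) v"
  have bd: "norm (?h v) \<le> 2 * C" if "v \<in> space M" for v
    using norm_triangle_ineq4[of "H (s1 v) v" "H (s2 v) v"] H_bd[OF that, of "s1 v"] H_bd[OF that, of "s2 v"] by simp
  have u: "u \<le> 1" using uw by simp
  obtain B where B[measurable]: "B \<in> sets M" and eq: "(LINT v:B|M. ?h v) = u *\<^sub>R (\<integral>v. ?h v \<partial>M)"
    by (rule Lyapunov_convexity[OF p _ bd uw(1) u]) auto
  define s where "s v = (if v \<in> B then s1 v else s2 v)" for v
  have "s \<in> selections M T"
    unfolding selections_def s_def using s[THEN selectionsD(2)] by auto
  moreover have "(\<integral>v. H (s v) v \<partial>M) = u *\<^sub>R x + w *\<^sub>R y"
  proof -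
    have "(\<integral>v. H (s v) v \<partial>M) = (\<integral>v. H (s2 v) v + indicator B v *\<^sub>R ?h v \<partial>M)"
      by (rule Bochner_Integration.integral_cong) (auto simp: s_def)
    also have "\<dots> = y + (LINT v:B|M. ?h v)"
      unfolding y set_lebesgue_integral_def
      by (intro Bochner_Integration.integral_add integrable_mult_indicator
          Bochner_Integration.integrable_diff integrable_selected) auto
    also have "\<dots> = y + u *\<^sub>R (x - y)"
      unfolding eq x y by (subst Bochner_Integration.integral_diff) (auto intro: integrable_selected)
    also have "\<dots> = u *\<^sub>R x + (1 - u) *\<^sub>R y" by (simp add: algebra_simps)
    also have "1 - u = w" using uw by simp
    finally show ?thesis .
  qed
  ultimately show "u *\<^sub>R x + w *\<^sub>R y \<in> integrals T" by (intro image_eqI[where x = s]) simp_all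
qed

text \<open>A selection whose integral is almost minimal in direction \<open>a\<close> may be redirected to the
  minimisers in that direction without changing the integral much; this reduces closedness to the
  faces of the closure, where the dimension drops.\<close>

lemma closed_integrals:
  assumes p: "p \<in> borel_measurable M" "\<And>c::real. measure M {v \<in> space M. p v = c} = 0"
    and T: "T \<in> measurable M (count_space UNIV)" and ne: "\<And>v. v \<in> space M \<Longrightarrow> T v \<noteq> {}"
  shows "closed (integrals T)"
  using T ne
\<comment> \<open>The shift by 1 makes the measure a natural number even for the empty set, whose
  affine dimension is -1.\<close>
proof (induction "nat (aff_dim (integrals T) + 1)" arbitrary: T rule: less_induct)
  case (less T)
  note T[measurable] = less.prems(1)
  have conv: "convex (integrals T)" by (rule convex_integrals[OF p])
  have "d \<in> integrals T" if d: "d \<in> closure (integrals T)" for d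
  proof (cases "d \<in> rel_interior (integrals T)")
    case True
    then show ?thesis by (rule subsetD[OF rel_interior_subset])
  next
    case False
    \<comment> \<open>Strictness on the relative interior is what later forces the dimension of the
      face to drop.\<close>
    obtain a where a: "a \<noteq> 0" "\<And>y. y \<in> closure (integrals T) \<Longrightarrow> a \<bullet> d \<le> a \<bullet> y"
      "\<And>y. y \<in> rel_interior (integrals T) \<Longrightarrow> a \<bullet> d < a \<bullet> y"
      by (rule supporting_hyperplane_relative_frontier[OF conv d False]) auto
    define T' where "T' v = {i \<in> T v. \<forall>j. j \<in> T v \<longrightarrow> a \<bullet> H i v \<le> a \<bullet> H j v}" for v
    have T'[measurable]: "T' \<in> measurable M (count_space UNIV)"
      by (rule measurable_finite_set_valued) (unfold T'_def mem_Collect_eq, measurable)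
    have ne': "T' v \<noteq> {}" if "v \<in> space M" for v
    proof -
      have "arg_min_on (\<lambda>i. a \<bullet> H i v) (T v) \<in> T' v"
        unfolding T'_def using less.prems(2)[OF that]
        by (auto intro: arg_min_if_finite(1) arg_min_least)
      then show ?thesis by auto
    qed
    define s0 where "s0 v = (SOME i. i \<in> T' v)" for v
    have s0: "s0 \<in> selections M T'" unfolding s0_def by (rule some_in_selections[OF T' ne'])
    have T'_sub: "selections M T' \<subseteq> selections M T" unfolding selections_def T'_def by auto
    note [measurable] = selectionsD(1)[OF s0]
    obtain S where S: "\<And>k. S k \<in> selections M T" and lim: "(\<lambda>k. \<integral>v. H (S k v) v \<partial>M) \<longlonglongrightarrow> d"
    proof -
      obtain y where "\<forall>k. y k \<in> integrals T" "y \<longlonglongrightarrow> d" using d unfolding closure_sequential by blast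
      then obtain S where "\<forall>k. S k \<in> selections M T \<and> y k = (\<integral>v. H (S k v) v \<partial>M)"
        by (auto simp: image_iff Bex_def choice_iff)
      moreover from this have "y = (\<lambda>k. \<integral>v. H (S k v) v \<partial>M)" by auto
      ultimately show ?thesis using \<open>y \<longlonglongrightarrow> d\<close> by (intro that[of S]) auto
    qed
    note [measurable] = S[THEN selectionsD(1)]
    have inner: "(\<integral>v. a \<bullet> H (s v) v \<partial>M) = a \<bullet> (\<integral>v. H (s v) v \<partial>M)" if "s \<in> measurable M (count_space UNIV)" for s
      using integrable_selected[OF that] by (intro integral_inner_right) auto
    have s0_min: "a \<bullet> H (s0 v) v \<le> a \<bullet> H (s v) v" if "s \<in> selections M T" "v \<in> space M" for s v
      using selectionsD(2)[OF s0 that(2)] selectionsD(2)[OF that] by (auto simp: T'_def)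
    have s0_le: "a \<bullet> (\<integral>v. H (s0 v) v \<partial>M) \<le> a \<bullet> (\<integral>v. H (s v) v \<partial>M)" if "s \<in> selections M T" for s
      unfolding inner[OF selectionsD(1)[OF s0], symmetric] inner[OF selectionsD(1)[OF that], symmetric]
      using s0_min[OF that] integrable_selected[OF selectionsD(1)[OF s0]] integrable_selected[OF selectionsD(1)[OF that]]
      by (intro integral_mono) auto
    have ad: "a \<bullet> (\<integral>v. H (s0 v) v \<partial>M) = a \<bullet> d"
    proof (rule antisym)
      have "(\<lambda>k. a \<bullet> (\<integral>v. H (S k v) v \<partial>M)) \<longlonglongrightarrow> a \<bullet> d" by (intro tendsto_intros lim)
      then show "a \<bullet> (\<integral>v. H (s0 v) v \<partial>M) \<le> a \<bullet> d"
        by (rule LIMSEQ_le_const) (use s0_le[OF S] in auto)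
      have "(\<integral>v. H (s0 v) v \<partial>M) \<in> closure (integrals T)"
        by (intro subsetD[OF closure_subset] imageI subsetD[OF T'_sub s0])
      then show "a \<bullet> d \<le> a \<bullet> (\<integral>v. H (s0 v) v \<partial>M)" by (rule a(2))
    qed
    \<comment> \<open>\<open>u k\<close> is the excess of the k-th selection over the minimum in
      direction \<open>a\<close>. It is nonnegative, so its L1 norm is its integral, which tends to
      \<open>a\<close> . d - \<open>a\<close> . d = 0; along a subsequence the excess itself
      vanishes almost everywhere.\<close>
    define u where "u k v = a \<bullet> H (S k v) v - a \<bullet> H (s0 v) v" for k v
    have u_int: "integrable M (u k)" for k
      unfolding u_def using integrable_selected[OF selectionsD(1)[OF s0]] integrable_selected[OF selectionsD(1)[OF S]]
      by (intro Bochner_Integration.integrable_diff integrable_inner_right) auto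
    have "(\<integral>v. norm (u k v) \<partial>M) = a \<bullet> (\<integral>v. H (S k v) v \<partial>M) - a \<bullet> d" for k
    proof -
      have "(\<integral>v. norm (u k v) \<partial>M) = (\<integral>v. a \<bullet> H (S k v) v - a \<bullet> H (s0 v) v \<partial>M)"
        by (rule Bochner_Integration.integral_cong) (use s0_min[OF S] in \<open>auto simp: u_def\<close>)
      also have "\<dots> = (\<integral>v. a \<bullet> H (S k v) v \<partial>M) - (\<integral>v. a \<bullet> H (s0 v) v \<partial>M)"
        using integrable_selected[OF selectionsD(1)[OF s0]] integrable_selected[OF selectionsD(1)[OF S]]
        by (intro Bochner_Integration.integral_diff) auto
      finally show ?thesis by (simp add: inner ad)
    qed
    moreover have "(\<lambda>k. a \<bullet> (\<integral>v. H (S k v) v \<partial>M) - a \<bullet> d) \<longlonglongrightarrow> a \<bullet> d - a \<bullet> d"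
      by (intro tendsto_intros lim)
    ultimately have "(\<lambda>k. \<integral>v. norm (u k v) \<partial>M) \<longlonglongrightarrow> 0" by simp
    then obtain r where r: "strict_mono r" and AE_u: "AE v in M. (\<lambda>k. u (r k) v) \<longlonglongrightarrow> 0"
      using tendsto_L1_AE_subseq[of M u, OF u_int] by blast
    define S' where "S' k v = (if S k v \<in> T' v then S k v else s0 v)" for k v
    have S': "S' k \<in> selections M T'" for k
      unfolding S'_def by (rule redirect_in_selections[OF T' selectionsD(1)[OF S] s0])
    note [measurable] = S'[THEN selectionsD(1)]
    have "(\<lambda>k. \<integral>v. H (S' (r k) v) v - H (S (r k) v) v \<partial>M) \<longlonglongrightarrow> (\<integral>v. 0 \<partial>M)"
    proof (rule integral_dominated_convergence[where w = "\<lambda>_. 2 * C"])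
      show "AE v in M. (\<lambda>k. H (S' (r k) v) v - H (S (r k) v) v) \<longlonglongrightarrow> 0"
        using AE_u AE_space
      proof eventually_elim
        case (elim v)
        \<comment> \<open>The smallest excess of a non-minimising index, positive because there are
          finitely many indices; the 1 only keeps the set nonempty. An excess below \<delta> forces
          the selected index to be a minimiser, so redirecting eventually changes nothing at
          \<open>v\<close>.\<close>
        define \<delta> where "\<delta> = Min (insert 1 ((\<lambda>i. a \<bullet> H i v - a \<bullet> H (s0 v) v) ` (T v - T' v)))"
        have gap: "0 < a \<bullet> H i v - a \<bullet> H (s0 v) v" if i: "i \<in> T v - T' v" for i
        proof -
          obtain j where "j \<in> T v" "a \<bullet> H j v < a \<bullet> H i v" using i by (auto simp: T'_def not_le)
          moreover have "a \<bullet> H (s0 v) v \<le> a \<bullet> H j v"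
            using selectionsD(2)[OF s0 elim(2)] \<open>j \<in> T v\<close> by (auto simp: T'_def)
          ultimately show ?thesis by simp
        qed
        then have "\<delta> > 0" unfolding \<delta>_def by (subst Min_gr_iff) auto
        then have "\<forall>\<^sub>F k in sequentially. u (r k) v < \<delta>" using elim(1) by (intro order_tendstoD) auto
        then have "\<forall>\<^sub>F k in sequentially. H (S' (r k) v) v - H (S (r k) v) v = 0"
        proof eventually_elim
          case (elim k)
          have "S (r k) v \<in> T' v"
          proof (rule ccontr)
            assume "S (r k) v \<notin> T' v"
            then have "S (r k) v \<in> T v - T' v" using selectionsD(2)[OF S \<open>v \<in> space M\<close>] by auto
            then have "\<delta> \<le> u (r k) v" unfolding \<delta>_def u_def by (intro Min_le) auto
            then show False using elim by simp
          qed
          then show ?case by (simp add: S'_def)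
        qed
        then show ?case by (rule tendsto_eventually)
      qed
      show "AE v in M. norm (H (S' (r k) v) v - H (S (r k) v) v) \<le> 2 * C" for k
      proof (rule AE_I2)
        fix v assume "v \<in> space M"
        then show "norm (H (S' (r k) v) v - H (S (r k) v) v) \<le> 2 * C"
          using norm_triangle_ineq4[of "H (S' (r k) v) v" "H (S (r k) v) v"]
            H_bd[of v "S' (r k) v"] H_bd[of v "S (r k) v"] by simp
      qed
    qed auto
    moreover have "(\<integral>v. H (S' (r k) v) v - H (S (r k) v) v \<partial>M)
        = (\<integral>v. H (S' (r k) v) v \<partial>M) - (\<integral>v. H (S (r k) v) v \<partial>M)" for k
      by (intro Bochner_Integration.integral_diff integrable_selected) auto
    ultimately have "(\<lambda>k. (\<integral>v. H (S' (r k) v) v \<partial>M) - (\<integral>v. H (S (r k) v) v \<partial>M)) \<longlonglongrightarrow> 0" by simp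
    from tendsto_add[OF this LIMSEQ_subseq_LIMSEQ[OF lim r]]
    have "(\<lambda>k. \<integral>v. H (S' (r k) v) v \<partial>M) \<longlonglongrightarrow> d" by (simp add: o_def)
    then have d': "d \<in> closure (integrals T')"
      unfolding closure_sequential using S' by (intro exI[of _ "\<lambda>k. \<integral>v. H (S' (r k) v) v \<partial>M"]) auto
    have plane: "integrals T' \<subseteq> {y. a \<bullet> y = a \<bullet> d}"
    proof safe
      fix s assume s: "s \<in> selections M T'"
      have "a \<bullet> H (s v) v = a \<bullet> H (s0 v) v" if "v \<in> space M" for v
        using selectionsD(2)[OF s0 that] selectionsD(2)[OF s that] unfolding T'_def
        by (intro antisym) simp_all
      then have "(\<integral>v. a \<bullet> H (s v) v \<partial>M) = (\<integral>v. a \<bullet> H (s0 v) v \<partial>M)"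
        by (intro Bochner_Integration.integral_cong) auto
      then show "a \<bullet> (\<integral>v. H (s v) v \<partial>M) = a \<bullet> d"
        using ad inner selectionsD(1)[OF s] selectionsD(1)[OF s0] by simp
    qed
    \<comment> \<open>The face lies in the supporting hyperplane, while a relative interior point of
      the larger set lies strictly on one side of it.\<close>
    have "aff_dim (integrals T') < aff_dim (integrals T)"
    proof (rule aff_dim_psubset)
      have sub: "affine hull (integrals T') \<subseteq> affine hull (integrals T)"
        by (intro hull_mono image_mono T'_sub)
      have "integrals T \<noteq> {}" using S[of 0] by auto
      then have "rel_interior (integrals T) \<noteq> {}" using rel_interior_eq_empty[OF conv] by simp
      then obtain y where y: "y \<in> rel_interior (integrals T)" by (meson ex_in_conv)
      have "affine hull (integrals T') \<subseteq> {y. a \<bullet> y = a \<bullet> d}"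
        using plane by (rule hull_minimal) (rule affine_hyperplane)
      then have y1: "y \<notin> affine hull (integrals T')" using a(3)[OF y] by auto
      have y2: "y \<in> affine hull (integrals T)"
        by (rule hull_inc, rule subsetD[OF rel_interior_subset y])
      show "affine hull (integrals T') \<subset> affine hull (integrals T)"
      proof (rule psubsetI[OF sub], rule notI)
        assume "affine hull (integrals T') = affine hull (integrals T)"
        then show False using y1 y2 by simp
      qed
    qed
    then have "nat (aff_dim (integrals T') + 1) < nat (aff_dim (integrals T) + 1)"
      using aff_dim_geq[of "integrals T'"] by linarith
    then have "closed (integrals T')" by (rule less.hyps[OF _ T' ne'])
    then have "d \<in> integrals T'" using d' by simp
    then show ?thesis by (rule subsetD[OF image_mono[OF T'_sub]])
  qed
  then have "closure (integrals T) \<subseteq> integrals T" by (rule subsetI)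
  then show ?case by (simp only: closure_subset_eq)
qed

end

section \<open>Polar coordinates\<close>

lemma nn_integral_lborel_scaleR:
  fixes F :: "'a::euclidean_space \<Rightarrow> ennreal"
  assumes [measurable]: "F \<in> borel_measurable borel" and c: "0 < c"
  shows "(\<integral>\<^sup>+w. F w \<partial>lborel) = ennreal (c ^ DIM('a)) * (\<integral>\<^sup>+z. F (c *\<^sub>R z) \<partial>lborel)"
proof -
  have "(\<integral>\<^sup>+w. F w \<partial>lborel)
    = (\<integral>\<^sup>+w. F w \<partial>density (distr lborel borel (\<lambda>x. 0 + c *\<^sub>R x)) (\<lambda>_. ennreal (\<bar>c\<bar> ^ DIM('a))))"
    using lborel_affine[of c "0::'a"] c by simp
  then show ?thesis
    using c by (simp add: nn_integral_density nn_integral_cmult nn_integral_distr)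
qed

text \<open>This tail is what remains in \<open>nn_integral_polar\<close> when the scaling parameter
  is integrated out at a fixed point of norm \<open>a\<close>.\<close>

lemma nn_integral_inverse_power_tail:
  assumes a: "0 < a" and n: "0 < n"
  shows "(\<integral>\<^sup>+s. ennreal (1 / s ^ Suc n) * indicator {a<..} s \<partial>lborel) = ennreal (1 / (real n * a ^ n))"
proof -
  have "(\<integral>\<^sup>+s. ennreal (1 / s ^ Suc n) * indicator {a<..} s \<partial>lborel)
      = (\<integral>\<^sup>+s. ennreal (1 / s ^ Suc n) * indicator {a..} s \<partial>lborel)"
  proof (rule nn_integral_cong_AE)
    show "AE s in lborel. ennreal (1 / s ^ Suc n) * indicator {a<..} s
        = ennreal (1 / s ^ Suc n) * indicator {a..} s"
      using AE_lborel_singleton[of a] by eventually_elim (auto simp: indicator_def)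
  qed
  also have "\<dots> = ennreal (0 - (- (1 / (real n * a ^ n))))"
  proof (rule nn_integral_FTC_atLeast)
    fix s assume s: "a \<le> s"
    show "((\<lambda>s. - (1 / (real n * s ^ n))) has_real_derivative 1 / s ^ Suc n) (at s)"
    proof -
      define t where "t = s ^ (n - 1)"
      have t: "t > 0" and s0: "s > 0" using a s by (auto simp: t_def)
      have sn: "s ^ n = t * s" using n by (cases n) (auto simp: t_def)
      have "((\<lambda>s. - (1 / (real n * s ^ n))) has_real_derivative
          real n * (real n * s ^ (n - 1)) / (real n * s ^ n)^2) (at s)"
        using a s n by (auto intro!: derivative_eq_intros simp: power2_eq_square)
      also have "real n * (real n * s ^ (n - 1)) / (real n * s ^ n)^2 = 1 / s ^ Suc n"
        using t s0 n unfolding power_Suc sn t_def[symmetric] by (simp add: field_simps power2_eq_square)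
      finally show ?thesis .
    qed
    show "0 \<le> 1 / s ^ Suc n" using a s by simp
  next
    have "filterlim (\<lambda>s::real. real n * s ^ n) at_top at_top"
      using n by (intro filterlim_tendsto_pos_mult_at_top[OF tendsto_const] filterlim_pow_at_top filterlim_ident) auto
    then have "((\<lambda>s::real. inverse (real n * s ^ n)) \<longlongrightarrow> 0) at_top"
      by (rule tendsto_inverse_0_at_top)
    from tendsto_minus[OF this]
    show "((\<lambda>s::real. - (1 / (real n * s ^ n))) \<longlongrightarrow> 0) at_top"
      by (simp add: divide_inverse)
  qed simp
  finally show ?thesis by simp
qed

text \<open>Writing the spherical mean as a mean over the ball and substituting \<open>r = s \<parallel>z\<parallel>\<close> turns the
  claim into two applications of Tonelli's theorem.\<close>

lemma nn_integral_polar: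
  fixes F :: "'a::euclidean_space \<Rightarrow> ennreal"
  assumes [measurable]: "F \<in> borel_measurable borel"
  shows "(\<integral>\<^sup>+w. F w \<partial>lborel) = ennreal (real DIM('a) * measure lborel (ball (0::'a) 1)) *
    (\<integral>\<^sup>+v. (\<integral>\<^sup>+r. ennreal (r ^ (DIM('a) - 1)) * F (r *\<^sub>R v) * indicator {0<..} r \<partial>lborel) \<partial>uniform_sphere)"
proof -
  define n where "n = DIM('a)"
  have n: "0 < n" unfolding n_def by simp
  define vol where "vol = measure lborel (ball (0::'a) 1)"
  have em: "emeasure lborel (ball (0::'a) 1) = ennreal vol"
    unfolding vol_def using emeasure_unit_ball(2)[where 'a='a] by (simp add: emeasure_eq_ennreal_measure)
  have vol: "0 < vol"
    using emeasure_unit_ball(1)[where 'a='a] em by (metis ennreal_0 ennreal_neg less_eq_real_def not_le)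
  define K where "K v = (\<integral>\<^sup>+r. ennreal (r ^ (n - 1)) * F (r *\<^sub>R v) * indicator {0<..} r \<partial>lborel)" for v :: 'a
  have [measurable]: "K \<in> borel_measurable borel" unfolding K_def by measurable
  have subst: "K (z /\<^sub>R norm z) = (\<integral>\<^sup>+s. ennreal (s ^ (n - 1)) * ennreal (norm z ^ n) * F (s *\<^sub>R z) * indicator {0<..} s \<partial>lborel)"
    if z: "z \<noteq> 0" for z
  proof -
    have "K (z /\<^sub>R norm z) = ennreal \<bar>norm z\<bar> * (\<integral>\<^sup>+s. ennreal ((0 + norm z * s) ^ (n - 1)) *
        F ((0 + norm z * s) *\<^sub>R (z /\<^sub>R norm z)) * indicator {0<..} (0 + norm z * s) \<partial>lborel)"
      unfolding K_def by (rule nn_integral_real_affine) (use z in auto)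
    also have "\<dots> = (\<integral>\<^sup>+s. ennreal (norm z) * (ennreal ((norm z * s) ^ (n - 1)) *
        F ((norm z * s) *\<^sub>R (z /\<^sub>R norm z)) * indicator {0<..} (norm z * s)) \<partial>lborel)"
      by (subst nn_integral_cmult) auto
    also have "\<dots> = (\<integral>\<^sup>+s. ennreal (s ^ (n - 1)) * ennreal (norm z ^ n) * F (s *\<^sub>R z) * indicator {0<..} s \<partial>lborel)"
    proof (rule nn_integral_cong)
      fix s :: real
      show "ennreal (norm z) * (ennreal ((norm z * s) ^ (n - 1)) *
          F ((norm z * s) *\<^sub>R (z /\<^sub>R norm z)) * indicator {0<..} (norm z * s))
        = ennreal (s ^ (n - 1)) * ennreal (norm z ^ n) * F (s *\<^sub>R z) * indicator {0<..} s"
      proof (cases "0 < s")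
        case True
        have "ennreal (norm z) * ennreal ((norm z * s) ^ (n - 1)) = ennreal (norm z * (norm z * s) ^ (n - 1))"
          by (simp add: ennreal_mult')
        also have "norm z * (norm z * s) ^ (n - 1) = s ^ (n - 1) * norm z ^ n"
          using n by (cases n) (auto simp: power_mult_distrib)
        also have "ennreal \<dots> = ennreal (s ^ (n - 1)) * ennreal (norm z ^ n)"
          using True by (simp add: ennreal_mult')
        finally have *: "ennreal (norm z) * ennreal ((norm z * s) ^ (n - 1)) = ennreal (s ^ (n - 1)) * ennreal (norm z ^ n)" .
        have "(norm z * s) *\<^sub>R (z /\<^sub>R norm z) = s *\<^sub>R z" using z by simp
        moreover have "0 < norm z * s" using True z by simp
        ultimately show ?thesis using True unfolding mult.assoc[symmetric] * by (simp del: scaleR_scaleR)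
      next
        case False
        then have "\<not> 0 < norm z * s" using z by (simp add: zero_less_mult_iff)
        then show ?thesis using False by simp
      qed
    qed
    finally show ?thesis .
  qed
  \<comment> \<open>The substitution w = s z for fixed s turns s^(n-1) \<open>norm z\<close>^n dz
    into \<open>norm w\<close>^n s^(-n-1) dw, and the unit ball becomes the condition
    \<open>norm w\<close> < s.\<close>
  have inner: "(\<integral>\<^sup>+z. ennreal (s ^ (n - 1)) * ennreal (norm z ^ n) * F (s *\<^sub>R z) * indicator {0<..} s * indicator {..<1} (norm z) \<partial>lborel)
      = (\<integral>\<^sup>+w. ennreal (norm w ^ n) * F w * (ennreal (1 / s ^ Suc n) * indicator {0<..} (s - norm w)) \<partial>lborel)" for s :: real
  proof (cases "0 < s")
    case False
    then have "\<not> norm w < s" for w :: 'a using norm_ge_zero[of w] by linarith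
    with False show ?thesis by simp
  next
    case True
    have "(\<integral>\<^sup>+w. ennreal (norm w ^ n) * F w * (ennreal (1 / s ^ Suc n) * indicator {0<..} (s - norm w)) \<partial>lborel)
      = ennreal (s ^ n) * (\<integral>\<^sup>+z. ennreal (norm (s *\<^sub>R z) ^ n) * F (s *\<^sub>R z) * (ennreal (1 / s ^ Suc n) * indicator {0<..} (s - norm (s *\<^sub>R z))) \<partial>lborel)"
      unfolding n_def by (rule nn_integral_lborel_scaleR[OF _ True]) measurable
    also have "\<dots> = (\<integral>\<^sup>+z. ennreal (s ^ n) * (ennreal (norm (s *\<^sub>R z) ^ n) * F (s *\<^sub>R z) * (ennreal (1 / s ^ Suc n) * indicator {0<..} (s - norm (s *\<^sub>R z)))) \<partial>lborel)"
      by (subst nn_integral_cmult) auto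
    also have "\<dots> = (\<integral>\<^sup>+z. ennreal (s ^ (n - 1)) * ennreal (norm z ^ n) * F (s *\<^sub>R z) * indicator {0<..} s * indicator {..<1} (norm z) \<partial>lborel)"
    proof (rule nn_integral_cong)
      fix z :: 'a
      have ind: "(indicator {0<..} (s - norm (s *\<^sub>R z)) :: ennreal) = indicator {..<1} (norm z)"
        using True by (auto simp: indicator_def)
      have "ennreal (s ^ n) * (ennreal (norm (s *\<^sub>R z) ^ n) * ennreal (1 / s ^ Suc n))
          = ennreal (s ^ n * (norm (s *\<^sub>R z) ^ n * (1 / s ^ Suc n)))"
        using True by (subst ennreal_mult', simp, subst ennreal_mult') simp_all
      also have "s ^ n * (norm (s *\<^sub>R z) ^ n * (1 / s ^ Suc n)) = s ^ (n - 1) * norm z ^ n"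
        using True n by (cases n) (auto simp: power_mult_distrib field_simps)
      also have "ennreal \<dots> = ennreal (s ^ (n - 1)) * ennreal (norm z ^ n)"
        using True by (simp add: ennreal_mult')
      finally have *: "ennreal (s ^ n) * (ennreal (norm (s *\<^sub>R z) ^ n) * ennreal (1 / s ^ Suc n))
          = ennreal (s ^ (n - 1)) * ennreal (norm z ^ n)" .
      have "a * (b * x * (c * y)) = a * (b * c) * x * y" for a b c x y :: ennreal by (simp add: mult_ac)
      then show "ennreal (s ^ n) * (ennreal (norm (s *\<^sub>R z) ^ n) * F (s *\<^sub>R z) * (ennreal (1 / s ^ Suc n) * indicator {0<..} (s - norm (s *\<^sub>R z))))
        = ennreal (s ^ (n - 1)) * ennreal (norm z ^ n) * F (s *\<^sub>R z) * indicator {0<..} s * indicator {..<1} (norm z)"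
        unfolding ind by (simp only: *) (use True in simp)
    qed
    finally show ?thesis by simp
  qed
  \<comment> \<open>Integrating s over (\<open>norm w\<close>, infinity) produces exactly the power
    that cancels \<open>norm w ^ n\<close>, so that \<open>F\<close> is left with the constant
    weight 1 / n.\<close>
  have tail: "(\<integral>\<^sup>+s. ennreal (norm w ^ n) * F w * (ennreal (1 / s ^ Suc n) * indicator {0<..} (s - norm w)) \<partial>lborel)
      = ennreal (1 / n) * F w" if w: "w \<noteq> 0" for w :: 'a
  proof -
    have "(\<integral>\<^sup>+s. ennreal (norm w ^ n) * F w * (ennreal (1 / s ^ Suc n) * indicator {0<..} (s - norm w)) \<partial>lborel)
      = ennreal (norm w ^ n) * F w * ennreal (1 / (real n * norm w ^ n))"
      by (subst nn_integral_cmult)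
        (use nn_integral_inverse_power_tail[of "norm w" n] w n in \<open>auto simp: indicator_def greaterThan_def\<close>)
    also have "\<dots> = ennreal (norm w ^ n * (1 / (real n * norm w ^ n))) * F w"
      by (subst ennreal_mult') (simp_all only: mult_ac zero_le_power norm_ge_zero)
    also have "norm w ^ n * (1 / (real n * norm w ^ n)) = 1 / n" using w by simp
    finally show ?thesis .
  qed
  have "(\<integral>\<^sup>+v. K v \<partial>uniform_sphere) = (\<integral>\<^sup>+z. K (z /\<^sub>R norm z) \<partial>uniform_measure lborel (ball 0 1))"
    unfolding uniform_sphere_def by (subst nn_integral_distr) auto
  also have "\<dots> = (\<integral>\<^sup>+z. K (z /\<^sub>R norm z) * indicator {..<1} (norm z) \<partial>lborel) / ennreal vol"
    by (subst nn_integral_uniform_measure) (auto simp: em indicator_def)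
  also have "(\<integral>\<^sup>+z. K (z /\<^sub>R norm z) * indicator {..<1} (norm z) \<partial>lborel)
    = (\<integral>\<^sup>+z. (\<integral>\<^sup>+s. ennreal (s ^ (n - 1)) * ennreal (norm z ^ n) * F (s *\<^sub>R z) * indicator {0<..} s * indicator {..<1} (norm z) \<partial>lborel) \<partial>lborel)"
  proof (rule nn_integral_cong_AE)
    show "AE z in lborel. K (z /\<^sub>R norm z) * indicator {..<1} (norm z)
      = (\<integral>\<^sup>+s. ennreal (s ^ (n - 1)) * ennreal (norm z ^ n) * F (s *\<^sub>R z) * indicator {0<..} s * indicator {..<1} (norm z) \<partial>lborel)"
      using AE_lborel_singleton[of "0::'a"]
    proof eventually_elim
      case (elim z)
      then show ?case by (subst nn_integral_multc) (auto simp: subst)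
    qed
  qed
  also have "\<dots> = (\<integral>\<^sup>+s. (\<integral>\<^sup>+z. ennreal (s ^ (n - 1)) * ennreal (norm z ^ n) * F (s *\<^sub>R z) * indicator {0<..} s * indicator {..<1} (norm z) \<partial>lborel) \<partial>lborel)"
    by (rule lborel_pair.Fubini') measurable
  also have "\<dots> = (\<integral>\<^sup>+s. (\<integral>\<^sup>+w. ennreal (norm w ^ n) * F w * (ennreal (1 / s ^ Suc n) * indicator {0<..} (s - norm w)) \<partial>lborel) \<partial>lborel)"
    unfolding inner ..
  also have "\<dots> = (\<integral>\<^sup>+w. (\<integral>\<^sup>+s. ennreal (norm w ^ n) * F w * (ennreal (1 / s ^ Suc n) * indicator {0<..} (s - norm w)) \<partial>lborel) \<partial>lborel)"
    by (rule lborel_pair.Fubini') measurable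
  also have "\<dots> = (\<integral>\<^sup>+w. ennreal (1 / n) * F w \<partial>lborel)"
    by (rule nn_integral_cong_AE) (use AE_lborel_singleton[of "0::'a"] in eventually_elim, rule tail)
  also have "\<dots> = ennreal (1 / n) * (\<integral>\<^sup>+w. F w \<partial>lborel)" by (rule nn_integral_cmult) simp
  finally have "ennreal (real n * vol) * (\<integral>\<^sup>+v. K v \<partial>uniform_sphere)
    = ennreal (real n * vol) * (ennreal (1 / n) * (\<integral>\<^sup>+w. F w \<partial>lborel) / ennreal vol)" by simp
  also have "\<dots> = ennreal (real n * vol) * (ennreal (1 / n) * ennreal (1 / vol)) * (\<integral>\<^sup>+w. F w \<partial>lborel)"
    using vol by (simp add: divide_ennreal_def inverse_ennreal mult_ac divide_inverse)
  also have "ennreal (real n * vol) * (ennreal (1 / n) * ennreal (1 / vol)) = ennreal (real n * vol * (1 / n * (1 / vol)))"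
    using vol by (simp add: ennreal_mult'[symmetric])
  also have "real n * vol * (1 / n * (1 / vol)) = 1" using n vol by simp
  finally show ?thesis unfolding K_def vol_def n_def by simp
qed

text \<open>This is the surface area of the unit sphere, the constant that appears in
  \<open>theta\<close>; the functional equation of Gamma absorbs the factor n / 2.\<close>

lemma DIM_times_unit_ball_volume:
  "real DIM('a) * measure lborel (ball (0::'a::euclidean_space) 1)
    = 2 * pi powr (real DIM('a) / 2) / Gamma (real DIM('a) / 2)"
proof -
  have pos: "real DIM('a) / 2 > 0" by simp
  have "measure lborel (ball (0::'a) 1) = unit_ball_vol (real DIM('a))"
    using content_ball[of 1 "0::'a"] by simp
  also have "\<dots> = pi powr (real DIM('a) / 2) / Gamma (real DIM('a) / 2 + 1)"
    by (simp add: unit_ball_vol_def)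
  also have "Gamma (real DIM('a) / 2 + 1) = real DIM('a) / 2 * Gamma (real DIM('a) / 2)"
    using pos nonpos_Ints_nonpos[of "real DIM('a) / 2"] by (intro Gamma_plus1) linarith
  finally show ?thesis by simp
qed

text \<open>Smearing out along \<open>e\<close> makes the shear a translation of the smearing parameter.\<close>

lemma nn_integral_lborel_shear:
  fixes F :: "'a::euclidean_space \<Rightarrow> ennreal" and \<phi> :: "'a \<Rightarrow> real"
  assumes [measurable]: "F \<in> borel_measurable borel" "\<phi> \<in> borel_measurable borel"
    and e: "e \<in> Basis" and inv: "\<And>x t. \<phi> (x + t *\<^sub>R e) = \<phi> x"
  shows "(\<integral>\<^sup>+x. F (x + \<phi> x *\<^sub>R e) \<partial>lborel) = (\<integral>\<^sup>+x. F x \<partial>lborel)"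
proof -
  define W :: "real \<Rightarrow> ennreal" where "W = indicator {0..1}"
  have [measurable]: "W \<in> borel_measurable borel" unfolding W_def by simp
  have W1: "(\<integral>\<^sup>+t. W (s + t) \<partial>lborel) = 1" for s
    using nn_integral_real_affine[of W 1 s] by (simp add: W_def)
  have transl: "(\<integral>\<^sup>+x. G x \<partial>lborel) = (\<integral>\<^sup>+x. G (x + a) \<partial>lborel)"
    if [measurable]: "G \<in> borel_measurable borel" for G :: "'a \<Rightarrow> ennreal" and a
  proof -
    have "(\<integral>\<^sup>+x. G x \<partial>lborel) = (\<integral>\<^sup>+x. G x \<partial>distr lborel borel ((+) a))"
      by (simp add: lborel_distr_plus)
    then show ?thesis by (simp add: nn_integral_distr add.commute)
  qed
  \<comment> \<open>The weight W(x . e - t) has t-integral 1, so it may be inserted; translating x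
    by t e then turns the integral into an average over lines parallel to \<open>e\<close>. On such
    a line \<phi> is constant, so there the shear is a mere shift of t.\<close>
  have smear: "(\<integral>\<^sup>+x. G x \<partial>lborel) = (\<integral>\<^sup>+x. W (x \<bullet> e) * (\<integral>\<^sup>+t. G (x + t *\<^sub>R e) \<partial>lborel) \<partial>lborel)"
    if [measurable]: "G \<in> borel_measurable borel" for G :: "'a \<Rightarrow> ennreal"
  proof -
    have "(\<integral>\<^sup>+x. G x \<partial>lborel) = (\<integral>\<^sup>+x. (\<integral>\<^sup>+t. G x * W (x \<bullet> e + - 1 * t) \<partial>lborel) \<partial>lborel)"
    proof (rule nn_integral_cong)
      fix x :: 'a
      have "(\<integral>\<^sup>+t. W (x \<bullet> e + - 1 * t) \<partial>lborel) = 1"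
        using nn_integral_real_affine[of W "- 1" "x \<bullet> e"] W1[of 0] by simp
      then show "G x = (\<integral>\<^sup>+t. G x * W (x \<bullet> e + - 1 * t) \<partial>lborel)"
        by (subst nn_integral_cmult) auto
    qed
    also have "\<dots> = (\<integral>\<^sup>+t. (\<integral>\<^sup>+x. G x * W (x \<bullet> e + - 1 * t) \<partial>lborel) \<partial>lborel)"
      by (rule lborel_pair.Fubini') measurable
    also have "\<dots> = (\<integral>\<^sup>+t. (\<integral>\<^sup>+x. G (x + t *\<^sub>R e) * W (x \<bullet> e) \<partial>lborel) \<partial>lborel)"
    proof (rule nn_integral_cong)
      fix t :: real
      have "(\<integral>\<^sup>+x. G x * W (x \<bullet> e + - 1 * t) \<partial>lborel)
          = (\<integral>\<^sup>+x. G (x + t *\<^sub>R e) * W ((x + t *\<^sub>R e) \<bullet> e + - 1 * t) \<partial>lborel)"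
        by (rule transl) measurable
      then show "(\<integral>\<^sup>+x. G x * W (x \<bullet> e + - 1 * t) \<partial>lborel) = (\<integral>\<^sup>+x. G (x + t *\<^sub>R e) * W (x \<bullet> e) \<partial>lborel)"
        using e by (simp add: inner_add_left)
    qed
    also have "\<dots> = (\<integral>\<^sup>+x. (\<integral>\<^sup>+t. G (x + t *\<^sub>R e) * W (x \<bullet> e) \<partial>lborel) \<partial>lborel)"
      by (rule lborel_pair.Fubini') measurable
    also have "\<dots> = (\<integral>\<^sup>+x. W (x \<bullet> e) * (\<integral>\<^sup>+t. G (x + t *\<^sub>R e) \<partial>lborel) \<partial>lborel)"
      by (subst nn_integral_multc) (simp_all add: mult.commute)
    finally show ?thesis .
  qed
  have "(\<integral>\<^sup>+t. F ((x + t *\<^sub>R e) + \<phi> (x + t *\<^sub>R e) *\<^sub>R e) \<partial>lborel) = (\<integral>\<^sup>+t. F (x + t *\<^sub>R e) \<partial>lborel)" for x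
  proof -
    have "(\<integral>\<^sup>+t. F (x + t *\<^sub>R e) \<partial>lborel) = (\<integral>\<^sup>+t. F (x + (\<phi> x + 1 * t) *\<^sub>R e) \<partial>lborel)"
      using nn_integral_real_affine[of "\<lambda>t. F (x + t *\<^sub>R e)" 1 "\<phi> x"] by simp
    then show ?thesis by (simp add: inv scaleR_add_left add_ac)
  qed
  then show ?thesis
    by (subst (1 2) smear) auto
qed

text \<open>Induction over elementary factors: the formula is compatible with products, a zero row
  is excluded by the determinant, diagonal matrices scale the coordinates, swaps permute them, and
  the remaining factors are shears of determinant 1. \<open>F\<close> is quantified inside the
  induction because the product case applies the second factor to \<open>F\<close> composed with the
  first.\<close>

lemma nn_integral_lborel_matrix:
  fixes A :: "real^'n^'n" and F :: "real^'n \<Rightarrow> ennreal"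
  assumes "det A \<noteq> 0" and "F \<in> borel_measurable borel"
  shows "(\<integral>\<^sup>+z. F z \<partial>lborel) = ennreal \<bar>det A\<bar> * (\<integral>\<^sup>+w. F (A *v w) \<partial>lborel)"
proof -
  have meas[measurable]: "(\<lambda>w. A *v w) \<in> borel_measurable borel" for A :: "real^'n^'n"
    by (intro borel_measurable_continuous_onI linear_continuous_on) (simp add: linear_linear)
  have "\<forall>F\<in>borel_measurable borel. det A \<noteq> 0 \<longrightarrow>
      (\<integral>\<^sup>+z. F z \<partial>lborel) = ennreal \<bar>det A\<bar> * (\<integral>\<^sup>+w. F (A *v w) \<partial>lborel)"
  proof (induction A rule: induct_matrix_elementary)
    case (1 A B)
    show ?case
    proof safe
      fix F :: "real^'n \<Rightarrow> ennreal" assume [measurable]: "F \<in> borel_measurable borel" and "det (A ** B) \<noteq> 0"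
      then have nz: "det A \<noteq> 0" "det B \<noteq> 0" by (auto simp: det_mul)
      have "(\<integral>\<^sup>+z. F z \<partial>lborel) = ennreal \<bar>det A\<bar> * (\<integral>\<^sup>+w. F (A *v w) \<partial>lborel)"
        by (rule 1(1)[rule_format]) (use nz in auto)
      also have "(\<integral>\<^sup>+w. F (A *v w) \<partial>lborel) = ennreal \<bar>det B\<bar> * (\<integral>\<^sup>+w. F (A *v (B *v w)) \<partial>lborel)"
        by (rule 1(2)[rule_format]) (use nz in auto)
      finally show "(\<integral>\<^sup>+z. F z \<partial>lborel) = ennreal \<bar>det (A ** B)\<bar> * (\<integral>\<^sup>+w. F (A ** B *v w) \<partial>lborel)"
        by (simp add: det_mul abs_mult ennreal_mult' matrix_vector_mul_assoc mult.assoc)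
    qed
  next
    case (2 A i)
    then show ?case by (simp add: det_zero_row)
  next
    case (3 A)
    show ?case
    proof safe
      fix F :: "real^'n \<Rightarrow> ennreal" assume [measurable]: "F \<in> borel_measurable borel" and nz: "det A \<noteq> 0"
      have det: "det A = (\<Prod>i\<in>UNIV. A$i$i)" by (rule det_diagonal) (use 3 in auto)
      define c where "c b = (A *v b) \<bullet> b" for b
      have c: "c (axis i 1) = A$i$i" for i
        by (simp add: c_def inner_axis matrix_vector_mult_basis column_def)
      have c_nz: "c b \<noteq> 0" if "b \<in> Basis" for b
        using that nz unfolding det by (auto simp: Basis_vec_def c)
      have prod: "(\<Prod>b\<in>Basis. \<bar>c b\<bar>) = \<bar>det A\<bar>"
      proof -
        have B: "(Basis :: (real^'n) set) = (\<lambda>i. axis i 1) ` UNIV" by (auto simp: Basis_vec_def)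
        have "inj (\<lambda>i::'n. axis i (1::real))" by (auto intro!: injI simp: axis_eq_axis)
        then show ?thesis unfolding B det by (simp add: prod.reindex c abs_prod)
      qed
      have A: "0 + (\<Sum>b\<in>Basis. (c b * (w \<bullet> b)) *\<^sub>R b) = A *v w" for w
      proof (rule euclidean_eqI)
        fix b :: "real^'n" assume b: "b \<in> Basis"
        then obtain i where i: "b = axis i 1" by (auto simp: Basis_vec_def)
        have "(A *v w) $ i = (\<Sum>j\<in>UNIV. if j = i then A$i$i * w$i else 0)"
          unfolding matrix_vector_mult_def vec_lambda_beta by (rule sum.cong) (use 3 in auto)
        then have "(A *v w) $ i = A$i$i * w$i" by simp
        then show "(0 + (\<Sum>b\<in>Basis. (c b * (w \<bullet> b)) *\<^sub>R b)) \<bullet> b = (A *v w) \<bullet> b"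
          unfolding add_0_left inner_sum_left_Basis[OF b] by (simp add: i c inner_axis)
      qed
      have "(\<integral>\<^sup>+z. F z \<partial>lborel) = (\<integral>\<^sup>+z. F z \<partial>density (distr lborel borel ((*v) A)) (\<lambda>_. ennreal \<bar>det A\<bar>))"
        using lborel_affine_euclidean[of c 0] c_nz unfolding A prod by simp
      then show "(\<integral>\<^sup>+z. F z \<partial>lborel) = ennreal \<bar>det A\<bar> * (\<integral>\<^sup>+w. F (A *v w) \<partial>lborel)"
        by (simp add: nn_integral_density nn_integral_cmult nn_integral_distr)
    qed
  next
    case (4 m n)
    let ?t = "Transposition.transpose m n"
    let ?P = "(\<chi> i j. mat 1 $ i $ ?t j) :: real^'n^'n"
    have det: "\<bar>det ?P\<bar> = 1"
      using det_permute_columns[OF permutes_swap_id[of m UNIV n], of "mat 1 :: real^'n^'n"]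
      by (simp add: abs_mult sign_def split: if_splits)
    have t_eq: "i = ?t j \<longleftrightarrow> j = ?t i" for i j by (metis transpose_involutory)
    have P: "(?P *v w) $ i = w $ ?t i" for w i
    proof -
      have "(?P *v w) $ i = (\<Sum>j\<in>UNIV. if j = ?t i then w $ j else 0)"
        unfolding matrix_vector_mult_def vec_lambda_beta
        by (rule sum.cong) (use t_eq[of i] in \<open>auto simp: mat_def\<close>)
      then show ?thesis by simp
    qed
    have P_inner: "(?P *v u) \<bullet> b = u \<bullet> (?P *v b)" and P_Basis: "?P *v b \<in> Basis" and P_P: "?P *v (?P *v u) = u"
      if b: "b \<in> Basis" for u b
    proof -
      obtain i where i: "b = axis i 1" using b by (auto simp: Basis_vec_def)
      have "?P *v b = axis (?t i) 1" unfolding i by (auto simp: vec_eq_iff P axis_def)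
      then show "(?P *v u) \<bullet> b = u \<bullet> (?P *v b)" "?P *v b \<in> Basis" by (auto simp: i inner_axis P)
      show "?P *v (?P *v u) = u" by (simp add: vec_eq_iff P)
    qed
    \<comment> \<open>A coordinate swap maps boxes to boxes with the same side lengths, and values
      on boxes determine Lebesgue measure.\<close>
    have lb: "lborel = distr lborel borel (\<lambda>w. ?P *v w)"
    proof (rule lborel_eqI)
      fix l u :: "real^'n" assume lu: "\<And>b. b \<in> Basis \<Longrightarrow> l \<bullet> b \<le> u \<bullet> b"
      have "(\<lambda>w. ?P *v w) -` box l u = box (?P *v l) (?P *v u)"
      proof (rule set_eqI)
        fix x
        have "(\<forall>i. l $ i < x $ ?t i \<and> x $ ?t i < u $ i) \<longleftrightarrow> (\<forall>i. l $ ?t i < x $ i \<and> x $ i < u $ ?t i)"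
          by (metis transpose_involutory)
        then show "x \<in> (\<lambda>w. ?P *v w) -` box l u \<longleftrightarrow> x \<in> box (?P *v l) (?P *v u)"
          by (simp add: mem_box_cart P)
      qed
      then have "emeasure (distr lborel borel (\<lambda>w. ?P *v w)) (box l u) = emeasure lborel (box (?P *v l) (?P *v u))"
        by (subst emeasure_distr) auto
      also have "\<dots> = (\<Prod>b\<in>Basis. (?P *v u - ?P *v l) \<bullet> b)"
        using lu P_Basis by (intro emeasure_lborel_box) (simp add: P_inner)
      also have "(\<Prod>b\<in>Basis. (?P *v u - ?P *v l) \<bullet> b) = (\<Prod>b\<in>Basis. (u - l) \<bullet> b)"
        by (rule prod.reindex_bij_witness[of _ "\<lambda>b. ?P *v b" "\<lambda>b. ?P *v b"])
          (auto simp: P_P P_Basis P_inner inner_diff_left)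
      finally show "emeasure (distr lborel borel (\<lambda>w. ?P *v w)) (box l u) = (\<Prod>b\<in>Basis. (u - l) \<bullet> b)" .
    qed simp
    show ?case
    proof safe
      fix F :: "real^'n \<Rightarrow> ennreal" assume [measurable]: "F \<in> borel_measurable borel"
      show "(\<integral>\<^sup>+z. F z \<partial>lborel) = ennreal \<bar>det ?P\<bar> * (\<integral>\<^sup>+w. F (?P *v w) \<partial>lborel)"
        unfolding det by (subst lb) (simp add: nn_integral_distr)
    qed
  next
    case (5 m n c)
    let ?E = "(\<chi> i j. if i = m \<and> j = n then c else of_bool (i = j)) :: real^'n^'n"
    have "?E = (\<chi> k. if k = m then row m (mat 1) + c *s row n (mat 1) else row k (mat 1 :: real^'n^'n))"
      using 5 by (auto simp: vec_eq_iff row_def mat_def)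
    then have det: "det ?E = 1"
      using det_row_operation[OF 5, of "mat 1 :: real^'n^'n" c] by simp
    have E: "?E *v w = w + (c * w $ n) *\<^sub>R axis m 1" for w
    proof (rule vec_eq_iff[THEN iffD2], rule allI)
      fix i
      have "(?E *v w) $ i = (\<Sum>j\<in>UNIV. (if j = i then w $ i else 0) + (if j = n then (if i = m then c * w $ n else 0) else 0))"
        unfolding matrix_vector_mult_def using 5 by (auto intro!: sum.cong)
      then show "(?E *v w) $ i = (w + (c * w $ n) *\<^sub>R axis m 1) $ i"
        by (simp add: sum.distrib axis_def)
    qed
    show ?case
    proof safe
      fix F :: "real^'n \<Rightarrow> ennreal" assume [measurable]: "F \<in> borel_measurable borel"
      have "(\<integral>\<^sup>+w. F (w + (c * w $ n) *\<^sub>R axis m 1) \<partial>lborel) = (\<integral>\<^sup>+z. F z \<partial>lborel)"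
      proof (rule nn_integral_lborel_shear)
        show "axis m 1 \<in> (Basis :: (real^'n) set)" by (simp add: axis_in_Basis_iff)
        show "c * (x + t *\<^sub>R axis m 1) $ n = c * x $ n" for x t using 5 by (simp add: axis_def)
      qed auto
      then show "(\<integral>\<^sup>+z. F z \<partial>lborel) = ennreal \<bar>det ?E\<bar> * (\<integral>\<^sup>+w. F (?E *v w) \<partial>lborel)"
        unfolding det E by simp
    qed
  qed
  with assms show ?thesis by blast
qed

lemma nn_integral_polar_linear:
  fixes L :: "real^'m^'m" and F :: "real^'m \<Rightarrow> ennreal"
  assumes L: "invertible L" and F[measurable]: "F \<in> borel_measurable borel"
  shows "(\<integral>\<^sup>+z. F z \<partial>lborel) = (\<integral>\<^sup>+v. (\<integral>\<^sup>+r.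
    ennreal (2 * pi powr (real CARD('m) / 2) * \<bar>det L\<bar> / Gamma (real CARD('m) / 2) * r ^ (CARD('m) - 1))
      * F (r *\<^sub>R (L *v v)) * indicator {0<..} r \<partial>lborel) \<partial>uniform_sphere)"
proof -
  let ?c = "2 * pi powr (real CARD('m) / 2) / Gamma (real CARD('m) / 2)"
  have c: "?c \<ge> 0" by (intro divide_nonneg_pos Gamma_real_pos) auto
  have [measurable]: "(\<lambda>w. L *v w) \<in> borel_measurable borel"
    by (intro borel_measurable_continuous_onI linear_continuous_on) (simp add: linear_linear)
  have "(\<integral>\<^sup>+z. F z \<partial>lborel) = ennreal \<bar>det L\<bar> * (\<integral>\<^sup>+w. F (L *v w) \<partial>lborel)"
    using L F by (intro nn_integral_lborel_matrix) (simp_all add: invertible_det_nz)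
  also have "(\<integral>\<^sup>+w. F (L *v w) \<partial>lborel) = ennreal ?c * (\<integral>\<^sup>+v. (\<integral>\<^sup>+r. ennreal (r ^ (CARD('m) - 1)) * F (L *v (r *\<^sub>R v)) * indicator {0<..} r \<partial>lborel) \<partial>uniform_sphere)"
    using nn_integral_polar[of "\<lambda>w. F (L *v w)"] DIM_times_unit_ball_volume[where 'a="real^'m"] by simp
  also have "ennreal \<bar>det L\<bar> * \<dots> = (\<integral>\<^sup>+v. (\<integral>\<^sup>+r. ennreal \<bar>det L\<bar> * ennreal ?c * (ennreal (r ^ (CARD('m) - 1)) * F (L *v (r *\<^sub>R v)) * indicator {0<..} r) \<partial>lborel) \<partial>uniform_sphere)"
    unfolding mult.assoc[symmetric]
    by (subst nn_integral_cmult[symmetric])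
       (auto simp: mult.assoc nn_integral_cmult uniform_sphere_def)
  also have "\<dots> = (\<integral>\<^sup>+v. (\<integral>\<^sup>+r. ennreal (2 * pi powr (real CARD('m) / 2) * \<bar>det L\<bar> / Gamma (real CARD('m) / 2) * r ^ (CARD('m) - 1))
      * F (r *\<^sub>R (L *v v)) * indicator {0<..} r \<partial>lborel) \<partial>uniform_sphere)"
  proof (intro nn_integral_cong)
    fix v :: "real^'m" and r :: real
    have "ennreal \<bar>det L\<bar> * ennreal ?c * ennreal (r ^ (CARD('m) - 1)) = ennreal (\<bar>det L\<bar> * ?c * r ^ (CARD('m) - 1))" if "0 < r"
      using c by (metis abs_ge_zero ennreal_mult' mult_nonneg_nonneg)
    moreover have "\<bar>det L\<bar> * ?c * r ^ (CARD('m) - 1) = 2 * pi powr (real CARD('m) / 2) * \<bar>det L\<bar> / Gamma (real CARD('m) / 2) * r ^ (CARD('m) - 1)" by simp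
    ultimately show "ennreal \<bar>det L\<bar> * ennreal ?c * (ennreal (r ^ (CARD('m) - 1)) * F (L *v (r *\<^sub>R v)) * indicator {0<..} r)
      = ennreal (2 * pi powr (real CARD('m) / 2) * \<bar>det L\<bar> / Gamma (real CARD('m) / 2) * r ^ (CARD('m) - 1))
        * F (r *\<^sub>R (L *v v)) * indicator {0<..} r"
      by (cases "0 < r") (simp_all only: matrix_vector_mult_scaleR mult.assoc[symmetric], simp)
  qed
  finally show ?thesis .
qed

section \<open>Integrals of minima of smooth functions\<close>

text \<open>The first-order expansion as an eventual statement in \<open>nhds x\<close>, base point
  included, so that it combines with other eventual facts by filter elimination.
  \<open>GDERIV_I\<close> is the converse.\<close>

lemma GDERIV_D:
  assumes "GDERIV f x :> D" "\<epsilon> > 0"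
  shows "\<forall>\<^sub>F y in nhds x. \<bar>f y - f x - D \<bullet> (y - x)\<bar> \<le> \<epsilon> * norm (y - x)"
proof -
  obtain d where "d > 0" "\<And>y. norm (y - x) < d \<Longrightarrow> norm (f y - f x - (y - x) \<bullet> D) \<le> \<epsilon> * norm (y - x)"
    using assms unfolding gderiv_def has_derivative_at_alt by blast
  then show ?thesis
    unfolding eventually_nhds_metric by (auto simp: dist_norm inner_commute intro!: exI[of _ d])
qed

lemma GDERIV_I:
  assumes "\<And>\<epsilon>. \<epsilon> > 0 \<Longrightarrow> \<forall>\<^sub>F y in nhds x. \<bar>f y - f x - D \<bullet> (y - x)\<bar> \<le> \<epsilon> * norm (y - x)"
  shows "GDERIV f x :> D"
  unfolding gderiv_def has_derivative_at_alt
proof safe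
  show "bounded_linear (\<lambda>h. h \<bullet> D)" by (rule bounded_linear_inner_left)
  fix \<epsilon> :: real assume "\<epsilon> > 0"
  from assms[OF this] obtain d where "d > 0" "\<And>y. dist y x < d \<Longrightarrow> \<bar>f y - f x - D \<bullet> (y - x)\<bar> \<le> \<epsilon> * norm (y - x)"
    unfolding eventually_nhds_metric by blast
  then show "\<exists>d>0. \<forall>y. norm (y - x) < d \<longrightarrow> norm (f y - f x - (y - x) \<bullet> D) \<le> \<epsilon> * norm (y - x)"
    by (auto simp: dist_norm inner_commute intro!: exI[of _ d])
qed

lemma frechet_subdifferential_D:
  assumes "d \<in> frechet_subdifferential \<phi> x" "\<epsilon> > 0"
  shows "\<forall>\<^sub>F y in nhds x. - \<epsilon> * norm (y - x) \<le> \<phi> y - \<phi> x - d \<bullet> (y - x)"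
proof -
  have "0 \<le> Liminf (at x) (\<lambda>y. ereal ((\<phi> y - \<phi> x - d \<bullet> (y - x)) / norm (y - x)))"
    using assms by (simp add: frechet_subdifferential_def)
  moreover have "ereal (- \<epsilon>) < 0" using assms by simp
  ultimately have "\<forall>\<^sub>F y in at x. ereal (- \<epsilon>) < ereal ((\<phi> y - \<phi> x - d \<bullet> (y - x)) / norm (y - x))"
    unfolding le_Liminf_iff by blast
  then have "\<forall>\<^sub>F y in nhds x. y \<noteq> x \<longrightarrow> - \<epsilon> < (\<phi> y - \<phi> x - d \<bullet> (y - x)) / norm (y - x)"
    by (simp add: eventually_at_filter)
  then show ?thesis
  proof eventually_elim
    case (elim y)
    then show ?case by (cases "y = x") (auto simp: field_simps)
  qed
qed

text \<open>A function that touches \<open>\<phi>\<close> from above and is differentiable at the contact point forces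
  every Frechet subgradient of \<open>\<phi>\<close> there to equal its gradient.\<close>

lemma frechet_subgradient_eq_gradient_of_majorant:
  fixes \<phi> :: "'a::real_inner \<Rightarrow> real"
  assumes d: "d \<in> frechet_subdifferential \<phi> x" and \<psi>: "GDERIV \<psi> x :> D"
    and le: "\<forall>\<^sub>F y in nhds x. \<phi> y \<le> \<psi> y" and eq: "\<phi> x = \<psi> x"
  shows "d = D"
proof (rule ccontr)
  assume "d \<noteq> D"
  define w where "w = D - d"
  have w: "norm w > 0" using \<open>d \<noteq> D\<close> by (simp add: w_def)
  define \<epsilon> where "\<epsilon> = norm w / 4"
  have \<epsilon>: "\<epsilon> > 0" using w by (simp add: \<epsilon>_def)
  have "\<forall>\<^sub>F y in nhds x. - (2 * \<epsilon>) * norm (y - x) \<le> w \<bullet> (y - x)"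
    using le GDERIV_D[OF \<psi> \<epsilon>] frechet_subdifferential_D[OF d \<epsilon>]
  proof eventually_elim
    case (elim y)
    then show ?case using eq by (simp add: w_def inner_diff_left abs_le_iff)
  qed
  then obtain r where r: "r > 0" "\<And>y. dist y x < r \<Longrightarrow> - (2 * \<epsilon>) * norm (y - x) \<le> w \<bullet> (y - x)"
    unfolding eventually_nhds_metric by blast
  \<comment> \<open>The step from x along - w has length r / 2, hence stays in the ball. There the
    linear term is - t \<open>norm w\<close>^2, whereas \<epsilon> = \<open>norm w\<close> / 4
    permits at most half of that decrease.\<close>
  define t where "t = r / (2 * norm w)"
  have t: "t > 0" using r w by (simp add: t_def)
  have "dist (x - t *\<^sub>R w) x < r" using t r w by (simp add: dist_norm t_def)
  from r(2)[OF this] have "- (2 * \<epsilon>) * (t * norm w) \<le> - t * (norm w)^2"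
    using t by (simp add: power2_norm_eq_inner)
  then have "t * (norm w)^2 \<le> t * ((norm w)^2 / 2)" by (simp add: \<epsilon>_def power2_eq_square)
  then show False using t w by simp
qed

text \<open>Dominated convergence for the remainder divided by the distance. The increment and the
  linear term each contribute at most \<open>K\<close> times the distance, which gives the
  dominating constant \<open>2 * K\<close>. Working along sequences allows the exceptional null set
  of the Lipschitz bound to depend on \<open>y\<close>.\<close>

lemma (in finite_measure) GDERIV_integral:
  fixes q :: "'c::euclidean_space \<Rightarrow> 'a \<Rightarrow> real"
  assumes U: "open U" "x \<in> U" and int: "\<And>y. y \<in> U \<Longrightarrow> integrable M (q y)"
    and lip: "\<And>y. y \<in> U \<Longrightarrow> AE v in M. \<bar>q y v - q x v\<bar> \<le> K * norm (y - x)"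
    and der: "AE v in M. GDERIV (\<lambda>y. q y v) x :> D v"
    and D[measurable]: "D \<in> borel_measurable M" and bd: "AE v in M. norm (D v) \<le> K"
  shows "GDERIV (\<lambda>y. \<integral>v. q y v \<partial>M) x :> (\<integral>v. D v \<partial>M)"
proof -
  have intD: "integrable M D" by (rule integrable_const_bound[OF bd]) simp
  define p where "p y v = (q y v - q x v - D v \<bullet> (y - x)) / norm (y - x)" for y v
  have p_int: "integrable M (p y)" if "y \<in> U" for y
    unfolding p_def using int[OF that] int[OF U(2)] intD
    by (intro integrable_divide Bochner_Integration.integrable_diff integrable_inner_left) auto
  have p_eq: "(\<integral>v. p y v \<partial>M) = ((\<integral>v. q y v \<partial>M) - (\<integral>v. q x v \<partial>M) - (\<integral>v. D v \<partial>M) \<bullet> (y - x)) / norm (y - x)"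
    if "y \<in> U" for y
    unfolding p_def using int[OF that] int[OF U(2)] intD by simp
  have lim: "((\<lambda>y. \<integral>v. p y v \<partial>M) \<longlongrightarrow> 0) (at x)"
    unfolding tendsto_at_iff_sequentially
  proof safe
    fix Y :: "nat \<Rightarrow> 'c" assume Y: "\<forall>k. Y k \<in> UNIV - {x}" "Y \<longlonglongrightarrow> x"
    have ev: "\<forall>\<^sub>F k in sequentially. Y k \<in> U"
      using topological_tendstoD[OF Y(2) U] .
    then obtain N where N: "\<And>k. k \<ge> N \<Longrightarrow> Y k \<in> U" by (auto simp: eventually_sequentially)
    have "(\<lambda>k. \<integral>v. p (Y (k + N)) v \<partial>M) \<longlonglongrightarrow> (\<integral>v. 0 \<partial>M)"
    proof (rule integral_dominated_convergence[where w = "\<lambda>_. 2 * K"])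
      show "AE v in M. (\<lambda>k. p (Y (k + N)) v) \<longlonglongrightarrow> 0"
        using der
      proof eventually_elim
        case (elim v)
        show ?case
        proof (rule LIMSEQ_ignore_initial_segment, rule LIMSEQ_I)
          fix \<epsilon> :: real assume \<epsilon>: "\<epsilon> > 0"
          have "\<forall>\<^sub>F k in sequentially. \<bar>q (Y k) v - q x v - D v \<bullet> (Y k - x)\<bar> \<le> \<epsilon> / 2 * norm (Y k - x)"
            using \<epsilon> by (intro eventually_compose_filterlim[OF _ Y(2)] GDERIV_D[OF elim]) simp
          then have "\<forall>\<^sub>F k in sequentially. norm (p (Y k) v - 0) < \<epsilon>"
          proof eventually_elim
            case (elim k)
            have "norm (Y k - x) > 0" using Y(1) by auto
            then have "norm (p (Y k) v) \<le> \<epsilon> / 2" using elim by (simp add: p_def abs_divide divide_le_eq)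
            then show ?case using \<epsilon> by simp
          qed
          then show "\<exists>no. \<forall>k\<ge>no. norm (p (Y k) v - 0) < \<epsilon>" by (simp add: eventually_sequentially)
        qed
      qed
      show "AE v in M. norm (p (Y (k + N)) v) \<le> 2 * K" for k
        using lip[OF N[of "k + N", OF le_add2]] bd
      proof eventually_elim
        case (elim v)
        let ?h = "Y (k + N) - x"
        have h: "norm ?h > 0" using Y(1) by auto
        have "\<bar>D v \<bullet> ?h\<bar> \<le> K * norm ?h"
          using Cauchy_Schwarz_ineq2[of "D v" ?h] elim(2) h by (meson mult_right_mono norm_ge_zero order_trans)
        then have "\<bar>q (Y (k + N)) v - q x v - D v \<bullet> ?h\<bar> \<le> 2 * K * norm ?h" using elim(1) by linarith
        then show ?case using h by (simp add: p_def abs_divide divide_le_eq)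
      qed
    qed (use p_int N in auto)
    then show "((\<lambda>y. \<integral>v. p y v \<partial>M) \<circ> Y) \<longlonglongrightarrow> 0"
      by (simp add: o_def LIMSEQ_offset[of _ N])
  qed
  show ?thesis
  proof (rule GDERIV_I)
    fix \<epsilon> :: real assume "\<epsilon> > 0"
    then have "\<forall>\<^sub>F y in at x. dist (\<integral>v. p y v \<partial>M) 0 < \<epsilon>" using lim by (rule tendstoD[rotated])
    moreover have "\<forall>\<^sub>F y in at x. y \<in> U" using U by (rule eventually_at_in_open')
    ultimately have "\<forall>\<^sub>F y in at x. \<bar>(\<integral>v. q y v \<partial>M) - (\<integral>v. q x v \<partial>M) - (\<integral>v. D v \<partial>M) \<bullet> (y - x)\<bar> \<le> \<epsilon> * norm (y - x)"
      using eventually_neq_at_within[of x]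
    proof eventually_elim
      case (elim y)
      then have "norm (y - x) > 0" by auto
      then show ?case using elim p_eq by (simp add: abs_divide divide_less_eq)
    qed
    then show "\<forall>\<^sub>F y in nhds x. \<bar>(\<integral>v. q y v \<partial>M) - (\<integral>v. q x v \<partial>M) - (\<integral>v. D v \<partial>M) \<bullet> (y - x)\<bar> \<le> \<epsilon> * norm (y - x)"
      by (auto simp: eventually_at_filter elim: eventually_mono)
  qed
qed

text \<open>Separates the nonsmooth analysis from the geometry. Regularity in \<open>x\<close> is
  asked only in \<open>good\<close> directions, whereas nonemptiness of \<open>T\<close> and the
  bound on \<open>G\<close> hold for every \<open>v\<close>, so that selections exist everywhere and
  selected gradients are uniformly bounded.\<close>

locale min_integral = finite_measure M
  for M :: "'b measure" +
  fixes U :: "'a::euclidean_space set"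
    and e :: "'k::finite \<Rightarrow> 'a \<Rightarrow> 'b \<Rightarrow> real" and m :: "'a \<Rightarrow> 'b \<Rightarrow> real"
    and G :: "'k \<Rightarrow> 'a \<Rightarrow> 'b \<Rightarrow> 'a" and T :: "'a \<Rightarrow> 'b \<Rightarrow> 'k set"
    and K :: real and good :: "'b \<Rightarrow> bool" and \<phi> :: "'a \<Rightarrow> real"
  assumes open_U: "open U" and K_nonneg: "0 \<le> K" and AE_good: "AE v in M. good v"
    and e_int: "\<And>i x. x \<in> U \<Longrightarrow> integrable M (e i x)"
    and m_int: "\<And>x. x \<in> U \<Longrightarrow> integrable M (m x)"
    and G_meas: "\<And>i x. x \<in> U \<Longrightarrow> G i x \<in> borel_measurable M"
    and G_bd: "\<And>i x v. x \<in> U \<Longrightarrow> norm (G i x v) \<le> K"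
    and lip: "\<And>i x y v. x \<in> U \<Longrightarrow> y \<in> U \<Longrightarrow> good v \<Longrightarrow> \<bar>e i x v - e i y v\<bar> \<le> K * norm (x - y)"
    and deriv: "\<And>i x v. x \<in> U \<Longrightarrow> good v \<Longrightarrow> GDERIV (\<lambda>y. e i y v) x :> G i x v"
    and G_cont: "\<And>i x v. x \<in> U \<Longrightarrow> good v \<Longrightarrow> isCont (\<lambda>y. G i y v) x"
    and T_meas: "\<And>x. x \<in> U \<Longrightarrow> T x \<in> measurable M (count_space UNIV)"
    and T_ne: "\<And>x v. x \<in> U \<Longrightarrow> T x v \<noteq> {}"
    and T_usc: "\<And>x v. x \<in> U \<Longrightarrow> good v \<Longrightarrow> \<forall>\<^sub>F y in nhds x. T y v \<subseteq> T x v"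
    and m_le: "\<And>i x v. x \<in> U \<Longrightarrow> good v \<Longrightarrow> m x v \<le> e i x v"
    and m_eq: "\<And>i x v. x \<in> U \<Longrightarrow> good v \<Longrightarrow> i \<in> T x v \<Longrightarrow> m x v = e i x v"
    and \<phi>_eq: "\<And>x. x \<in> U \<Longrightarrow> \<phi> x = (\<integral>v. m x v \<partial>M)"
begin

lemma bounded_selections: "x \<in> U \<Longrightarrow> bounded_selections M (\<lambda>i. G i x) K"
  using G_meas G_bd by unfold_locales auto

text \<open>The minimum at one point is compared with an index active at the other: for j active at
  \<open>y\<close>, m x \<le> e j x \<le> e j y + K |x - y| = m y + K |x - y|, and
  symmetrically.\<close>

lemma m_lip: assumes "x \<in> U" "y \<in> U" "good v" shows "\<bar>m x v - m y v\<bar> \<le> K * norm (x - y)"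
proof -
  obtain i j where "i \<in> T x v" "j \<in> T y v" using T_ne[OF assms(1)] T_ne[OF assms(2)] by blast
  then show ?thesis
    using m_eq[OF assms(1,3), of i] m_eq[OF assms(2,3), of j] m_le[OF assms(1,3), of j] m_le[OF assms(2,3), of i]
      lip[OF assms, of i] lip[OF assms, of j] by (simp add: abs_le_iff)
qed

lemma phi_lipschitz: "(K * measure M (space M))-lipschitz_on U \<phi>"
proof (rule lipschitz_onI)
  fix x y assume xy: "x \<in> U" "y \<in> U"
  have "dist (\<phi> x) (\<phi> y) = \<bar>\<integral>v. m x v - m y v \<partial>M\<bar>"
    using m_int xy \<phi>_eq by (simp add: dist_real_def)
  also have "\<dots> \<le> (\<integral>v. \<bar>m x v - m y v\<bar> \<partial>M)" by (rule integral_abs_bound)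
  also have "\<dots> \<le> (\<integral>v. K * norm (x - y) \<partial>M)"
    using m_int xy by (intro integral_mono_AE) (use AE_good m_lip[OF xy] in auto)
  finally show "dist (\<phi> x) (\<phi> y) \<le> K * measure M (space M) * dist x y" by (simp add: dist_norm mult_ac)
qed (use K_nonneg in simp)

lemma integrable_e_selected:
  assumes x: "x \<in> U" and s: "s \<in> measurable M (count_space UNIV)"
  shows "integrable M (\<lambda>v. e (s v) x v)"
proof -
  have "integrable M (\<lambda>v. \<Sum>i\<in>UNIV. norm (e i x v))"
    using e_int[OF x] by auto
  moreover have "(\<lambda>v. e (s v) x v) \<in> borel_measurable M"
    by (rule measurable_compose_countable[OF _ s]) (use e_int[OF x] in auto)
  ultimately show ?thesis
  proof (rule Bochner_Integration.integrable_bound)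
    show "AE v in M. norm (e (s v) x v) \<le> norm (\<Sum>i\<in>UNIV. norm (e i x v))"
      by (auto simp: sum_nonneg intro!: order_trans[OF member_le_sum[of "s _" UNIV "\<lambda>i. \<bar>e i x _\<bar>"]])
  qed
qed

text \<open>The selection \<open>s\<close> is frozen while the point varies. As \<open>s\<close> is
  arbitrary, the existence of one subgradient forces all selections active at \<open>x\<close> to
  have the same integral.\<close>

lemma frechet_subgradient:
  assumes x: "x \<in> U" and s: "s \<in> selections M (T x)" and d: "d \<in> frechet_subdifferential \<phi> x"
  shows "d = (\<integral>v. G (s v) x v \<partial>M)"
proof (rule frechet_subgradient_eq_gradient_of_majorant[OF d])
  note sm = selectionsD(1)[OF s]
  interpret bounded_selections M "\<lambda>i. G i x" K by (rule bounded_selections[OF x])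
  show "GDERIV (\<lambda>y. \<integral>v. e (s v) y v \<partial>M) x :> (\<integral>v. G (s v) x v \<partial>M)"
    using open_U x integrable_e_selected[OF _ sm]
  proof (rule GDERIV_integral)
    show "AE v in M. \<bar>e (s v) y v - e (s v) x v\<bar> \<le> K * norm (y - x)" if "y \<in> U" for y
      using AE_good by eventually_elim (rule lip[OF that x])
    show "AE v in M. GDERIV (\<lambda>y. e (s v) y v) x :> G (s v) x v"
      using AE_good by eventually_elim (rule deriv[OF x])
    show "AE v in M. norm (G (s v) x v) \<le> K" using G_bd[OF x] by simp
    show "(\<lambda>v. G (s v) x v) \<in> borel_measurable M" by (rule measurable_selected[OF sm])
  qed
  have "\<forall>\<^sub>F y in nhds x. y \<in> U" using open_U x by (rule eventually_nhds_in_open)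
  then show "\<forall>\<^sub>F y in nhds x. \<phi> y \<le> (\<integral>v. e (s v) y v \<partial>M)"
  proof eventually_elim
    case (elim y)
    then show ?case unfolding \<phi>_eq[OF elim]
      by (intro integral_mono_AE m_int integrable_e_selected[OF _ sm]) (use AE_good m_le in auto)
  qed
  show "\<phi> x = (\<integral>v. e (s v) x v \<partial>M)"
    unfolding \<phi>_eq[OF x]
  proof (rule integral_cong_AE)
    show "AE v in M. m x v = e (s v) x v"
      using AE_good AE_space by eventually_elim (use m_eq[OF x] selectionsD(2)[OF s] in auto)
  qed (use m_int[OF x] integrable_e_selected[OF x sm] in auto)
qed

text \<open>The index may change with k; summing the differences over all of the finitely many
  indices removes this dependence.\<close>

lemma G_selected_tendsto:
  assumes x: "x \<in> U" and X: "X \<longlonglongrightarrow> x" and v: "good v"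
  shows "(\<lambda>k. G (S k) (X k) v - G (S k) x v) \<longlonglongrightarrow> 0"
proof (rule Lim_null_comparison)
  show "\<forall>\<^sub>F k in sequentially. norm (G (S k) (X k) v - G (S k) x v) \<le> (\<Sum>i\<in>UNIV. norm (G i (X k) v - G i x v))"
    by (intro always_eventually allI member_le_sum[of _ UNIV "\<lambda>i. norm (G i (X _) v - G i x v)"]) auto
  have "(\<lambda>k. G i (X k) v) \<longlonglongrightarrow> G i x v" for i
    using G_cont[OF x v] X by (rule isCont_tendsto_compose)
  then have "(\<lambda>k. norm (G i (X k) v - G i x v)) \<longlonglongrightarrow> 0" for i
    by (simp add: LIM_zero tendsto_norm_zero)
  then show "(\<lambda>k. \<Sum>i\<in>UNIV. norm (G i (X k) v - G i x v)) \<longlonglongrightarrow> 0"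
    by (rule tendsto_null_sum)
qed

lemma limiting_subgradient:
  assumes x: "x \<in> U" and closed: "closed ((\<lambda>s. \<integral>v. G (s v) x v \<partial>M) ` selections M (T x))"
    and d: "d \<in> limiting_subdifferential \<phi> x"
  shows "\<exists>s\<in>selections M (T x). d = (\<integral>v. G (s v) x v \<partial>M)"
proof -
  interpret bounded_selections M "\<lambda>i. G i x" K by (rule bounded_selections[OF x])
  obtain X' D' where X': "X' \<longlonglongrightarrow> x" and D': "\<And>k::nat. D' k \<in> frechet_subdifferential \<phi> (X' k)" "D' \<longlonglongrightarrow> d"
    using d unfolding limiting_subdifferential_def by blast
  obtain N where N: "\<And>k. k \<ge> N \<Longrightarrow> X' k \<in> U"
    using topological_tendstoD[OF X' open_U x] by (auto simp: eventually_sequentially)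
  define X where "X k = X' (k + N)" for k
  define D where "D k = D' (k + N)" for k
  have X: "X \<longlonglongrightarrow> x" "\<And>k. X k \<in> U" and D: "D \<longlonglongrightarrow> d" "\<And>k. D k \<in> frechet_subdifferential \<phi> (X k)"
    using X' D' N unfolding X_def D_def by (auto intro: LIMSEQ_ignore_initial_segment)
  define S where "S k v = (SOME i. i \<in> T (X k) v)" for k v
  have S: "S k \<in> selections M (T (X k))" for k
    unfolding S_def by (rule some_in_selections[OF T_meas[OF X(2)] T_ne[OF X(2)]])
  define s0 where "s0 v = (SOME i. i \<in> T x v)" for v
  have s0: "s0 \<in> selections M (T x)"
    unfolding s0_def by (rule some_in_selections[OF T_meas[OF x] T_ne[OF x]])
  \<comment> \<open>By \<open>T_usc\<close> an index active at X k is, for large k, active at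
    \<open>x\<close>, so in each good direction the redirection is eventually void. Hence the
    integrals of \<open>S' k\<close> at \<open>x\<close> have the same limit as \<open>D k\<close>,
    and they all lie in the closed set.\<close>
  define S' where "S' k v = (if S k v \<in> T x v then S k v else s0 v)" for k v
  have S': "S' k \<in> selections M (T x)" for k
    unfolding S'_def by (rule redirect_in_selections[OF T_meas[OF x] selectionsD(1)[OF S] s0])
  have D_eq: "D k = (\<integral>v. G (S k v) (X k) v \<partial>M)" for k
    by (rule frechet_subgradient[OF X(2) S D(2)])
  have Sint: "integrable M (\<lambda>v. G (S k v) (X k) v)" for k
    by (rule bounded_selections.integrable_selected[OF bounded_selections[OF X(2)] selectionsD(1)[OF S]])
  have S'int: "integrable M (\<lambda>v. G (S' k v) x v)" for k
    by (rule integrable_selected[OF selectionsD(1)[OF S']])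
  have "(\<lambda>k. \<integral>v. G (S k v) (X k) v - G (S' k v) x v \<partial>M) \<longlonglongrightarrow> (\<integral>v. 0 \<partial>M)"
  proof (rule integral_dominated_convergence[where w = "\<lambda>_. 2 * K"])
    show "AE v in M. (\<lambda>k. G (S k v) (X k) v - G (S' k v) x v) \<longlonglongrightarrow> 0"
      using AE_good AE_space
    proof eventually_elim
      case (elim v)
      have "\<forall>\<^sub>F k in sequentially. T (X k) v \<subseteq> T x v"
        by (rule eventually_compose_filterlim[OF T_usc[OF x elim(1)] X(1)])
      then have "\<forall>\<^sub>F k in sequentially. G (S k v) (X k) v - G (S k v) x v = G (S k v) (X k) v - G (S' k v) x v"
      proof eventually_elim
        case (elim k)
        then show ?case using selectionsD(2)[OF S \<open>v \<in> space M\<close>] by (auto simp: S'_def)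
      qed
      then show ?case by (rule Lim_transform_eventually[OF G_selected_tendsto[OF x X(1) elim(1)]])
    qed
    show "AE v in M. norm (G (S k v) (X k) v - G (S' k v) x v) \<le> 2 * K" for k
    proof (rule AE_I2)
      fix v
      show "norm (G (S k v) (X k) v - G (S' k v) x v) \<le> 2 * K"
        using norm_triangle_ineq4[of "G (S k v) (X k) v" "G (S' k v) x v"] G_bd[OF X(2), of "S k v" k v] G_bd[OF x, of "S' k v" v] by simp
    qed
    show "(\<lambda>v. G (S k v) (X k) v - G (S' k v) x v) \<in> borel_measurable M" for k
      using Sint S'int by simp
  qed auto
  then have "(\<lambda>k. D k - (\<integral>v. G (S' k v) x v \<partial>M)) \<longlonglongrightarrow> 0"
    using Sint S'int by (simp add: D_eq)
  from tendsto_diff[OF D(1) this] have lim: "(\<lambda>k. \<integral>v. G (S' k v) x v \<partial>M) \<longlonglongrightarrow> d" by simp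
  have "d \<in> (\<lambda>s. \<integral>v. G (s v) x v \<partial>M) ` selections M (T x)"
    using closed by (rule closed_sequentially[OF _ _ lim]) (use S' in blast)
  then show ?thesis by blast
qed

text \<open>Near \<open>x\<close> the minimum is attained only by indices already active at
  \<open>x\<close>. These share one gradient, so their expansions combine into one for
  \<open>m\<close>.\<close>

lemma m_GDERIV:
  assumes x: "x \<in> U" and v: "good v" and i: "i \<in> T x v"
    and agree: "\<And>j. j \<in> T x v \<Longrightarrow> G j x v = G i x v"
  shows "GDERIV (\<lambda>y. m y v) x :> G i x v"
proof (rule GDERIV_I)
  fix \<epsilon> :: real assume \<epsilon>: "\<epsilon> > 0"
  have "\<forall>\<^sub>F y in nhds x. \<forall>j. \<bar>e j y v - e j x v - G j x v \<bullet> (y - x)\<bar> \<le> \<epsilon> * norm (y - x)"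
    using GDERIV_D[OF deriv[OF x v] \<epsilon>] by (simp add: eventually_all_finite)
  moreover have "\<forall>\<^sub>F y in nhds x. y \<in> U" using open_U x by (rule eventually_nhds_in_open)
  ultimately show "\<forall>\<^sub>F y in nhds x. \<bar>m y v - m x v - G i x v \<bullet> (y - x)\<bar> \<le> \<epsilon> * norm (y - x)"
    using T_usc[OF x v]
  proof eventually_elim
    case (elim y)
    obtain j where j: "j \<in> T y v" using T_ne[OF elim(2)] by blast
    then have j': "j \<in> T x v" using elim(3) by blast
    show ?case
      using elim(1)[rule_format, of j] m_eq[OF elim(2) v j] m_eq[OF x v j'] agree[OF j'] by simp
  qed
qed

lemma phi_GDERIV:
  assumes x: "x \<in> U" and s: "s \<in> selections M (T x)"
    and agree: "AE v in M. \<forall>i\<in>T x v. \<forall>j\<in>T x v. G i x v = G j x v"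
  shows "GDERIV \<phi> x :> (\<integral>v. G (s v) x v \<partial>M)"
proof -
  interpret bounded_selections M "\<lambda>i. G i x" K by (rule bounded_selections[OF x])
  have "GDERIV (\<lambda>y. \<integral>v. m y v \<partial>M) x :> (\<integral>v. G (s v) x v \<partial>M)"
    using open_U x m_int
  proof (rule GDERIV_integral)
    show "AE v in M. \<bar>m y v - m x v\<bar> \<le> K * norm (y - x)" if "y \<in> U" for y
      using AE_good by eventually_elim (rule m_lip[OF that x])
    show "AE v in M. GDERIV (\<lambda>y. m y v) x :> G (s v) x v"
      using AE_good AE_space agree
      by eventually_elim (use selectionsD(2)[OF s] in \<open>auto intro!: m_GDERIV[OF x]\<close>)
    show "AE v in M. norm (G (s v) x v) \<le> K" using G_bd[OF x] by simp
    show "(\<lambda>v. G (s v) x v) \<in> borel_measurable M" by (rule measurable_selected[OF selectionsD(1)[OF s]])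
  qed
  moreover have "\<forall>\<^sub>F y in nhds x. (\<integral>v. m y v \<partial>M) = \<phi> y"
    using eventually_nhds_in_open[OF open_U x] by eventually_elim (simp add: \<phi>_eq)
  ultimately show ?thesis
    unfolding gderiv_def using has_derivative_transform_eventually[of "\<lambda>y. \<integral>v. m y v \<partial>M" _ x UNIV \<phi>] \<phi>_eq[OF x]
    by (simp add: eventually_nhds_conv_at)
qed

text \<open>The selections at different points are unrelated. In the limit an index selected at X k
  is active at \<open>x\<close>, where \<open>agree\<close> makes it interchangeable with
  \<open>s x v\<close>.\<close>

lemma phi_C1:
  assumes s: "\<And>x. x \<in> U \<Longrightarrow> s x \<in> selections M (T x)"
    and agree: "\<And>x. x \<in> U \<Longrightarrow> AE v in M. \<forall>i\<in>T x v. \<forall>j\<in>T x v. G i x v = G j x v"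
  shows "C1_on U \<phi>"
  unfolding C1_on_def
proof (intro exI conjI ballI)
  show "GDERIV \<phi> x :> (\<integral>v. G (s x v) x v \<partial>M)" if "x \<in> U" for x
    by (rule phi_GDERIV[OF that s[OF that] agree[OF that]])
  show "continuous_on U (\<lambda>x. \<integral>v. G (s x v) x v \<partial>M)"
    unfolding continuous_on_sequentially
  proof safe
    fix X x assume x: "x \<in> U" and X: "\<forall>k. X k \<in> U" "X \<longlonglongrightarrow> x"
    have "(\<lambda>k. \<integral>v. G (s (X k) v) (X k) v \<partial>M) \<longlonglongrightarrow> (\<integral>v. G (s x v) x v \<partial>M)"
    proof (rule integral_dominated_convergence[where w = "\<lambda>_. K"])
      show "AE v in M. (\<lambda>k. G (s (X k) v) (X k) v) \<longlonglongrightarrow> G (s x v) x v"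
        using AE_good AE_space agree[OF x]
      proof eventually_elim
        case (elim v)
        have "\<forall>\<^sub>F k in sequentially. T (X k) v \<subseteq> T x v"
          by (rule eventually_compose_filterlim[OF T_usc[OF x elim(1)] X(2)])
        then have "\<forall>\<^sub>F k in sequentially. G (s (X k) v) (X k) v - G (s (X k) v) x v = G (s (X k) v) (X k) v - G (s x v) x v"
        proof eventually_elim
          case (elim k)
          have "s (X k) v \<in> T x v" "s x v \<in> T x v"
            using selectionsD(2)[OF s \<open>v \<in> space M\<close>] X(1) x elim by auto
          then have "G (s (X k) v) x v = G (s x v) x v"
            using \<open>\<forall>i\<in>T x v. \<forall>j\<in>T x v. G i x v = G j x v\<close> by blast
          then show ?case by simp
        qed
        then have "(\<lambda>k. G (s (X k) v) (X k) v - G (s x v) x v) \<longlonglongrightarrow> 0"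
          by (rule Lim_transform_eventually[OF G_selected_tendsto[OF x X(2) elim(1)]])
        then show ?case by (rule LIM_zero_cancel)
      qed
      show "AE v in M. norm (G (s (X k) v) (X k) v) \<le> K" for k using G_bd X(1) by simp
      show "(\<lambda>v. G (s (X k) v) (X k) v) \<in> borel_measurable M" for k
        by (rule bounded_selections.measurable_selected[OF bounded_selections selectionsD(1)[OF s]]) (use X in auto)
      show "(\<lambda>v. G (s x v) x v) \<in> borel_measurable M"
        by (rule bounded_selections.measurable_selected[OF bounded_selections selectionsD(1)[OF s]]) (use x in auto)
    qed auto
    then show "((\<lambda>x. \<integral>v. G (s x v) x v \<partial>M) \<circ> X) \<longlonglongrightarrow> (\<integral>v. G (s x v) x v \<partial>M)" by (simp add: o_def)
  qed
qed

end

section \<open>The radius of a quasi-convex sublevel set\<close>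

lemma grad_eqI:
  assumes "GDERIV f x :> D"
  shows "grad f x = D"
proof -
  have "D' = D" if "GDERIV f x :> D'" for D'
  proof -
    have "(\<lambda>h. h \<bullet> D') = (\<lambda>h. h \<bullet> D)"
      using that assms unfolding gderiv_def by (rule has_derivative_unique)
    then show ?thesis by (metis inner_commute vector_eq_ldot)
  qed
  then show ?thesis unfolding grad_def using assms by blast
qed

locale C1_system =
  fixes g :: "'k::finite \<Rightarrow> 'a::euclidean_space \<Rightarrow> 'z::euclidean_space \<Rightarrow> real"
  assumes g_C1: "\<And>i. C1_on UNIV (\<lambda>(x, z). g i x z)"
begin

definition Dx :: "'k \<Rightarrow> 'a \<Rightarrow> 'z \<Rightarrow> 'a" where "Dx i x z = grad (\<lambda>y. g i y z) x"
definition Dz :: "'k \<Rightarrow> 'a \<Rightarrow> 'z \<Rightarrow> 'z" where "Dz i x z = grad (\<lambda>w. g i x w) z"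

text \<open>The separately defined gradients \<open>Dx\<close> and \<open>Dz\<close> are the two
  components of the joint gradient, and therefore inherit its joint continuity.\<close>

lemma g_joint:
  "((\<lambda>p. g i (fst p) (snd p)) has_derivative (\<lambda>h. fst h \<bullet> Dx i x z + snd h \<bullet> Dz i x z)) (at (x, z))"
  and Dx_cont: "continuous_on UNIV (\<lambda>p. Dx i (fst p) (snd p))"
  and Dz_cont: "continuous_on UNIV (\<lambda>p. Dz i (fst p) (snd p))"
proof -
  obtain D where D: "\<And>p. GDERIV (\<lambda>(x, z). g i x z) p :> D p" and cont: "continuous_on UNIV D"
    using g_C1[of i] unfolding C1_on_def by auto
  have der: "((\<lambda>p. g i (fst p) (snd p)) has_derivative (\<lambda>h. fst h \<bullet> fst (D p) + snd h \<bullet> snd (D p))) (at p)" for p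
    using D[of p] by (simp add: gderiv_def case_prod_beta' inner_prod_def)
  have Dx: "Dx i x z = fst (D (x, z))" for x z
  proof -
    have "((\<lambda>y. (y, z)) has_derivative (\<lambda>h. (h, 0))) (at x)" by (auto intro!: derivative_eq_intros)
    from has_derivative_compose[OF this der]
    have "GDERIV (\<lambda>y. g i y z) x :> fst (D (x, z))" by (simp add: gderiv_def)
    then show ?thesis unfolding Dx_def by (rule grad_eqI)
  qed
  have Dz: "Dz i x z = snd (D (x, z))" for x z
  proof -
    have "((\<lambda>w. (x, w)) has_derivative (\<lambda>h. (0, h))) (at z)" by (auto intro!: derivative_eq_intros)
    from has_derivative_compose[OF this der]
    have "GDERIV (\<lambda>w. g i x w) z :> snd (D (x, z))" by (simp add: gderiv_def)
    then show ?thesis unfolding Dz_def by (rule grad_eqI)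
  qed
  show "((\<lambda>p. g i (fst p) (snd p)) has_derivative (\<lambda>h. fst h \<bullet> Dx i x z + snd h \<bullet> Dz i x z)) (at (x, z))"
    using der[of "(x, z)"] by (simp add: Dx Dz)
  show "continuous_on UNIV (\<lambda>p. Dx i (fst p) (snd p))" "continuous_on UNIV (\<lambda>p. Dz i (fst p) (snd p))"
    unfolding Dx Dz prod.collapse by (intro continuous_intros cont)+
qed

lemma g_cont: "continuous_on UNIV (\<lambda>p. g i (fst p) (snd p))"
proof (rule continuous_at_imp_continuous_on, rule ballI)
  fix p :: "'a \<times> 'z"
  show "isCont (\<lambda>p. g i (fst p) (snd p)) p"
    using has_derivative_continuous[OF g_joint[of i "fst p" "snd p"]] by simp
qed

lemma g_continuous_on [continuous_intros]:
  fixes a :: "'b::topological_space \<Rightarrow> 'a"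
  assumes "continuous_on S a" "continuous_on S b"
  shows "continuous_on S (\<lambda>t. g i (a t) (b t))"
  using continuous_on_compose2[OF g_cont continuous_on_Pair[OF assms]] by simp

lemma Dx_continuous_on [continuous_intros]:
  fixes a :: "'b::topological_space \<Rightarrow> 'a"
  assumes "continuous_on S a" "continuous_on S b"
  shows "continuous_on S (\<lambda>t. Dx i (a t) (b t))"
  using continuous_on_compose2[OF Dx_cont continuous_on_Pair[OF assms]] by simp

lemma Dz_continuous_on [continuous_intros]:
  fixes a :: "'b::topological_space \<Rightarrow> 'a"
  assumes "continuous_on S a" "continuous_on S b"
  shows "continuous_on S (\<lambda>t. Dz i (a t) (b t))"
  using continuous_on_compose2[OF Dz_cont continuous_on_Pair[OF assms]] by simp

lemma g_tendsto: "((\<lambda>y. g i y z) \<longlongrightarrow> g i x z) (nhds x)"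
proof -
  have "continuous_on UNIV (\<lambda>y. g i y z)" by (intro continuous_intros)
  then have "isCont (\<lambda>y. g i y z) x" by (simp add: continuous_on_eq_continuous_at)
  then show ?thesis unfolding isCont_def by (rule tendsto_at_iff_tendsto_nhds[THEN iffD1])
qed

lemma eventually_g_less: "g i x z < 0 \<Longrightarrow> \<forall>\<^sub>F y in nhds x. g i y z < 0"
  by (rule order_tendstoD(2)[OF g_tendsto])

lemma eventually_g_greater: "g i x z > 0 \<Longrightarrow> \<forall>\<^sub>F y in nhds x. g i y z > 0"
  by (rule order_tendstoD(1)[OF g_tendsto])

lemma g_line_deriv: "((\<lambda>t. g i x (z + t *\<^sub>R w)) has_real_derivative Dz i x (z + t *\<^sub>R w) \<bullet> w) (at t)"
proof -
  have "((\<lambda>t. (x, z + t *\<^sub>R w)) has_derivative (\<lambda>h. (0, h *\<^sub>R w))) (at t)"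
    by (auto intro!: derivative_eq_intros)
  from has_derivative_compose[OF this g_joint]
  have "((\<lambda>t. g i x (z + t *\<^sub>R w)) has_derivative (\<lambda>h. h * (Dz i x (z + t *\<^sub>R w) \<bullet> w))) (at t)"
    by (simp add: inner_commute)
  then show ?thesis by (simp add: has_field_derivative_def mult_commute_abs)
qed

end

text \<open>The ball of radius \<delta> acts as a Slater condition that is uniform over
  \<open>U\<close>; together with nonvanishing \<open>Dz\<close> on zero sets it makes every ray
  from the origin leave each sublevel set transversally or not at all.\<close>

locale radial_system = C1_system g
  for g :: "'k::finite \<Rightarrow> 'a::euclidean_space \<Rightarrow> real^'m \<Rightarrow> real" +
  fixes L :: "real^'m^'m" and U :: "'a set" and \<delta> :: real
  assumes g_qc: "\<And>i x. quasiconvex_on UNIV (\<lambda>z. g i x z)"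
    and open_U: "open U" and \<delta>: "0 < \<delta>"
    and neg: "\<And>i x w. x \<in> U \<Longrightarrow> norm w \<le> \<delta> \<Longrightarrow> g i x w < 0"
    and Dz_nz: "\<And>i x z. x \<in> U \<Longrightarrow> g i x z = 0 \<Longrightarrow> Dz i x z \<noteq> 0"
begin

lemma qc: "0 \<le> t \<Longrightarrow> t \<le> 1 \<Longrightarrow> g i x ((1 - t) *\<^sub>R z + t *\<^sub>R w) \<le> max (g i x z) (g i x w)"
  using g_qc[of i x] unfolding quasiconvex_on_def by auto

text \<open>The zero sublevel set contains the ball of radius \<open>\<delta>\<close>, so quasi-convexity makes the normal
  \<open>Dz\<close> point outward uniformly.\<close>

lemma Dz_radial:
  assumes x: "x \<in> U" and z: "g i x z = 0"
  shows "\<delta> * norm (Dz i x z) \<le> Dz i x z \<bullet> z"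
proof (rule ccontr)
  assume neg': "\<not> ?thesis"
  define n where "n = Dz i x z"
  have n: "n \<noteq> 0" using Dz_nz[OF assms] by (simp add: n_def)
  \<comment> \<open>The point of the \<delta>-ball furthest in the direction of the normal. If the
    inequality failed, \<open>g\<close> would increase from \<open>z\<close> towards
    \<open>w\<close>, although it is 0 at \<open>z\<close> and negative at \<open>w\<close>.\<close>
  define w where "w = (\<delta> / norm n) *\<^sub>R n"
  have w: "g i x w < 0" using neg[OF x, of w i] n \<delta> by (simp add: w_def)
  have "n \<bullet> w = \<delta> * norm n" using n by (simp add: w_def power2_norm_eq_inner[symmetric] power2_eq_square)
  then have "0 < Dz i x (z + 0 *\<^sub>R (w - z)) \<bullet> (w - z)"
    using neg' by (simp add: n_def inner_diff_right)
  from DERIV_pos_inc_right[OF g_line_deriv this]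
  obtain d where d: "d > 0" "\<And>h. 0 < h \<Longrightarrow> h < d \<Longrightarrow> g i x (z + 0 *\<^sub>R (w - z)) < g i x (z + (0 + h) *\<^sub>R (w - z))"
    by auto
  define h where "h = min (d / 2) 1"
  have h: "0 < h" "h < d" "h \<le> 1" using d by (auto simp: h_def)
  have "g i x ((1 - h) *\<^sub>R z + h *\<^sub>R w) \<le> 0" using qc[of h i x z w] h z w by simp
  moreover have "(1 - h) *\<^sub>R z + h *\<^sub>R w = z + h *\<^sub>R (w - z)" by (simp add: algebra_simps)
  ultimately show False using d(2)[OF h(1,2)] z by simp
qed

lemma g_ray_le:
  assumes "x \<in> U" "0 \<le> r" "r \<le> s" "g i x (s *\<^sub>R w) \<le> 0"
  shows "g i x (r *\<^sub>R w) \<le> 0"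
proof (cases "s = 0")
  case False
  have "g i x ((1 - r / s) *\<^sub>R 0 + (r / s) *\<^sub>R (s *\<^sub>R w)) \<le> max (g i x 0) (g i x (s *\<^sub>R w))"
    using assms False by (intro qc) auto
  then show ?thesis using neg[OF assms(1), of 0 i] \<delta> assms False by simp
qed (use assms in auto)

lemma Dz_ray_pos:
  assumes x: "x \<in> U" and r: "0 \<le> r" and z: "g i x (r *\<^sub>R w) = 0"
  shows "0 < r" "\<delta> * norm (Dz i x (r *\<^sub>R w)) \<le> r * (Dz i x (r *\<^sub>R w) \<bullet> w)" "0 < Dz i x (r *\<^sub>R w) \<bullet> w"
proof -
  show r': "0 < r" using neg[OF x, of 0 i] \<delta> r z by (cases "r = 0") auto
  show le: "\<delta> * norm (Dz i x (r *\<^sub>R w)) \<le> r * (Dz i x (r *\<^sub>R w) \<bullet> w)"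
    using Dz_radial[OF x z] by simp
  have "0 < \<delta> * norm (Dz i x (r *\<^sub>R w))" using Dz_nz[OF x z] \<delta> by simp
  then show "0 < Dz i x (r *\<^sub>R w) \<bullet> w" using le r' by (metis less_le_trans zero_less_mult_pos)
qed

text \<open>Excludes plateaus at level 0: at a zero the radial derivative is positive, so
  \<open>g\<close> would be positive just behind it, against \<open>g_ray_le\<close>.\<close>

lemma g_ray_less:
  assumes x: "x \<in> U" and r: "0 \<le> r" "r < s" and s: "g i x (s *\<^sub>R w) \<le> 0"
  shows "g i x (r *\<^sub>R w) < 0"
proof (rule ccontr)
  assume "\<not> ?thesis"
  then have z: "g i x (r *\<^sub>R w) = 0" using g_ray_le[OF x r(1) _ s] r by simp
  have "0 < Dz i x (0 + r *\<^sub>R w) \<bullet> w" using Dz_ray_pos(3)[OF x r(1) z] by simp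
  from DERIV_pos_inc_right[OF g_line_deriv this]
  obtain d where d: "d > 0" "\<And>h. 0 < h \<Longrightarrow> h < d \<Longrightarrow> g i x (0 + r *\<^sub>R w) < g i x (0 + (r + h) *\<^sub>R w)"
    by auto
  define h where "h = min (d / 2) (s - r)"
  have h: "0 < h" "h < d" "r + h \<le> s" using d r by (auto simp: h_def)
  have "g i x ((r + h) *\<^sub>R w) \<le> 0" by (rule g_ray_le[OF x _ h(3) s]) (use r h in simp)
  then show False using d(2)[OF h(1,2)] z by simp
qed

text \<open>The Boolean \<open>P\<close> records the sign, so that one statement serves both
  signs.\<close>

lemma g_ray_eventually:
  assumes "(g i x (a *\<^sub>R w) < 0) = P" "g i x (a *\<^sub>R w) \<noteq> 0"
  shows "\<forall>\<^sub>F r in nhds a. (g i x (r *\<^sub>R w) < 0) = P \<and> g i x (r *\<^sub>R w) \<noteq> 0"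
proof -
  have "continuous_on UNIV (\<lambda>r. g i x (r *\<^sub>R w))" by (intro continuous_intros)
  then have "isCont (\<lambda>r. g i x (r *\<^sub>R w)) a" by (simp add: continuous_on_eq_continuous_at)
  then have lim: "((\<lambda>r. g i x (r *\<^sub>R w)) \<longlongrightarrow> g i x (a *\<^sub>R w)) (nhds a)"
    unfolding isCont_def by (rule tendsto_at_iff_tendsto_nhds[THEN iffD1])
  show ?thesis
  proof (cases "g i x (a *\<^sub>R w) < 0")
    case True
    then show ?thesis using order_tendstoD(2)[OF lim True] assms by (auto elim!: eventually_mono)
  next
    case False
    then have "g i x (a *\<^sub>R w) > 0" using assms by simp
    then show ?thesis using order_tendstoD(1)[OF lim, of 0] assms by (auto elim!: eventually_mono)
  qed
qed

abbreviation "\<rho> i x v \<equiv> rho L (g i) x v"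

text \<open>Forward by \<open>g_ray_less\<close>, backward because negativity persists slightly
  beyond \<open>a\<close>. With \<open>rho_lt_iff\<close> it reduces comparisons with the radius to
  the sign of \<open>g\<close> at a single point, from which continuity and measurability of the
  radius follow.\<close>

lemma rho_gt_iff:
  assumes x: "x \<in> U" and a: "0 \<le> a"
  shows "ennreal a < \<rho> i x v \<longleftrightarrow> g i x (a *\<^sub>R (L *v v)) < 0"
proof
  assume "ennreal a < \<rho> i x v"
  then obtain r where r: "0 < r" "g i x (r *\<^sub>R (L *v v)) \<le> 0" "ennreal a < ennreal r"
    unfolding rho_def less_SUP_iff by auto
  then have "a < r" using a by (simp add: ennreal_less_iff)
  then show "g i x (a *\<^sub>R (L *v v)) < 0" using g_ray_less[OF x a _ r(2)] by simp
next
  assume "g i x (a *\<^sub>R (L *v v)) < 0"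
  then have "\<forall>\<^sub>F r in nhds a. g i x (r *\<^sub>R (L *v v)) < 0"
    using g_ray_eventually[of i x a "L *v v" True] by (auto elim!: eventually_mono)
  then obtain d where d: "d > 0" "\<And>r. dist r a < d \<Longrightarrow> g i x (r *\<^sub>R (L *v v)) < 0"
    unfolding eventually_nhds_metric by blast
  have "ennreal a < ennreal (a + d / 2)" using a d by (simp add: ennreal_less_iff)
  also have "ennreal (a + d / 2) \<le> \<rho> i x v"
    unfolding rho_def using d(2)[of "a + d / 2"] d(1) a by (intro SUP_upper) (auto simp: dist_real_def)
  finally show "ennreal a < \<rho> i x v" .
qed

lemma rho_lt_iff:
  assumes x: "x \<in> U" and a: "0 \<le> a"
  shows "\<rho> i x v < ennreal a \<longleftrightarrow> 0 < g i x (a *\<^sub>R (L *v v))"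
proof
  assume lt: "\<rho> i x v < ennreal a"
  then have a0: "0 < a" by (metis ennreal_neg not_le not_less_zero)
  show "0 < g i x (a *\<^sub>R (L *v v))"
  proof (rule ccontr)
    assume "\<not> ?thesis"
    then have "ennreal a \<le> \<rho> i x v" unfolding rho_def using a0 by (intro SUP_upper) auto
    then show False using lt by simp
  qed
next
  assume pos: "0 < g i x (a *\<^sub>R (L *v v))"
  have a0: "0 < a" using pos neg[OF x, of 0 i] \<delta> a by (cases "a = 0") auto
  have "\<forall>\<^sub>F r in nhds a. 0 < g i x (r *\<^sub>R (L *v v))"
    using g_ray_eventually[of i x a "L *v v" False] pos by (auto elim!: eventually_mono)
  then obtain d where d: "d > 0" "\<And>r. dist r a < d \<Longrightarrow> 0 < g i x (r *\<^sub>R (L *v v))"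
    unfolding eventually_nhds_metric by blast
  \<comment> \<open>Positive, strictly below \<open>a\<close>, and close enough to \<open>a\<close>
    for \<open>g\<close> to be still positive; the whole sublevel ray then ends before
    \<open>b\<close>.\<close>
  define b where "b = max (a / 2) (a - d / 2)"
  have b: "0 < b" "b < a" "dist b a < d" using a0 d(1) by (auto simp: b_def dist_real_def)
  have "\<rho> i x v \<le> ennreal b"
    unfolding rho_def
  proof (rule SUP_least)
    fix r assume r: "r \<in> {r. 0 < r \<and> g i x (r *\<^sub>R (L *v v)) \<le> 0}"
    have "r \<le> b"
    proof (rule ccontr)
      assume "\<not> r \<le> b"
      then have "g i x (b *\<^sub>R (L *v v)) \<le> 0" using g_ray_le[OF x, of b r i "L *v v"] b r by auto
      then show False using d(2)[OF b(3)] by simp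
    qed
    then show "ennreal r \<le> ennreal b" by (rule ennreal_leI)
  qed
  also have "ennreal b < ennreal a" using b by (simp add: ennreal_less_iff)
  finally show "\<rho> i x v < ennreal a" .
qed

lemma rho_eq_iff:
  assumes "x \<in> U" "0 \<le> a"
  shows "\<rho> i x v = ennreal a \<longleftrightarrow> g i x (a *\<^sub>R (L *v v)) = 0"
  using rho_gt_iff[OF assms, of i v] rho_lt_iff[OF assms, of i v]
  by (cases "\<rho> i x v" "ennreal a" rule: linorder_cases) auto

lemma rho_ge_iff:
  assumes "x \<in> U" "0 \<le> a"
  shows "ennreal a \<le> \<rho> i x v \<longleftrightarrow> g i x (a *\<^sub>R (L *v v)) \<le> 0"
  using rho_lt_iff[OF assms, of i v] by (auto simp: not_less[symmetric])

abbreviation "R i x v \<equiv> enn2real (\<rho> i x v)"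

lemma rho_finite:
  assumes x: "x \<in> U" and fin: "\<rho> i x v < \<infinity>"
  shows "ennreal (R i x v) = \<rho> i x v" "g i x (R i x v *\<^sub>R (L *v v)) = 0" "0 < R i x v"
proof -
  show eq: "ennreal (R i x v) = \<rho> i x v" using fin by simp
  show z: "g i x (R i x v *\<^sub>R (L *v v)) = 0" using rho_eq_iff[OF x, of "R i x v" i v] eq by simp
  show "0 < R i x v" using Dz_ray_pos(1)[OF x _ z] by simp
qed

lemma eventually_U: "x \<in> U \<Longrightarrow> \<forall>\<^sub>F y in nhds x. y \<in> U"
  by (rule eventually_nhds_in_open[OF open_U])

lemma eventually_rho_gt:
  assumes x: "x \<in> U" and a: "0 \<le> a" "ennreal a < \<rho> i x v"
  shows "\<forall>\<^sub>F y in nhds x. ennreal a < \<rho> i y v"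
  using eventually_U[OF x] eventually_g_less[OF rho_gt_iff[THEN iffD1, OF x a]]
  by eventually_elim (simp add: rho_gt_iff a)

lemma eventually_rho_lt:
  assumes x: "x \<in> U" and a: "0 \<le> a" "\<rho> i x v < ennreal a"
  shows "\<forall>\<^sub>F y in nhds x. \<rho> i y v < ennreal a"
  using eventually_U[OF x] eventually_g_greater[OF rho_lt_iff[THEN iffD1, OF x a]]
  by eventually_elim (simp add: rho_lt_iff a)

lemma eventually_rho_finite:
  assumes x: "x \<in> U" and fin: "\<rho> i x v < \<infinity>"
  shows "\<forall>\<^sub>F y in nhds x. \<rho> i y v < \<infinity>"
proof -
  have "ennreal (R i x v) < ennreal (R i x v + 1)" by (simp add: ennreal_less_iff)
  then have "\<rho> i x v < ennreal (R i x v + 1)" by (simp only: rho_finite(1)[OF x fin])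
  then have "\<forall>\<^sub>F y in nhds x. \<rho> i y v < ennreal (R i x v + 1)" by (intro eventually_rho_lt[OF x]) auto
  then show ?thesis by eventually_elim (auto intro: less_trans simp: ennreal_less_top)
qed

text \<open>The sign of \<open>g\<close> at \<open>s *\<^sub>R (L *v v)\<close> decides on which side of \<open>s\<close> the radius lies, so the
  first-order expansion of \<open>g\<close> traps the radius between two affine functions of \<open>y\<close>.\<close>

lemma R_GDERIV:
  assumes x: "x \<in> U" and fin: "\<rho> i x v < \<infinity>"
  defines "z \<equiv> R i x v *\<^sub>R (L *v v)"
  shows "GDERIV (\<lambda>y. R i y v) x :> - (1 / (Dz i x z \<bullet> (L *v v))) *\<^sub>R Dx i x z"
proof (rule GDERIV_I)
  fix \<epsilon> :: real assume \<epsilon>: "\<epsilon> > 0"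
  define w where "w = L *v v"
  define r0 where "r0 = R i x v"
  define c where "c = Dz i x z \<bullet> w"
  define a where "a = Dx i x z"
  have z0: "g i x (r0 *\<^sub>R w) = 0" and r0: "0 < r0"
    using rho_finite[OF x fin] by (simp_all add: r0_def w_def)
  have z_eq: "z = r0 *\<^sub>R w" by (simp add: z_def r0_def w_def)
  have c: "c > 0" using Dz_ray_pos(3)[OF x _ z0] r0 by (simp add: c_def z_eq)
  \<comment> \<open>A trial radius is the linear prediction shifted by \<epsilon> N with N =
    \<open>norm (y - x)\<close>; its distance from \<open>r0\<close> is at most
    \<open>B * N\<close>.\<close>
  define B where "B = norm a / c + \<epsilon>"
  have B: "0 \<le> B" using c \<epsilon> by (simp add: B_def)
  \<comment> \<open>Chosen such that the expansion error at a trial radius is at most c \<epsilon> N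
    / 2, half of the change that the shift by \<epsilon> N causes in \<open>g\<close>.\<close>
  define \<epsilon>' where "\<epsilon>' = c * \<epsilon> / (2 * (1 + B))"
  have \<epsilon>': "\<epsilon>' > 0" using c \<epsilon> B by (simp add: \<epsilon>'_def)
  have "((\<lambda>q. (fst q, snd q *\<^sub>R w)) has_derivative (\<lambda>h. (fst h, snd h *\<^sub>R w))) (at (x, r0))"
    by (auto intro!: derivative_eq_intros)
  from has_derivative_compose[OF this g_joint[of i "fst (x, r0)" "snd (x, r0) *\<^sub>R w"]]
  have "((\<lambda>q. g i (fst q) (snd q *\<^sub>R w)) has_derivative (\<lambda>h. fst h \<bullet> a + snd h * c)) (at (x, r0))"
    by (simp add: a_def c_def z_eq inner_commute)
  then obtain d where d: "d > 0" "\<And>q. norm (q - (x, r0)) < d \<Longrightarrow>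
      norm (g i (fst q) (snd q *\<^sub>R w) - g i (fst (x, r0)) (snd (x, r0) *\<^sub>R w) - (fst (q - (x, r0)) \<bullet> a + snd (q - (x, r0)) * c)) \<le> \<epsilon>' * norm (q - (x, r0))"
    unfolding has_derivative_at_alt using \<epsilon>' by blast
  \<comment> \<open>The bound \<open>d\<close> keeps trial points in the range of the expansion, and
    \<open>r0\<close> keeps trial radii positive.\<close>
  define d' where "d' = min d r0 / (1 + B)"
  have d': "d' > 0" using d r0 B by (simp add: d'_def)
  have "\<forall>\<^sub>F y in nhds x. dist y x < d'" using d' by (auto simp: eventually_nhds_metric)
  then show "\<forall>\<^sub>F y in nhds x. \<bar>R i y v - R i x v - (- (1 / (Dz i x z \<bullet> (L *v v))) *\<^sub>R Dx i x z) \<bullet> (y - x)\<bar> \<le> \<epsilon> * norm (y - x)"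
    using eventually_U[OF x]
  proof eventually_elim
    case (elim y)
    define N where "N = norm (y - x)"
    show ?case
    proof (cases "y = x")
      case True
      then show ?thesis by simp
    next
      case False
      then have N: "N > 0" by (simp add: N_def)
      have N_lt: "(1 + B) * N < min d r0"
        using elim(1) B by (simp add: dist_norm N_def d'_def pos_less_divide_eq mult.commute)
      have key: "0 < s" "\<bar>g i y (s *\<^sub>R w) - c * \<sigma>\<bar> \<le> c * (\<epsilon> * N) / 2"
        if s: "s = r0 - ((y - x) \<bullet> a) / c + \<sigma>" and \<sigma>: "\<bar>\<sigma>\<bar> = \<epsilon> * N" for s \<sigma>
      proof -
        have "\<bar>(y - x) \<bullet> a\<bar> \<le> N * norm a" unfolding N_def by (rule Cauchy_Schwarz_ineq2)
        then have "\<bar>((y - x) \<bullet> a) / c\<bar> \<le> N * norm a / c" using c by (simp add: abs_divide divide_right_mono)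
        moreover have "\<bar>s - r0\<bar> \<le> \<bar>((y - x) \<bullet> a) / c\<bar> + \<bar>\<sigma>\<bar>" unfolding s by linarith
        ultimately have "\<bar>s - r0\<bar> \<le> N * norm a / c + \<epsilon> * N" unfolding \<sigma> by linarith
        then have s_r0: "\<bar>s - r0\<bar> \<le> B * N" by (simp add: B_def algebra_simps)
        have "N + B * N < r0" using N_lt by (simp add: algebra_simps)
        then show "0 < s" using s_r0 N by linarith
        have nq: "norm ((y, s) - (x, r0)) \<le> (1 + B) * N"
          using norm_Pair_le[of "y - x" "s - r0"] s_r0 by (simp add: N_def algebra_simps)
        then have "norm ((y, s) - (x, r0)) < d" using N_lt by simp
        from d(2)[OF this] have "\<bar>g i y (s *\<^sub>R w) - ((y - x) \<bullet> a + (s - r0) * c)\<bar> \<le> \<epsilon>' * norm ((y, s) - (x, r0))"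
          by (simp add: z0)
        also have "(y - x) \<bullet> a + (s - r0) * c = c * \<sigma>" using c by (simp add: s field_simps)
        also have "\<epsilon>' * norm ((y, s) - (x, r0)) \<le> \<epsilon>' * ((1 + B) * N)" using nq \<epsilon>' by (intro mult_left_mono) auto
        also have "\<dots> = c * (\<epsilon> * N) / 2" using B by (simp add: \<epsilon>'_def field_simps)
        finally show "\<bar>g i y (s *\<^sub>R w) - c * \<sigma>\<bar> \<le> c * (\<epsilon> * N) / 2" .
      qed
      have ce: "c * (\<epsilon> * N) > 0" using c \<epsilon> N by simp
      \<comment> \<open>At the linear prediction raised by \<epsilon> N the value of
        \<open>g\<close> is positive, and at the one lowered by \<epsilon> N it is negative, so the
        radius lies between the two.\<close>
      define s1 where "s1 = r0 - ((y - x) \<bullet> a) / c + \<epsilon> * N"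
      define s2 where "s2 = r0 - ((y - x) \<bullet> a) / c + - (\<epsilon> * N)"
      have "\<bar>\<epsilon> * N\<bar> = \<epsilon> * N" "\<bar>- (\<epsilon> * N)\<bar> = \<epsilon> * N" using \<epsilon> N by simp_all
      note k1 = key[OF s1_def this(1)] and k2 = key[OF s2_def this(2)]
      have s1: "0 < s1" "0 < g i y (s1 *\<^sub>R w)" using k1 ce by linarith+
      have s2: "0 < s2" "g i y (s2 *\<^sub>R w) < 0"
        using k2 ce unfolding mult_minus_right by linarith+
      have lt1: "\<rho> i y v < ennreal s1" using rho_lt_iff[OF elim(2), of s1] s1 by (simp add: w_def)
      have lt2: "ennreal s2 < \<rho> i y v" using rho_gt_iff[OF elim(2), of s2] s2 by (simp add: w_def)
      have fin_y: "\<rho> i y v < \<infinity>" using lt1 by (auto intro: less_trans simp: ennreal_less_top)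
      have "ennreal s2 < ennreal (R i y v)" "ennreal (R i y v) < ennreal s1"
        using lt1 lt2 by (simp_all only: rho_finite(1)[OF elim(2) fin_y])
      then have "s2 < R i y v" "R i y v < s1" using s2(1) by (simp_all add: ennreal_less_iff)
      then have "\<bar>R i y v - r0 + ((y - x) \<bullet> a) / c\<bar> \<le> \<epsilon> * N" by (simp add: s1_def s2_def abs_le_iff)
      moreover have "(- (1 / c) *\<^sub>R a) \<bullet> (y - x) = - (((y - x) \<bullet> a) / c)" by (simp add: inner_commute)
      ultimately show ?thesis
        unfolding w_def[symmetric] c_def[symmetric] a_def[symmetric] r0_def[symmetric] N_def[symmetric]
        by (simp add: inner_commute[of a])
    qed
  qed
qed

end

section \<open>Radial integrals\<close>

text \<open>Made for a function that need not be differentiable where it attains the upper bound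
  \<open>m\<close>. The mean value theorem controls the rise up to the first time at which
  \<open>m\<close> is attained, and after that no further rise is possible. Reversing time controls
  the fall.\<close>

lemma abs_diff_le_if_maximal_or_bounded_deriv:
  fixes u :: "real \<Rightarrow> real"
  assumes cont: "continuous_on {0..1} u" and le: "\<And>t. t \<in> {0..1} \<Longrightarrow> u t \<le> m" and K: "0 \<le> K"
    and der: "\<And>t. t \<in> {0..1} \<Longrightarrow> u t = m \<or> (\<exists>D. (u has_real_derivative D) (at t) \<and> \<bar>D\<bar> \<le> K)"
  shows "\<bar>u 1 - u 0\<bar> \<le> K"
proof -
  have one_sided: "u 1 - u 0 \<le> K"
    if cont: "continuous_on {0..1} u" and le: "\<And>t. t \<in> {0..1} \<Longrightarrow> u t \<le> m"
      and der: "\<And>t. t \<in> {0..1} \<Longrightarrow> u t = m \<or> (\<exists>D. (u has_real_derivative D) (at t) \<and> \<bar>D\<bar> \<le> K)"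
    for u :: "real \<Rightarrow> real"
  proof -
    have mvt: "u s - u 0 \<le> K" if s: "0 < s" "s \<le> 1" and ne: "\<And>t. 0 < t \<Longrightarrow> t < s \<Longrightarrow> u t \<noteq> m" for s
    proof -
      have ex: "\<exists>D. (u has_real_derivative D) (at t) \<and> \<bar>D\<bar> \<le> K" if "0 < t" "t < s" for t
        using der[of t] ne[OF that] that s by auto
      have "\<exists>l z. 0 < z \<and> z < s \<and> (u has_real_derivative l) (at z) \<and> u s - u 0 = (s - 0) * l"
        using s ex by (intro MVT continuous_on_subset[OF cont]) (auto simp: real_differentiable_def)
      then obtain l z where z: "0 < z" "z < s" "(u has_real_derivative l) (at z)" "u s - u 0 = s * l" by auto
      obtain D where "(u has_real_derivative D) (at z)" "\<bar>D\<bar> \<le> K" using ex[OF z(1,2)] by blast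
      then have "l \<le> K" using DERIV_unique[OF z(3)] by auto
      then have "s * l \<le> 1 * K" using s K by (metis mult_left_mono mult_right_mono less_imp_le order_trans)
      then show ?thesis using z(4) by simp
    qed
    show ?thesis
    proof (cases "\<exists>t\<in>{0..1}. u t = m")
      case False
      then show ?thesis by (intro mvt) auto
    next
      case True
      define S where "S = {t \<in> {0..1}. u t = m}"
      have "S = {0..1} \<inter> u -` {m}" by (auto simp: S_def)
      then have clS: "closed S" using continuous_closed_preimage[OF cont, of "{m}"] by auto
      have neS: "S \<noteq> {}" and bdS: "bdd_below S" using True by (auto simp: S_def intro: bdd_belowI[of _ 0])
      have inf: "Inf S \<in> S" by (rule closed_contains_Inf[OF neS bdS clS])
      have m: "u 1 \<le> u (Inf S)" using inf le[of 1] by (simp add: S_def)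
      show ?thesis
      proof (cases "Inf S = 0")
        case True
        then show ?thesis using m K by simp
      next
        case False
        have "u (Inf S) - u 0 \<le> K"
        proof (rule mvt)
          show "0 < Inf S" "Inf S \<le> 1" using inf False by (auto simp: S_def)
          fix t assume "0 < t" "t < Inf S"
          then show "u t \<noteq> m" using cInf_lower[OF _ bdS, of t] inf by (auto simp: S_def)
        qed
        then show ?thesis using m by simp
      qed
    qed
  qed
  have "u 1 - u 0 \<le> K" by (rule one_sided[OF cont le der])
  moreover have "(\<lambda>t. u (1 - t)) 1 - (\<lambda>t. u (1 - t)) 0 \<le> K"
  proof (rule one_sided)
    show "continuous_on {0..1} (\<lambda>t. u (1 - t))"
      by (rule continuous_on_compose2[OF cont]) (auto intro!: continuous_intros)
    show "u (1 - t) \<le> m" if "t \<in> {0..1}" for t using le[of "1 - t"] that by simp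
    show "u (1 - t) = m \<or> (\<exists>D. ((\<lambda>t. u (1 - t)) has_real_derivative D) (at t) \<and> \<bar>D\<bar> \<le> K)" if t: "t \<in> {0..1}" for t
    proof -
      consider "u (1 - t) = m" | D where "(u has_real_derivative D) (at (1 - t))" "\<bar>D\<bar> \<le> K"
        using der[of "1 - t"] t by auto
      then show ?thesis
      proof cases
        case 2
        have "((\<lambda>t. 1 - t) has_real_derivative - 1) (at t)" by (auto intro!: derivative_eq_intros)
        from DERIV_chain2[OF 2(1) this] show ?thesis using 2(2) by (intro disjI2 exI[of _ "D * - 1"]) auto
      qed simp
    qed
  qed
  ultimately show ?thesis by (simp add: abs_le_iff)
qed

lemma measurable_compose_continuous:
  fixes k :: "'y::topological_space \<Rightarrow> 'z::topological_space"
  assumes "continuous_on UNIV k" "h \<in> borel_measurable M"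
  shows "(\<lambda>t. k (h t)) \<in> borel_measurable M"
  using measurable_compose[OF assms(2) borel_measurable_continuous_onI[OF assms(1)]] .

lemma sets_uniform_sphere [measurable_cong, simp]: "sets uniform_sphere = sets borel"
  by (simp add: uniform_sphere_def)

lemma space_uniform_sphere [simp]: "space uniform_sphere = UNIV"
  by (simp add: uniform_sphere_def)

text \<open>Here \<open>c0\<close> is a lower bound for the stretching by \<open>L\<close>, and
  \<open>B\<close> bounds the weight of the growth condition globally. Convexity of \<open>U\<close>
  provides segments for Lipschitz estimates.\<close>

locale radial_growth = radial_system g L U \<delta>
  for g :: "'k::finite \<Rightarrow> 'a::euclidean_space \<Rightarrow> real^'m \<Rightarrow> real" and L U \<delta> +
  fixes f :: "real^'m \<Rightarrow> real" and \<eta> :: "real \<Rightarrow> real" and l c0 B :: real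
  assumes L: "invertible L" and convex_U: "convex U"
    and f_nonneg: "\<And>z. 0 \<le> f z" and f_cont: "continuous_on UNIV f"
    and f_int: "(\<integral>\<^sup>+z. ennreal (f z) \<partial>lborel) < \<infinity>"
    and c0: "0 < c0" "\<And>v. c0 * norm v \<le> norm (L *v v)"
    and l: "0 \<le> l" and \<eta>_nonneg: "\<And>t. 0 \<le> \<eta> t"
    and growth_le: "\<And>i x z. x \<in> U \<Longrightarrow> g i x z = 0 \<Longrightarrow> norm (Dx i x z) \<le> l * \<eta> (norm z) * norm (Dz i x z)"
    and growth_bd: "\<And>z. norm z ^ CARD('m) * f z * \<eta> (norm z) \<le> B"
    and growth_lim: "((\<lambda>z. norm z ^ CARD('m) * f z * \<eta> (norm z)) \<longlongrightarrow> 0) at_infinity"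
begin

definition "\<kappa> = 2 * pi powr (real CARD('m) / 2) * \<bar>det L\<bar> / Gamma (real CARD('m) / 2)"

lemma kappa_nonneg: "0 \<le> \<kappa>"
  unfolding \<kappa>_def by (intro divide_nonneg_pos Gamma_real_pos) auto

lemma theta_eq: "theta L f r v = \<kappa> * r ^ (CARD('m) - 1) * f (r *\<^sub>R (L *v v))"
  by (simp add: theta_def \<kappa>_def)

lemma theta_nonneg: "0 \<le> r \<Longrightarrow> 0 \<le> theta L f r v"
  unfolding theta_eq using kappa_nonneg f_nonneg by simp

lemma Lv_cont [continuous_intros]: "continuous_on S h \<Longrightarrow> continuous_on S (\<lambda>t. L *v h t)"
  by (rule continuous_on_compose2[OF linear_continuous_on[of "(*v) L" UNIV]]) (auto simp: linear_linear)

lemma f_continuous_on [continuous_intros]: "continuous_on S h \<Longrightarrow> continuous_on S (\<lambda>t. f (h t))"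
  by (rule continuous_on_compose2[OF f_cont]) auto

lemma theta_cont [continuous_intros]:
  "continuous_on S h \<Longrightarrow> continuous_on S (\<lambda>r. theta L f (h r) v)"
  unfolding theta_eq by (intro continuous_intros)

lemma measurable_data [measurable (raw)]:
  assumes "h \<in> borel_measurable M"
  shows "(\<lambda>t. L *v h t) \<in> borel_measurable M" "(\<lambda>t. f (h t)) \<in> borel_measurable M"
    "(\<lambda>t. g i x (h t)) \<in> borel_measurable M" "(\<lambda>t. Dx i x (h t)) \<in> borel_measurable M"
    "(\<lambda>t. Dz i x (h t)) \<in> borel_measurable M"
  by (rule measurable_compose_continuous[OF _ assms], intro continuous_intros)+

lemma theta_measurable [measurable (raw)]:
  assumes [measurable]: "h \<in> borel_measurable M" "k \<in> borel_measurable M"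
  shows "(\<lambda>t. theta L f (h t) (k t)) \<in> borel_measurable M"
  unfolding theta_eq by measurable

text \<open>The range of integration is given by the sign of \<open>g\<close> instead of an upper
  limit \<rho>: this covers infinite radii uniformly and makes the polar formula directly
  applicable.\<close>

definition e :: "'k \<Rightarrow> 'a \<Rightarrow> real^'m \<Rightarrow> real" where
  "e i x v = (\<integral>r. theta L f r v * indicator {r. 0 < r \<and> g i x (r *\<^sub>R (L *v v)) \<le> 0} r \<partial>lborel)"

definition e_min :: "'a \<Rightarrow> real^'m \<Rightarrow> real" where
  "e_min x v = (\<integral>r. theta L f r v * indicator {r. 0 < r \<and> (\<forall>i. g i x (r *\<^sub>R (L *v v)) \<le> 0)} r \<partial>lborel)"

definition e_top :: "real^'m \<Rightarrow> real" where
  "e_top v = (\<integral>r. theta L f r v * indicator {0<..} r \<partial>lborel)"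

definition good :: "real^'m \<Rightarrow> bool" where
  "good v \<longleftrightarrow> norm v = 1 \<and> integrable lborel (\<lambda>r. theta L f r v * indicator {0<..} r)"

text \<open>By the chain rule, \<theta> at the endpoint times the gradient of the radius. The value
  0 at infinite radius is the true derivative there, as \<open>e_GDERIV\<close> shows; the value 0
  off the sphere makes the bound valid for all \<open>v\<close>.\<close>

definition G :: "'k \<Rightarrow> 'a \<Rightarrow> real^'m \<Rightarrow> 'a" where
  "G i x v = (if norm v = 1 \<and> \<rho> i x v < \<infinity> then
     - ((theta L f (R i x v) v / (Dz i x (R i x v *\<^sub>R (L *v v)) \<bullet> (L *v v))) *\<^sub>R Dx i x (R i x v *\<^sub>R (L *v v))) else 0)"

abbreviation "q z \<equiv> norm z ^ CARD('m) * f z * \<eta> (norm z)"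

definition "C0 = \<kappa> * l / (\<delta> * c0 ^ CARD('m))"

lemma C0_nonneg: "0 \<le> C0"
  unfolding C0_def using kappa_nonneg l \<delta> c0 by simp

text \<open>The growth condition bounds \<open>Dx\<close> by l \<eta> times the norm of
  \<open>Dz\<close>, and the radial inequality bounds that norm by r c / \<delta>. This cancels the
  denominator c and raises the power r^(m-1) in \<theta> to r^m, which explains the weight in the
  growth condition. Replacing r by \<open>norm z / c0\<close> accounts for the power of
  \<open>c0\<close> in \<open>C0\<close>.\<close>

lemma G_le:
  assumes x: "x \<in> U" and v: "norm v = 1" and fin: "\<rho> i x v < \<infinity>"
  shows "norm (G i x v) \<le> C0 * q (R i x v *\<^sub>R (L *v v))"
proof -
  define w where "w = L *v v"
  define r where "r = R i x v"
  define z where "z = r *\<^sub>R w"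
  define c where "c = Dz i x z \<bullet> w"
  define N where "N = norm (Dz i x z)"
  have z0: "g i x (r *\<^sub>R w) = 0" and r: "0 < r" using rho_finite[OF x fin] by (simp_all add: r_def w_def)
  have c: "0 < c" and N: "\<delta> * N \<le> r * c"
    using Dz_ray_pos[OF x _ z0] r by (simp_all add: c_def z_def N_def)
  have t: "0 \<le> theta L f r v" using r by (intro theta_nonneg) simp
  have "norm (G i x v) = theta L f r v / c * norm (Dx i x z)"
    using v fin c t unfolding G_def w_def[symmetric] r_def[symmetric] z_def[symmetric] c_def[symmetric] by simp
  also have "\<dots> \<le> theta L f r v / c * (l * \<eta> (norm z) * N)"
    using growth_le[OF x, of i z] z0 t c unfolding z_def[symmetric] N_def[symmetric] by (intro mult_left_mono) simp_all
  also have "\<dots> \<le> theta L f r v / c * (l * \<eta> (norm z) * (r * c / \<delta>))"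
    using N \<delta> t c l \<eta>_nonneg[of "norm z"] by (intro mult_left_mono) (simp_all add: pos_le_divide_eq mult.commute)
  also have "\<dots> = \<kappa> * l / \<delta> * (r ^ CARD('m) * (f z * \<eta> (norm z)))"
    using c \<delta> unfolding theta_eq w_def[symmetric] z_def[symmetric]
    by (cases "CARD('m)") (simp_all add: field_simps)
  also have "\<dots> \<le> \<kappa> * l / \<delta> * ((norm z / c0) ^ CARD('m) * (f z * \<eta> (norm z)))"
  proof (intro mult_left_mono mult_right_mono power_mono)
    have "c0 \<le> norm w" using c0(2)[of v] v by (simp add: w_def)
    then show "r \<le> norm z / c0" using c0(1) r by (simp add: z_def pos_le_divide_eq)
  qed (use kappa_nonneg l \<delta> f_nonneg \<eta>_nonneg r in simp_all)
  also have "\<dots> = C0 * q z" by (simp add: C0_def power_divide)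
  finally show ?thesis by (simp add: z_def r_def w_def)
qed

lemma G_bd: assumes "x \<in> U" shows "norm (G i x v) \<le> C0 * B"
proof (cases "norm v = 1 \<and> \<rho> i x v < \<infinity>")
  case True
  then show ?thesis using G_le[OF assms, of v i] growth_bd[of "R i x v *\<^sub>R (L *v v)"] C0_nonneg
    by (meson mult_left_mono order_trans)
next
  case False
  have "0 \<le> q 0" by (simp add: f_nonneg \<eta>_nonneg)
  then have "0 \<le> B" using growth_bd[of 0] by linarith
  then show ?thesis using False C0_nonneg by (auto simp: G_def)
qed

text \<open>Near a point of infinite radius the radii are either infinite, where \<open>G\<close> is
  0, or so large that the weight of the growth condition is already small.\<close>

lemma eventually_G_small:
  assumes x: "x \<in> U" and v: "norm v = 1" and inf: "\<rho> i x v = \<infinity>" and \<epsilon>: "\<epsilon> > 0"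
  shows "\<forall>\<^sub>F y in nhds x. norm (G i y v) \<le> \<epsilon>"
proof -
  have "((\<lambda>z. C0 * q z) \<longlongrightarrow> C0 * 0) at_infinity" by (intro tendsto_mult_left growth_lim)
  then have "\<forall>\<^sub>F z in at_infinity. C0 * q z < \<epsilon>" using \<epsilon> by (intro order_tendstoD) auto
  then obtain b where b: "\<And>z. b \<le> norm z \<Longrightarrow> C0 * q z < \<epsilon>" unfolding eventually_at_infinity by blast
  define a where "a = \<bar>b\<bar> / c0"
  have a: "0 \<le> a" using c0 by (simp add: a_def)
  have "\<forall>\<^sub>F y in nhds x. ennreal a < \<rho> i y v" by (rule eventually_rho_gt[OF x a]) (simp add: inf)
  then show ?thesis using eventually_U[OF x]
  proof eventually_elim
    case (elim y)
    show ?case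
    proof (cases "\<rho> i y v < \<infinity>")
      case True
      have "ennreal a < ennreal (R i y v)" using elim(1) by (simp only: rho_finite(1)[OF elim(2) True])
      then have "a \<le> R i y v" using a by (simp add: ennreal_less_iff)
      then have "\<bar>b\<bar> \<le> R i y v * c0" using c0 by (simp add: a_def pos_divide_le_eq)
      also have "\<dots> \<le> R i y v * norm (L *v v)" using c0(2)[of v] v by (intro mult_left_mono) auto
      finally have "b \<le> norm (R i y v *\<^sub>R (L *v v))" by simp
      from b[OF this] G_le[OF elim(2) v True] show ?thesis by linarith
    next
      case False
      then show ?thesis using \<epsilon> by (simp add: G_def)
    qed
  qed
qed

lemma R_isCont: "x \<in> U \<Longrightarrow> \<rho> i x v < \<infinity> \<Longrightarrow> isCont (\<lambda>y. R i y v) x"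
  using has_derivative_continuous[OF R_GDERIV[unfolded gderiv_def]] .

lemma G_isCont:
  assumes x: "x \<in> U" and v: "norm v = 1"
  shows "isCont (\<lambda>y. G i y v) x"
proof (cases "\<rho> i x v < \<infinity>")
  case True
  define w where "w = L *v v"
  let ?H = "\<lambda>y r. - ((theta L f r v / (Dz i y (r *\<^sub>R w) \<bullet> w)) *\<^sub>R Dx i y (r *\<^sub>R w))"
  have c: "Dz i x (R i x v *\<^sub>R w) \<bullet> w \<noteq> 0"
    using Dz_ray_pos(3)[OF x _ rho_finite(2)[OF x True]] by (simp add: w_def)
  have R: "((\<lambda>y. R i y v) \<longlongrightarrow> R i x v) (at x)" using R_isCont[OF x True] by (simp add: isCont_def)
  have pair: "((\<lambda>y. (y, R i y v)) \<longlongrightarrow> (x, R i x v)) (at x)" by (intro tendsto_intros R)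
  have t1: "((\<lambda>y. Dz i y (R i y v *\<^sub>R w)) \<longlongrightarrow> Dz i x (R i x v *\<^sub>R w)) (at x)"
    using continuous_on_tendsto_compose[of UNIV "\<lambda>p. Dz i (fst p) (snd p *\<^sub>R w)", OF _ pair]
    by (simp add: continuous_intros)
  have t2: "((\<lambda>y. Dx i y (R i y v *\<^sub>R w)) \<longlongrightarrow> Dx i x (R i x v *\<^sub>R w)) (at x)"
    using continuous_on_tendsto_compose[of UNIV "\<lambda>p. Dx i (fst p) (snd p *\<^sub>R w)", OF _ pair]
    by (simp add: continuous_intros)
  have t3: "((\<lambda>y. theta L f (R i y v) v) \<longlongrightarrow> theta L f (R i x v) v) (at x)"
    using continuous_on_tendsto_compose[of UNIV "\<lambda>r. theta L f r v", OF _ R]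
    by (simp add: continuous_intros)
  have "((\<lambda>y. ?H y (R i y v)) \<longlongrightarrow> ?H x (R i x v)) (at x)"
    by (intro tendsto_intros t1 t2 t3 c)
  also have "?H x (R i x v) = G i x v" using True v by (simp add: G_def w_def)
  finally have lim: "((\<lambda>y. ?H y (R i y v)) \<longlongrightarrow> G i x v) (at x)" .
  have "\<forall>\<^sub>F y in at x. ?H y (R i y v) = G i y v"
    using eventually_nhds_conv_at[THEN iffD1, OF eventually_rho_finite[OF x True]]
    by (auto elim!: eventually_mono simp: G_def v w_def)
  then show ?thesis unfolding isCont_def by (rule Lim_transform_eventually[OF lim])
next
  case False
  then have inf: "\<rho> i x v = \<infinity>" by (simp add: less_top[symmetric])
  have "((\<lambda>y. G i y v) \<longlongrightarrow> 0) (at x)"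
  proof (rule tendstoI)
    fix \<epsilon> :: real assume "\<epsilon> > 0"
    then have "\<forall>\<^sub>F y in nhds x. norm (G i y v) \<le> \<epsilon> / 2" by (intro eventually_G_small[OF x v inf]) simp
    then have "\<forall>\<^sub>F y in nhds x. dist (G i y v) 0 < \<epsilon>" by eventually_elim (use \<open>\<epsilon> > 0\<close> in auto)
    then show "\<forall>\<^sub>F y in at x. dist (G i y v) 0 < \<epsilon>" by (simp add: eventually_nhds_conv_at)
  qed
  moreover have "G i x v = 0" using False by (simp add: G_def)
  ultimately show ?thesis by (simp add: isCont_def)
qed

lemma integrable_theta_indicator:
  assumes "good v" and [measurable]: "Measurable.pred borel P" and "\<And>r. P r \<Longrightarrow> 0 < r"
  shows "integrable lborel (\<lambda>r. theta L f r v * indicator {r. P r} r)"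
proof (rule Bochner_Integration.integrable_bound)
  show "integrable lborel (\<lambda>r. theta L f r v * indicator {0<..} r)" using assms by (simp add: good_def)
  show "AE r in lborel. norm (theta L f r v * indicator {r. P r} r) \<le> norm (theta L f r v * indicator {0<..} r)"
    using assms(3) by (auto simp: indicator_def)
qed measurable

text \<open>For fixed r the sign of \<open>g\<close> at r is locally constant in \<open>x\<close>,
  except when r is the radius itself, a single point of measure zero. For an infinite radius
  \<open>enn2real\<close> yields 0, which is harmless since only r > 0 enters.\<close>

lemma e_isCont:
  assumes x: "x \<in> U" and v: "good v"
  shows "isCont (\<lambda>y. e i y v) x"
  unfolding isCont_def tendsto_at_iff_sequentially
proof safe
  fix Y :: "nat \<Rightarrow> 'a" assume Y: "Y \<longlonglongrightarrow> x"
  let ?w = "L *v v"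
  have "(\<lambda>k. e i (Y k) v) \<longlonglongrightarrow> e i x v"
    unfolding e_def
  proof (rule integral_dominated_convergence[where w = "\<lambda>r. theta L f r v * indicator {0<..} r"])
    show "integrable lborel (\<lambda>r. theta L f r v * indicator {0<..} r)" using v by (simp add: good_def)
    show "AE r in lborel. (\<lambda>k. theta L f r v * indicator {r. 0 < r \<and> g i (Y k) (r *\<^sub>R ?w) \<le> 0} r)
        \<longlonglongrightarrow> theta L f r v * indicator {r. 0 < r \<and> g i x (r *\<^sub>R ?w) \<le> 0} r"
      using AE_lborel_singleton[of "R i x v"]
    proof eventually_elim
      case (elim r)
      show ?case
      proof (cases "0 < r")
        case True
        have "g i x (r *\<^sub>R ?w) \<noteq> 0"
          using rho_eq_iff[OF x, of r i v] True elim by auto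
        then consider "g i x (r *\<^sub>R ?w) < 0" | "g i x (r *\<^sub>R ?w) > 0" by linarith
        then have "\<forall>\<^sub>F y in nhds x. (g i y (r *\<^sub>R ?w) \<le> 0) = (g i x (r *\<^sub>R ?w) \<le> 0)"
        proof cases
          case 1
          then show ?thesis using eventually_g_less[OF 1] by (auto elim!: eventually_mono)
        next
          case 2
          then show ?thesis using eventually_g_greater[OF 2] by (auto elim!: eventually_mono)
        qed
        then have "\<forall>\<^sub>F k in sequentially. (g i (Y k) (r *\<^sub>R ?w) \<le> 0) = (g i x (r *\<^sub>R ?w) \<le> 0)"
          by (rule eventually_compose_filterlim[OF _ Y])
        then have "\<forall>\<^sub>F k in sequentially. theta L f r v * indicator {r. 0 < r \<and> g i (Y k) (r *\<^sub>R ?w) \<le> 0} r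
            = theta L f r v * indicator {r. 0 < r \<and> g i x (r *\<^sub>R ?w) \<le> 0} r"
          by eventually_elim (simp add: indicator_def)
        then show ?thesis by (rule tendsto_eventually)
      qed simp
    qed
    show "AE r in lborel. norm (theta L f r v * indicator {r. 0 < r \<and> g i (Y k) (r *\<^sub>R ?w) \<le> 0} r)
        \<le> theta L f r v * indicator {0<..} r" for k
      using theta_nonneg by (auto simp: indicator_def)
  qed measurable
  then show "((\<lambda>y. e i y v) \<circ> Y) \<longlonglongrightarrow> e i x v" by (simp add: o_def)
qed

lemma e_le_top: assumes "good v" shows "e i x v \<le> e_top v"
  unfolding e_def e_top_def
proof (rule integral_mono)
  show "integrable lborel (\<lambda>r. theta L f r v * indicator {r. 0 < r \<and> g i x (r *\<^sub>R (L *v v)) \<le> 0} r)"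
    by (rule integrable_theta_indicator[OF assms]) auto
  show "integrable lborel (\<lambda>r. theta L f r v * indicator {0<..} r)" using assms by (simp add: good_def)
  fix r show "theta L f r v * indicator {r. 0 < r \<and> g i x (r *\<^sub>R (L *v v)) \<le> 0} r \<le> theta L f r v * indicator {0<..} r"
    using theta_nonneg[of r v] by (auto simp: indicator_def)
qed

lemma e_eq_top: assumes "x \<in> U" "\<rho> i x v = \<infinity>" shows "e i x v = e_top v"
proof -
  have "g i x (r *\<^sub>R (L *v v)) \<le> 0" if "0 < r" for r
    using rho_ge_iff[OF assms(1), of r i v] that assms(2) by simp
  then have "{r. 0 < r \<and> g i x (r *\<^sub>R (L *v v)) \<le> 0} = {0<..}" by auto
  then show ?thesis by (simp add: e_def e_top_def)
qed

lemma e_eq_integral: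
  assumes x: "x \<in> U" and fin: "\<rho> i x v < \<infinity>"
  shows "e i x v = integral {0..R i x v} (\<lambda>r. theta L f r v)"
proof -
  have eq: "0 < r \<and> g i x (r *\<^sub>R (L *v v)) \<le> 0 \<longleftrightarrow> 0 < r \<and> r \<le> R i x v" for r
  proof (cases "0 < r")
    case True
    have "g i x (r *\<^sub>R (L *v v)) \<le> 0 \<longleftrightarrow> ennreal r \<le> ennreal (R i x v)"
      using rho_ge_iff[OF x, of r i v] True by (simp only: rho_finite(1)[OF x fin] less_imp_le simp_thms)
    then show ?thesis using True by (simp add: ennreal_le_iff)
  qed simp
  have "e i x v = (LINT r:{0..R i x v}|lborel. theta L f r v)"
    unfolding e_def set_lebesgue_integral_def eq
  proof (rule integral_cong_AE)
    show "AE r in lborel. theta L f r v * indicator {r. 0 < r \<and> r \<le> R i x v} r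
        = indicator {0..R i x v} r *\<^sub>R theta L f r v"
      using AE_lborel_singleton[of "0::real"] by eventually_elim (auto simp: indicator_def)
  qed measurable
  also have "\<dots> = integral {0..R i x v} (\<lambda>r. theta L f r v)"
    by (intro set_borel_integral_eq_integral borel_integrable_atLeastAtMost') (intro continuous_intros)
  finally show ?thesis .
qed

lemma e_GDERIV_finite:
  assumes x: "x \<in> U" and v: "norm v = 1" and fin: "\<rho> i x v < \<infinity>"
  shows "GDERIV (\<lambda>y. e i y v) x :> G i x v"
proof -
  define r0 where "r0 = R i x v"
  have r0: "0 < r0" using rho_finite(3)[OF x fin] by (simp add: r0_def)
  \<comment> \<open>The interval extends beyond \<open>r0\<close> so that the derivative within it
    becomes a two-sided one.\<close>
  have "((\<lambda>s. integral {0..s} (\<lambda>r. theta L f r v)) has_real_derivative theta L f r0 v) (at r0 within {0..r0 + 1})"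
    using r0 by (intro integral_has_real_derivative) (auto intro!: continuous_intros)
  then have "((\<lambda>s. integral {0..s} (\<lambda>r. theta L f r v)) has_real_derivative theta L f r0 v) (at r0)"
    using r0 by (subst (asm) at_within_interior) (auto simp: interior_atLeastAtMost_real)
  from GDERIV_DERIV_compose[OF R_GDERIV[OF x fin] this[unfolded r0_def]]
  have "GDERIV (\<lambda>y. integral {0..R i y v} (\<lambda>r. theta L f r v)) x :> G i x v"
    using v fin by (simp add: G_def)
  moreover have "\<forall>\<^sub>F y in nhds x. integral {0..R i y v} (\<lambda>r. theta L f r v) = e i y v"
    using eventually_rho_finite[OF x fin] eventually_U[OF x] by eventually_elim (simp add: e_eq_integral)
  ultimately show ?thesis
    unfolding gderiv_def using has_derivative_transform_eventually[of "\<lambda>y. integral {0..R i y v} (\<lambda>r. theta L f r v)" _ x UNIV "\<lambda>y. e i y v"]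
    by (simp add: eventually_nhds_conv_at)
qed

text \<open>Along a segment \<open>e i\<close> either equals its maximum \<open>e_top v\<close> or
  has a derivative bounded through \<open>G\<close>. The set \<open>W\<close> is a parameter because
  the estimate is used twice: on \<open>U\<close> with the global bound, and on small balls with an
  arbitrarily small one.\<close>

lemma e_lipschitz:
  assumes W: "W \<subseteq> U" "convex W" and v: "good v" and K: "0 \<le> K" "\<And>y. y \<in> W \<Longrightarrow> norm (G i y v) \<le> K"
    and xy: "x \<in> W" "y \<in> W"
  shows "\<bar>e i x v - e i y v\<bar> \<le> K * norm (x - y)"
proof -
  define p where "p t = y + t *\<^sub>R (x - y)" for t
  have pW: "p t \<in> W" if "t \<in> {0..1}" for t
    using convexD[OF W(2) xy(2,1), of "1 - t" t] that by (simp add: p_def algebra_simps)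
  have "\<bar>e i (p 1) v - e i (p 0) v\<bar> \<le> K * norm (x - y)"
  proof (rule abs_diff_le_if_maximal_or_bounded_deriv[where m = "e_top v"])
    show "continuous_on {0..1} (\<lambda>t. e i (p t) v)"
    proof (rule continuous_at_imp_continuous_on, rule ballI)
      fix t :: real assume "t \<in> {0..1}"
      then have "isCont (\<lambda>y. e i y v) (p t)" using e_isCont[OF _ v] pW W by blast
      moreover have "isCont p t" unfolding p_def by (intro continuous_intros)
      ultimately show "isCont (\<lambda>t. e i (p t) v) t" by (rule isCont_o2[rotated])
    qed
    show "e i (p t) v \<le> e_top v" for t by (rule e_le_top[OF v])
    fix t :: real assume t: "t \<in> {0..1}"
    have pU: "p t \<in> U" using pW[OF t] W by blast
    show "e i (p t) v = e_top v \<or> (\<exists>D. ((\<lambda>t. e i (p t) v) has_real_derivative D) (at t) \<and> \<bar>D\<bar> \<le> K * norm (x - y))"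
    proof (cases "\<rho> i (p t) v < \<infinity>")
      case False
      then show ?thesis using e_eq_top[OF pU, of i v] by (simp add: less_top[symmetric])
    next
      case True
      have "(p has_derivative (\<lambda>h. h *\<^sub>R (x - y))) (at t)" unfolding p_def by (auto intro!: derivative_eq_intros)
      from has_derivative_compose[OF this e_GDERIV_finite[OF pU _ True, unfolded gderiv_def]] v
      have "((\<lambda>t. e i (p t) v) has_derivative (\<lambda>h. h * ((x - y) \<bullet> G i (p t) v))) (at t)"
        by (simp add: good_def)
      then have "((\<lambda>t. e i (p t) v) has_real_derivative (x - y) \<bullet> G i (p t) v) (at t)"
        by (simp add: has_field_derivative_def mult_commute_abs)
      moreover have "\<bar>(x - y) \<bullet> G i (p t) v\<bar> \<le> K * norm (x - y)"
        using Cauchy_Schwarz_ineq2[of "x - y" "G i (p t) v"] mult_left_mono[OF K(2)[OF pW[OF t]] norm_ge_zero[of "x - y"]]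
        by (simp add: mult.commute)
      ultimately show ?thesis by blast
    qed
  qed (use K in simp)
  then show ?thesis by (simp add: p_def)
qed

text \<open>At infinite radius \<open>G\<close> is at most \<epsilon> on a small ball, so
  \<open>e i\<close> is \<epsilon>-Lipschitz there; as \<epsilon> is arbitrary, the gradient is
  0.\<close>

lemma e_GDERIV:
  assumes x: "x \<in> U" and v: "good v"
  shows "GDERIV (\<lambda>y. e i y v) x :> G i x v"
proof (cases "\<rho> i x v < \<infinity>")
  case True
  then show ?thesis using e_GDERIV_finite[OF x] v by (simp add: good_def)
next
  case False
  then have inf: "\<rho> i x v = \<infinity>" by (simp add: less_top[symmetric])
  have G0: "G i x v = 0" using False by (simp add: G_def)
  show ?thesis
  proof (rule GDERIV_I)
    fix \<epsilon> :: real assume \<epsilon>: "\<epsilon> > 0"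
    have "\<forall>\<^sub>F y in nhds x. norm (G i y v) \<le> \<epsilon> \<and> y \<in> U"
      using eventually_G_small[OF x _ inf \<epsilon>] eventually_U[OF x] v by (auto simp: good_def eventually_conj)
    then obtain d where d: "d > 0" "\<And>y. dist y x < d \<Longrightarrow> norm (G i y v) \<le> \<epsilon> \<and> y \<in> U"
      unfolding eventually_nhds_metric by blast
    have "\<bar>e i y v - e i x v\<bar> \<le> \<epsilon> * norm (y - x)" if "dist y x < d" for y
      by (rule e_lipschitz[of "ball x d"]) (use d v \<epsilon> that in \<open>auto simp: dist_commute\<close>)
    then show "\<forall>\<^sub>F y in nhds x. \<bar>e i y v - e i x v - G i x v \<bullet> (y - x)\<bar> \<le> \<epsilon> * norm (y - x)"
      unfolding eventually_nhds_metric using d(1) by (auto simp: G0)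
  qed
qed

end

section \<open>Null sets of the sphere and active index sets\<close>

lemma AE_uniform_sphere_not_in_hyperplanes:
  fixes a b :: "'a::euclidean_space"
  assumes "a \<noteq> 0" "b \<noteq> 0"
  shows "AE v in uniform_sphere. a \<bullet> v \<noteq> 0 \<and> b \<bullet> v \<noteq> 0"
proof -
  have null: "AE z in lborel. c \<bullet> z \<noteq> 0" if c: "c \<noteq> 0" for c :: 'a
  proof -
    have "negligible {z. c \<bullet> z = 0}" using c by (intro negligible_hyperplane) simp
    moreover have "{z. c \<bullet> z = 0} \<in> sets borel" by measurable
    ultimately have "{z. c \<bullet> z = 0} \<in> null_sets lborel"
      by (auto simp: null_sets_def negligible_iff_emeasure0)
    from AE_not_in[OF this] show ?thesis by simp
  qed
  have "AE z in lborel. a \<bullet> (z /\<^sub>R norm z) \<noteq> 0 \<and> b \<bullet> (z /\<^sub>R norm z) \<noteq> 0"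
    using null[OF assms(1)] null[OF assms(2)] by eventually_elim auto
  then have "AE z in uniform_measure lborel (ball 0 1). a \<bullet> (z /\<^sub>R norm z) \<noteq> 0 \<and> b \<bullet> (z /\<^sub>R norm z) \<noteq> 0"
    by (intro AE_uniform_measureI) auto
  then show ?thesis unfolding uniform_sphere_def by (subst AE_distr_iff) auto
qed

text \<open>For \<open>m \<ge> 2\<close> the ratio of two coordinates has an atomless distribution under the uniform
  measure, since its level sets lie in two hyperplanes.\<close>

lemma uniform_sphere_diffuse_ratio:
  fixes a b :: "'m::finite"
  assumes "a \<noteq> b"
  shows "measure (uniform_sphere :: (real^'m) measure) {v \<in> space uniform_sphere. v $ a / v $ b = c} = 0"
proof -
  \<comment> \<open>The level set at c lies in the hyperplane v_a = c v_b, except where v_b = 0: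
    there the quotient is 0 by convention, and the second hyperplane removes these points.\<close>
  have nz: "axis a 1 - c *\<^sub>R axis b 1 \<noteq> (0 :: real^'m)" "axis b 1 \<noteq> (0 :: real^'m)"
    using assms by (auto simp: vec_eq_iff axis_def)
  have "AE v in (uniform_sphere :: (real^'m) measure). \<not> v $ a / v $ b = c"
    using AE_uniform_sphere_not_in_hyperplanes[OF nz]
    by eventually_elim (auto simp: inner_diff_left inner_axis' field_simps)
  from emeasure_eq_0_AE[OF this] show ?thesis by (simp add: measure_def)
qed

lemma sphere_card_1:
  fixes v :: "real^'m"
  assumes "UNIV = {a :: 'm::finite}" "norm v = 1"
  shows "v = axis a 1 \<or> v = - axis a 1"
proof -
  have all: "i = a" for i :: 'm using assms(1) by auto
  have "v $ i = (v $ a *\<^sub>R axis a 1) $ i" for i using all[of i] by (simp add: axis_def)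
  then obtain t where t: "v = t *\<^sub>R axis a 1" by (metis vec_eq_iff)
  then have "\<bar>t\<bar> = 1" using assms(2) by (simp add: norm_axis_1)
  then have "t = 1 \<or> t = - 1" by linarith
  then show ?thesis unfolding t by auto
qed

text \<open>Pairwise comparison of radii replaces \<open>rho_min\<close>, which suits both
  measurability and semicontinuity arguments.\<close>

lemma in_T_set_iff: "i \<in> T_set L g x v \<longleftrightarrow> (\<forall>j. rho L (g i) x v \<le> rho L (g j) x v)"
proof -
  have "rho_min L g x v \<in> range (\<lambda>i. rho L (g i) x v)" and le: "\<And>j. rho_min L g x v \<le> rho L (g j) x v"
    unfolding rho_min_def by (auto intro: Min_in)
  then obtain k where k: "rho_min L g x v = rho L (g k) x v" by auto
  show ?thesis
  proof
    assume "i \<in> T_set L g x v"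
    then show "\<forall>j. rho L (g i) x v \<le> rho L (g j) x v" using le by (simp add: T_set_def)
  next
    assume "\<forall>j. rho L (g i) x v \<le> rho L (g j) x v"
    then show "i \<in> T_set L g x v" unfolding T_set_def using k le[of i] by (auto intro: antisym)
  qed
qed

lemma T_set_nonempty: "T_set L g x v \<noteq> {}"
proof -
  have "rho_min L g x v \<in> range (\<lambda>i. rho L (g i) x v)" unfolding rho_min_def by (rule Min_in) auto
  then show ?thesis by (auto simp: T_set_def)
qed

section \<open>Spherical integration of the radial integrals, and the formulas for \<phi>\<close>

context radial_growth
begin

text \<open>Common form of \<open>e i x\<close> and \<open>e_min x\<close>, so that integrability
  and the polar formula are proved once for all measurable sets.\<close>

definition E :: "(real^'m) set \<Rightarrow> real^'m \<Rightarrow> real" where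
  "E A v = (\<integral>r. (if 0 < r \<and> r *\<^sub>R (L *v v) \<in> A then theta L f r v else 0) \<partial>lborel)"

lemma e_eq_E: "e i x v = E {z. g i x z \<le> 0} v" and e_min_eq_E: "e_min x v = E {z. \<forall>i. g i x z \<le> 0} v"
  unfolding e_def e_min_def E_def by (auto simp: indicator_def intro!: Bochner_Integration.integral_cong)

lemma level_sets [measurable]:
  "{z. g i x z \<le> 0} \<in> sets borel" "{z. \<forall>i. g i x z \<le> 0} \<in> sets borel"
proof -
  have "{z \<in> space borel. g i x z \<le> 0} \<in> sets borel" "{z \<in> space borel. \<forall>i. g i x z \<le> 0} \<in> sets borel" by measurable
  then show "{z. g i x z \<le> 0} \<in> sets borel" "{z. \<forall>i. g i x z \<le> 0} \<in> sets borel" by simp_all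
qed

lemma nn_integral_polar_theta:
  assumes [measurable]: "A \<in> sets borel"
  shows "(\<integral>\<^sup>+z. ennreal (f z) * indicator A z \<partial>lborel)
    = (\<integral>\<^sup>+v. (\<integral>\<^sup>+r. ennreal (if 0 < r \<and> r *\<^sub>R (L *v v) \<in> A then theta L f r v else 0) \<partial>lborel) \<partial>uniform_sphere)"
proof -
  have "ennreal (\<kappa> * r ^ (CARD('m) - 1)) * (ennreal (f (r *\<^sub>R (L *v v))) * indicator A (r *\<^sub>R (L *v v))) * indicator {0<..} r
      = ennreal (if 0 < r \<and> r *\<^sub>R (L *v v) \<in> A then theta L f r v else 0)" for r v
    using kappa_nonneg by (auto simp: indicator_def theta_eq ennreal_mult'[symmetric])
  then show ?thesis
    using nn_integral_polar_linear[OF L, of "\<lambda>z. ennreal (f z) * indicator A z"] by (simp add: \<kappa>_def[symmetric])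
qed

text \<open>The total mass of \<open>f\<close> is finite, so by polar coordinates almost every ray
  carries finite mass.\<close>

lemma AE_good: "AE v in uniform_sphere. good v"
proof -
  have "(\<integral>\<^sup>+v. (\<integral>\<^sup>+r. ennreal (if 0 < r \<and> r *\<^sub>R (L *v v) \<in> UNIV then theta L f r v else 0) \<partial>lborel) \<partial>uniform_sphere) \<noteq> \<infinity>"
    using nn_integral_polar_theta[of UNIV] f_int by auto
  then have "AE v in uniform_sphere. (\<integral>\<^sup>+r. ennreal (if 0 < r \<and> r *\<^sub>R (L *v v) \<in> UNIV then theta L f r v else 0) \<partial>lborel) \<noteq> \<infinity>"
    by (intro nn_integral_noteq_infinite) measurable
  then show ?thesis using AE_uniform_sphere
  proof eventually_elim
    case (elim v)
    have "integrable lborel (\<lambda>r. theta L f r v * indicator {0<..} r)"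
    proof (rule integrableI_nonneg)
      have "(\<integral>\<^sup>+r. ennreal (theta L f r v * indicator {0<..} r) \<partial>lborel)
          = (\<integral>\<^sup>+r. ennreal (if 0 < r \<and> r *\<^sub>R (L *v v) \<in> UNIV then theta L f r v else 0) \<partial>lborel)"
        by (rule nn_integral_cong) (auto simp: indicator_def)
      then show "(\<integral>\<^sup>+r. ennreal (theta L f r v * indicator {0<..} r) \<partial>lborel) < \<infinity>"
        using elim(1) by (simp add: less_top)
      show "AE r in lborel. 0 \<le> theta L f r v * indicator {0<..} r"
        using theta_nonneg by (auto simp: indicator_def)
    qed measurable
    then show ?case using elim(2) by (simp add: good_def)
  qed
qed

lemma E_integral:
  assumes [measurable]: "A \<in> sets borel"
  shows "integrable uniform_sphere (E A)"
    and "ennreal (\<integral>v. E A v \<partial>uniform_sphere) = (\<integral>\<^sup>+z. ennreal (f z) * indicator A z \<partial>lborel)"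
proof -
  have [measurable]: "E A \<in> borel_measurable uniform_sphere" unfolding E_def by measurable
  have nonneg: "0 \<le> E A v" for v
    unfolding E_def using theta_nonneg by (intro integral_nonneg_AE) auto
  have "(\<integral>\<^sup>+v. ennreal (E A v) \<partial>uniform_sphere)
    = (\<integral>\<^sup>+v. (\<integral>\<^sup>+r. ennreal (if 0 < r \<and> r *\<^sub>R (L *v v) \<in> A then theta L f r v else 0) \<partial>lborel) \<partial>uniform_sphere)"
  \<comment> \<open>The identity may fail where the ray integral diverges, since the Bochner
    integral then defaults to 0; good directions avoid this.\<close>
  proof (rule nn_integral_cong_AE)
    show "AE v in uniform_sphere. ennreal (E A v)
      = (\<integral>\<^sup>+r. ennreal (if 0 < r \<and> r *\<^sub>R (L *v v) \<in> A then theta L f r v else 0) \<partial>lborel)"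
      using AE_good
    proof eventually_elim
      case (elim v)
      have "integrable lborel (\<lambda>r. theta L f r v * indicator {r. 0 < r \<and> r *\<^sub>R (L *v v) \<in> A} r)"
        by (rule integrable_theta_indicator[OF elim]) auto
      also have "(\<lambda>r. theta L f r v * indicator {r. 0 < r \<and> r *\<^sub>R (L *v v) \<in> A} r)
          = (\<lambda>r. if 0 < r \<and> r *\<^sub>R (L *v v) \<in> A then theta L f r v else 0)"
        by (auto simp: indicator_def)
      finally show ?case unfolding E_def using theta_nonneg by (subst nn_integral_eq_integral) auto
    qed
  qed
  also have "\<dots> = (\<integral>\<^sup>+z. ennreal (f z) * indicator A z \<partial>lborel)" by (simp add: nn_integral_polar_theta)
  finally have eq: "(\<integral>\<^sup>+v. ennreal (E A v) \<partial>uniform_sphere) = (\<integral>\<^sup>+z. ennreal (f z) * indicator A z \<partial>lborel)" .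
  also have "\<dots> \<le> (\<integral>\<^sup>+z. ennreal (f z) \<partial>lborel)" by (intro nn_integral_mono) (auto simp: indicator_def)
  finally have "(\<integral>\<^sup>+v. ennreal (E A v) \<partial>uniform_sphere) < \<infinity>" using f_int by (rule le_less_trans)
  then show int: "integrable uniform_sphere (E A)" using nonneg by (intro integrableI_nonneg) auto
  show "ennreal (\<integral>v. E A v \<partial>uniform_sphere) = (\<integral>\<^sup>+z. ennreal (f z) * indicator A z \<partial>lborel)"
    using nn_integral_eq_integral[OF int] nonneg eq by simp
qed

lemma rho_measurable [measurable]:
  assumes x: "x \<in> U" shows "(\<lambda>v. \<rho> i x v) \<in> borel_measurable borel"
proof (rule borel_measurableI_greater)
  fix a :: ennreal
  have "{v \<in> space borel. a < \<rho> i x v} \<in> sets borel"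
  proof (cases a)
    case (real r)
    have "{v \<in> space borel. a < \<rho> i x v} = {v \<in> space borel. g i x (r *\<^sub>R (L *v v)) < 0}"
      using rho_gt_iff[OF x real(1)] by (simp add: real)
    also have "\<dots> \<in> sets borel" by measurable
    finally show ?thesis .
  qed simp
  then show "{v \<in> space borel. a < \<rho> i x v} \<in> sets borel" .
qed

lemma T_measurable:
  assumes x: "x \<in> U" shows "T_set L g x \<in> measurable uniform_sphere (count_space UNIV)"
proof (rule measurable_finite_set_valued)
  note [measurable] = rho_measurable[OF x]
  show "Measurable.pred uniform_sphere (\<lambda>v. i \<in> T_set L g x v)" for i
    unfolding in_T_set_iff by measurable
qed

lemma G_measurable: assumes x: "x \<in> U" shows "G i x \<in> borel_measurable uniform_sphere"
proof -
  note [measurable] = rho_measurable[OF x]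
  show ?thesis unfolding G_def by measurable
qed

text \<open>An inactive index has a radius strictly larger than some other one. A number strictly
  between the two radii keeps separating them at nearby points, and finitely many indices allow a
  common neighbourhood.\<close>

lemma T_usc: assumes x: "x \<in> U" shows "\<forall>\<^sub>F y in nhds x. T_set L g y v \<subseteq> T_set L g x v"
proof -
  have "\<forall>\<^sub>F y in nhds x. i \<notin> T_set L g x v \<longrightarrow> i \<notin> T_set L g y v" for i
  proof (cases "i \<in> T_set L g x v")
    case False
    then obtain j where "\<rho> j x v < \<rho> i x v" by (auto simp: in_T_set_iff not_le)
    then obtain t where t: "\<rho> j x v < t" "t < \<rho> i x v" using dense by blast
    obtain a where a: "0 \<le> a" "t = ennreal a" using t(2) by (cases t) auto
    from eventually_rho_gt[OF x a(1) t(2)[unfolded a(2)]] eventually_rho_lt[OF x a(1) t(1)[unfolded a(2)]]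
    show ?thesis
    proof eventually_elim
      case (elim y)
      then have "\<rho> j y v < \<rho> i y v" by (rule less_trans[rotated])
      then show ?case by (auto simp: in_T_set_iff not_le)
    qed
  qed simp
  then have "\<forall>\<^sub>F y in nhds x. \<forall>i. i \<notin> T_set L g x v \<longrightarrow> i \<notin> T_set L g y v"
    by (rule eventually_all_finite)
  then show ?thesis by eventually_elim auto
qed

lemma e_min_le: assumes "good v" shows "e_min x v \<le> e i x v"
  unfolding e_min_def e_def
proof (rule integral_mono)
  show "integrable lborel (\<lambda>r. theta L f r v * indicator {r. 0 < r \<and> (\<forall>i. g i x (r *\<^sub>R (L *v v)) \<le> 0)} r)"
    "integrable lborel (\<lambda>r. theta L f r v * indicator {r. 0 < r \<and> g i x (r *\<^sub>R (L *v v)) \<le> 0} r)"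
    by (rule integrable_theta_indicator[OF assms]; auto)+
  fix r show "theta L f r v * indicator {r. 0 < r \<and> (\<forall>i. g i x (r *\<^sub>R (L *v v)) \<le> 0)} r
      \<le> theta L f r v * indicator {r. 0 < r \<and> g i x (r *\<^sub>R (L *v v)) \<le> 0} r"
    using theta_nonneg[of r v] by (auto simp: indicator_def)
qed

lemma e_min_eq: assumes x: "x \<in> U" and i: "i \<in> T_set L g x v" shows "e_min x v = e i x v"
proof -
  have "(\<forall>j. g j x (r *\<^sub>R (L *v v)) \<le> 0) \<longleftrightarrow> g i x (r *\<^sub>R (L *v v)) \<le> 0" if r: "0 < r" for r
  proof -
    have "g j x (r *\<^sub>R (L *v v)) \<le> 0 \<longleftrightarrow> ennreal r \<le> \<rho> j x v" for j
      using rho_ge_iff[OF x, of r j v] r by simp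
    then show ?thesis using i unfolding in_T_set_iff by (meson order_trans)
  qed
  then have "{r. 0 < r \<and> (\<forall>i. g i x (r *\<^sub>R (L *v v)) \<le> 0)} = {r. 0 < r \<and> g i x (r *\<^sub>R (L *v v)) \<le> 0}" by auto
  then show ?thesis by (simp add: e_min_def e_def)
qed

text \<open>At the smallest radius, if finite, the active constraint vanishes and the others are
  nonpositive. Conversely a zero of the maximum is a zero of some constraint, whose radius is then
  finite.\<close>

lemma F_set_iff:
  assumes x: "x \<in> U"
  shows "v \<in> F_set L (max_fun g) x \<longleftrightarrow> norm v = 1 \<and> rho_min L g x v < \<infinity>"
proof -
  obtain i where i: "i \<in> T_set L g x v" using T_set_nonempty[of L g x v] by auto
  then have min: "rho_min L g x v = \<rho> i x v" by (simp add: T_set_def)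
  have max: "max_fun g x z = 0 \<longleftrightarrow> (\<forall>i. g i x z \<le> 0) \<and> (\<exists>i. g i x z = 0)" for z
  proof -
    have "0 \<in> range (\<lambda>i. g i x z) \<longleftrightarrow> (\<exists>i. g i x z = 0)"
      unfolding image_iff by (simp add: eq_commute[of 0])
    then show ?thesis unfolding max_fun_def by (subst Max_eq_iff) auto
  qed
  have "(\<exists>r\<ge>0. max_fun g x (r *\<^sub>R (L *v v)) = 0) \<longleftrightarrow> \<rho> i x v < \<infinity>"
  proof
    assume "\<exists>r\<ge>0. max_fun g x (r *\<^sub>R (L *v v)) = 0"
    then obtain r j where r: "0 \<le> r" "g j x (r *\<^sub>R (L *v v)) = 0" by (auto simp: max)
    then have "\<rho> j x v = ennreal r" using rho_eq_iff[OF x r(1)] by blast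
    moreover have "\<rho> i x v \<le> \<rho> j x v" using i by (simp add: in_T_set_iff)
    ultimately show "\<rho> i x v < \<infinity>" by (auto simp: ennreal_less_top intro: le_less_trans)
  next
    assume fin: "\<rho> i x v < \<infinity>"
    have "g j x (R i x v *\<^sub>R (L *v v)) \<le> 0" for j
    proof -
      have "ennreal (R i x v) \<le> \<rho> j x v" using i rho_finite(1)[OF x fin] by (simp add: in_T_set_iff)
      then show ?thesis using rho_ge_iff[OF x, of "R i x v" j v] by simp
    qed
    then show "\<exists>r\<ge>0. max_fun g x (r *\<^sub>R (L *v v)) = 0"
      using rho_finite(2)[OF x fin] by (intro exI[of _ "R i x v"]) (auto simp: max)
  qed
  then show ?thesis by (auto simp: F_set_def min)
qed

lemma F_set_borel: assumes x: "x \<in> U" shows "F_set L (max_fun g) x \<in> sets borel"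
proof -
  note [measurable] = rho_measurable[OF x]
  have "rho_min L g x v < \<infinity> \<longleftrightarrow> (\<exists>i. \<rho> i x v < \<infinity>)" for v
    unfolding rho_min_def by (subst Min_less_iff) auto
  then have "F_set L (max_fun g) x = {v \<in> space borel. norm v = 1 \<and> (\<exists>i. \<rho> i x v < \<infinity>)}"
    using F_set_iff[OF x] by auto
  also have "\<dots> \<in> sets borel" by measurable
  finally show ?thesis .
qed

lemma G_eq_grad_integrand:
  assumes x: "x \<in> U" and i: "i \<in> T_set L g x v"
  shows "G i x v = - (indicator (F_set L (max_fun g) x) v *\<^sub>R grad_integrand L f g x v i)"
proof -
  have min: "rho_min L g x v = \<rho> i x v" using i by (simp add: T_set_def)
  show ?thesis
    using F_set_iff[OF x, of v] unfolding min
    by (simp add: G_def grad_integrand_def Let_def min Dx_def Dz_def indicator_def)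
qed

lemma closed_selected_integrals:
  assumes x: "x \<in> U"
  shows "closed ((\<lambda>s. \<integral>v. G (s v) x v \<partial>uniform_sphere) ` selections uniform_sphere (T_set L g x))"
proof -
  interpret prob_space "uniform_sphere :: (real^'m) measure" by (rule prob_space_uniform_sphere)
  interpret bounded_selections uniform_sphere "\<lambda>i. G i x" "C0 * B"
    using G_measurable[OF x] G_bd[OF x] by unfold_locales auto
  show ?thesis
  proof (cases "\<exists>a b :: 'm. a \<noteq> b")
    case True
    then obtain a b :: 'm where "a \<noteq> b" by blast
    show ?thesis
    proof (rule closed_integrals[where p = "\<lambda>v. v $ a / v $ b"])
      show "(\<lambda>v::real^'m. v $ a / v $ b) \<in> borel_measurable uniform_sphere" by measurable
    qed (use uniform_sphere_diffuse_ratio[OF \<open>a \<noteq> b\<close>] T_measurable[OF x] in \<open>auto simp: T_set_nonempty\<close>)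
  next
    case False
    obtain a :: 'm where a: "UNIV = {a}" using False by auto
    \<comment> \<open>When m = 1 the sphere is {axis a 1, - axis a 1}, so a selection matters only
      through a pair of indices and \<open>H\<close> has finite range.\<close>
    define H where "H p = (\<integral>v. G (if v = axis a 1 then fst p else snd p) x v \<partial>uniform_sphere)" for p
    have "integrals (T_set L g x) \<subseteq> range H"
    proof safe
      fix s assume s: "s \<in> selections uniform_sphere (T_set L g x)"
      have "(\<integral>v. G (s v) x v \<partial>uniform_sphere) = H (s (axis a 1), s (- axis a 1))"
        unfolding H_def
      proof (rule integral_cong_AE)
        show "AE v in uniform_sphere. G (s v) x v = G (if v = axis a 1 then fst (s (axis a 1), s (- axis a 1)) else snd (s (axis a 1), s (- axis a 1))) x v"
          using AE_uniform_sphere by eventually_elim (use sphere_card_1[OF a] in auto)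
      qed (auto intro!: measurable_selected selectionsD(1)[OF s])
      then show "(\<integral>v. G (s v) x v \<partial>uniform_sphere) \<in> range H" by auto
    qed
    then show ?thesis by (rule finite_imp_closed[OF finite_subset]) simp
  qed
qed

context
  fixes \<phi> :: "'a \<Rightarrow> real"
  assumes \<phi>_eq: "\<And>x. x \<in> U \<Longrightarrow> ennreal (\<phi> x) = (\<integral>\<^sup>+z. ennreal (f z) * indicator {z. \<forall>i. g i x z \<le> 0} z \<partial>lborel)"
    and \<phi>_nonneg: "\<And>x. 0 \<le> \<phi> x"
begin

lemma min_integral: "min_integral uniform_sphere U e e_min G (T_set L g) (C0 * B) good \<phi>"
proof -
  interpret prob_space "uniform_sphere :: (real^'m) measure" by (rule prob_space_uniform_sphere)
  have B: "0 \<le> C0 * B" if "x \<in> U" for x using G_bd[OF that, of undefined undefined] norm_ge_zero order_trans by blast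
  have "0 \<le> q 0" by (simp add: f_nonneg \<eta>_nonneg)
  then have "0 \<le> B" using growth_bd[of 0] by linarith
  show ?thesis
  proof
    show "0 \<le> C0 * B" using C0_nonneg \<open>0 \<le> B\<close> by simp
    fix x assume x: "x \<in> U"
    show "integrable uniform_sphere (e i x)" for i using E_integral(1)[OF level_sets(1)] by (simp add: e_eq_E[abs_def])
    show "integrable uniform_sphere (e_min x)" using E_integral(1)[OF level_sets(2)] by (simp add: e_min_eq_E[abs_def])
    show "\<phi> x = (\<integral>v. e_min x v \<partial>uniform_sphere)"
    proof -
      have "ennreal (\<phi> x) = ennreal (\<integral>v. e_min x v \<partial>uniform_sphere)"
        using \<phi>_eq[OF x] E_integral(2)[OF level_sets(2)] by (simp add: e_min_eq_E[abs_def])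
      moreover have "0 \<le> (\<integral>v. e_min x v \<partial>uniform_sphere)"
        unfolding e_min_eq_E E_def using theta_nonneg by (intro integral_nonneg_AE AE_I2) auto
      ultimately show ?thesis using \<phi>_nonneg by simp
    qed
    show "\<bar>e i x v - e i y v\<bar> \<le> C0 * B * norm (x - y)" if "y \<in> U" "good v" for i y v
      using e_lipschitz[OF subset_refl convex_U that(2) B[OF x] G_bd x that(1)] by simp
  qed (use open_U AE_good G_measurable G_bd e_GDERIV G_isCont T_measurable T_usc e_min_le e_min_eq
      in \<open>auto simp: good_def T_set_nonempty\<close>)
qed

interpretation min_integral uniform_sphere U e e_min G "T_set L g" "C0 * B" good \<phi>
  by (rule min_integral)

lemma locally_lipschitz: assumes "x \<in> U" shows "\<exists>\<epsilon>>0. \<exists>K. K-lipschitz_on (ball x \<epsilon>) \<phi>"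
proof -
  obtain \<epsilon> where "\<epsilon> > 0" "ball x \<epsilon> \<subseteq> U" using assms open_U open_contains_ball by blast
  then show ?thesis using lipschitz_on_subset[OF phi_lipschitz] by blast
qed

lemma integral_G_eq:
  assumes x: "x \<in> U" and s: "s \<in> selections uniform_sphere (T_set L g x)"
  shows "set_integrable uniform_sphere (F_set L (max_fun g) x) (\<lambda>v. grad_integrand L f g x v (s v))"
    and "(\<integral>v. G (s v) x v \<partial>uniform_sphere)
      = - (LINT v:F_set L (max_fun g) x|uniform_sphere. grad_integrand L f g x v (s v))"
proof -
  interpret bounded_selections uniform_sphere "\<lambda>i. G i x" "C0 * B" by (rule bounded_selections[OF x])
  have eq: "indicator (F_set L (max_fun g) x) v *\<^sub>R grad_integrand L f g x v (s v) = - G (s v) x v" for v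
    using G_eq_grad_integrand[OF x selectionsD(2)[OF s]] by simp
  show "set_integrable uniform_sphere (F_set L (max_fun g) x) (\<lambda>v. grad_integrand L f g x v (s v))"
    unfolding set_integrable_def eq using integrable_selected[OF selectionsD(1)[OF s]] by simp
  show "(\<integral>v. G (s v) x v \<partial>uniform_sphere)
      = - (LINT v:F_set L (max_fun g) x|uniform_sphere. grad_integrand L f g x v (s v))"
    unfolding set_lebesgue_integral_def eq by simp
qed

lemma limiting_subdifferential_subset:
  assumes x: "x \<in> U"
  shows "limiting_subdifferential \<phi> x \<subseteq>
    uminus ` set_valued_integral uniform_sphere (F_set L (max_fun g) x)
      (\<lambda>v. \<Union>i\<in>T_set L g x v. {grad_integrand L f g x v i})"
proof
  fix d assume "d \<in> limiting_subdifferential \<phi> x"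
  then obtain s where s: "s \<in> selections uniform_sphere (T_set L g x)" and d: "d = (\<integral>v. G (s v) x v \<partial>uniform_sphere)"
    using limiting_subgradient[OF x closed_selected_integrals[OF x]] by blast
  have "(LINT v:F_set L (max_fun g) x|uniform_sphere. grad_integrand L f g x v (s v)) \<in>
      set_valued_integral uniform_sphere (F_set L (max_fun g) x) (\<lambda>v. \<Union>i\<in>T_set L g x v. {grad_integrand L f g x v i})"
    unfolding set_valued_integral_def using integral_G_eq(1)[OF x s] selectionsD(2)[OF s]
    by (auto intro!: exI[of _ "\<lambda>v. grad_integrand L f g x v (s v)"])
  then show "d \<in> uminus ` set_valued_integral uniform_sphere (F_set L (max_fun g) x)
      (\<lambda>v. \<Union>i\<in>T_set L g x v. {grad_integrand L f g x v i})"
    unfolding d integral_G_eq(2)[OF x s] by (rule imageI)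
qed

context
  assumes unique: "\<And>x. x \<in> U \<Longrightarrow>
    AE v in uniform_sphere. v \<in> F_set L (max_fun g) x \<longrightarrow> card (T_set L g x v) = 1"
begin

text \<open>Outside \<open>F_set\<close> the gradients of all active indices vanish, so uniqueness
  is required only on \<open>F_set\<close>.\<close>

lemma agree:
  assumes x: "x \<in> U"
  shows "AE v in uniform_sphere. \<forall>i\<in>T_set L g x v. \<forall>j\<in>T_set L g x v. G i x v = G j x v"
  using unique[OF x]
proof eventually_elim
  case (elim v)
  show ?case
  proof (cases "v \<in> F_set L (max_fun g) x")
    case True
    then show ?thesis using elim by (auto simp: card_1_singleton_iff)
  next
    case False
    then show ?thesis using G_eq_grad_integrand[OF x] by simp
  qed
qed

text \<open>The choice operator gives an active index in every direction, whereas the definite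
  description in the gradient formula is meaningful only where the active index is unique; the two
  agree almost everywhere on \<open>F_set\<close>.\<close>

definition sel :: "'a \<Rightarrow> real^'m \<Rightarrow> 'k" where
  "sel x v = (SOME i. i \<in> T_set L g x v)"

lemma sel: "x \<in> U \<Longrightarrow> sel x \<in> selections uniform_sphere (T_set L g x)"
  unfolding sel_def by (rule some_in_selections[OF T_measurable T_set_nonempty])

lemma C1: "C1_on U \<phi>"
  by (rule phi_C1[OF sel agree])

lemma gradient:
  assumes x: "x \<in> U"
  shows "set_integrable uniform_sphere (F_set L (max_fun g) x)
      (\<lambda>v. grad_integrand L f g x v (THE i. i \<in> T_set L g x v))"
    and "GDERIV \<phi> x :> - (LINT v:F_set L (max_fun g) x|uniform_sphere.
      grad_integrand L f g x v (THE i. i \<in> T_set L g x v))"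
proof -
  note [measurable] = rho_measurable[OF x] F_set_borel[OF x] T_measurable[OF x]
  have gi: "(\<lambda>v. grad_integrand L f g x v i) \<in> borel_measurable uniform_sphere" for i
  proof -
    have [measurable]: "(\<lambda>v. rho_min L g x v) \<in> borel_measurable borel"
      unfolding rho_min_def by measurable
    show ?thesis unfolding grad_integrand_def Let_def Dx_def[symmetric] Dz_def[symmetric] by measurable
  qed
  have meas: "(\<lambda>v. indicator (F_set L (max_fun g) x) v *\<^sub>R grad_integrand L f g x v (t v)) \<in> borel_measurable uniform_sphere"
    if [measurable]: "t \<in> measurable uniform_sphere (count_space UNIV)" for t
    using measurable_compose_countable[OF gi that] by measurable
  \<comment> \<open>Where the active set is no singleton the value is unspecified but still a
    function of \<open>T_set L g x v\<close>, hence measurable.\<close>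
  have the: "(\<lambda>v. THE i. i \<in> T_set L g x v) \<in> measurable uniform_sphere (count_space UNIV)" by measurable
  have ae: "AE v in uniform_sphere. indicator (F_set L (max_fun g) x) v *\<^sub>R grad_integrand L f g x v (sel x v)
      = indicator (F_set L (max_fun g) x) v *\<^sub>R grad_integrand L f g x v (THE i. i \<in> T_set L g x v)"
    using unique[OF x]
  proof eventually_elim
    case (elim v)
    show ?case
    proof (cases "v \<in> F_set L (max_fun g) x")
      case True
      then obtain i where "T_set L g x v = {i}" using elim by (auto simp: card_1_singleton_iff)
      then show ?thesis by (simp add: sel_def)
    qed simp
  qed
  show "set_integrable uniform_sphere (F_set L (max_fun g) x)
      (\<lambda>v. grad_integrand L f g x v (THE i. i \<in> T_set L g x v))"
    using integral_G_eq(1)[OF x sel[OF x]] unfolding set_integrable_def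
    by (rule integrable_cong_AE[THEN iffD1, OF meas[OF selectionsD(1)[OF sel[OF x]]] meas[OF the] ae])
  have "(LINT v:F_set L (max_fun g) x|uniform_sphere. grad_integrand L f g x v (sel x v))
      = (LINT v:F_set L (max_fun g) x|uniform_sphere. grad_integrand L f g x v (THE i. i \<in> T_set L g x v))"
    unfolding set_lebesgue_integral_def
    by (rule integral_cong_AE[OF meas[OF selectionsD(1)[OF sel[OF x]]] meas[OF the] ae])
  then show "GDERIV \<phi> x :> - (LINT v:F_set L (max_fun g) x|uniform_sphere.
      grad_integrand L f g x v (THE i. i \<in> T_set L g x v))"
    using phi_GDERIV[OF x sel[OF x] agree[OF x]] integral_G_eq(2)[OF x sel[OF x]] by simp
qed

end
end
end

section \<open>The neighbourhood and the constants at the reference point\<close>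

theorem corollary4p3:
  fixes g :: "'k::finite \<Rightarrow> real^'n \<Rightarrow> real^'m \<Rightarrow> real"
    and L :: "real^'m^'m"
    and M :: "'w measure"
    and \<xi> :: "'w \<Rightarrow> real^'m"
    and f :: "real^'m \<Rightarrow> real"
    and xbar :: "real^'n"
    and \<phi> :: "real^'n \<Rightarrow> real"
  defines "\<phi> \<equiv> \<lambda>x. measure M {\<omega> \<in> space M. \<forall>i. g i x (\<xi> \<omega>) \<le> 0}"
  assumes L: "invertible L"
    and M: "prob_space M"
    and f_nonneg: "\<And>z. 0 \<le> f z"
    and f_cont: "continuous_on UNIV f"
    and density: "distributed M lborel \<xi> (\<lambda>z. ennreal (f z))"
    and g_C1: "\<And>i. C1_on UNIV (\<lambda>(x, z). g i x z)"
    and g_qc: "\<And>i x. quasiconvex_on UNIV (\<lambda>z. g i x z)"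
    and g_neg: "\<And>i. g i xbar 0 < 0"
    and growth: "eta_growth f g xbar"
    and int: "\<exists>V. open V \<and> xbar \<in> V \<and>
      (\<forall>i. \<forall>x\<in>V. interior {z. g i x z \<le> 0} = {z. g i x z < 0})"
  shows "\<exists>U'. open U' \<and> xbar \<in> U' \<and>
    (\<forall>x\<in>U'. \<exists>\<epsilon>>0. \<exists>K. K-lipschitz_on (ball x \<epsilon>) \<phi>) \<and>
    (\<forall>x\<in>U'. limiting_subdifferential \<phi> x \<subseteq>
       uminus ` set_valued_integral uniform_sphere (F_set L (max_fun g) x)
         (\<lambda>v. \<Union>i\<in>T_set L g x v. {grad_integrand L f g x v i})) \<and>
    ((\<forall>x\<in>U'. AE v in uniform_sphere. v \<in> F_set L (max_fun g) x \<longrightarrow> card (T_set L g x v) = 1) \<longrightarrow>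
       C1_on U' \<phi> \<and>
       (\<forall>x\<in>U'.
          set_integrable uniform_sphere (F_set L (max_fun g) x)
            (\<lambda>v. grad_integrand L f g x v (THE i. i \<in> T_set L g x v)) \<and>
          GDERIV \<phi> x :>
            - (LINT v:F_set L (max_fun g) x|uniform_sphere.
                 grad_integrand L f g x v (THE i. i \<in> T_set L g x v))))"
proof -
  interpret C1_system g using g_C1 by unfold_locales
  interpret M: prob_space M by (rule M)
  obtain \<eta> :: "real \<Rightarrow> real" and l where l: "l > 0" and \<eta>: "mono \<eta>" "\<And>t. 0 \<le> \<eta> t"
    and lim: "((\<lambda>z. norm z ^ CARD('m) * f z * \<eta> (norm z)) \<longlongrightarrow> 0) at_infinity"
    and gr: "\<And>i x z. x \<in> cball xbar (1 / l) \<Longrightarrow> g i x z = 0 \<Longrightarrow>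
        Dz i x z \<noteq> 0 \<and> norm (Dx i x z) \<le> l * \<eta> (norm z) * norm (Dz i x z)"
    using growth unfolding eta_growth_def Dx_def Dz_def by blast
  have "\<forall>\<^sub>F p in nhds (xbar, 0). \<forall>i. g i (fst p) (snd p) < 0"
  proof (rule eventually_all_finite)
    fix i
    have "isCont (\<lambda>p. g i (fst p) (snd p)) (xbar, 0)"
      using g_cont[of i] by (simp add: continuous_on_eq_continuous_at)
    then have "((\<lambda>p. g i (fst p) (snd p)) \<longlongrightarrow> g i xbar 0) (nhds (xbar, 0))"
      using tendsto_at_iff_tendsto_nhds[of "\<lambda>p. g i (fst p) (snd p)" "(xbar, 0)"] by (simp add: isCont_def)
    then show "\<forall>\<^sub>F p in nhds (xbar, 0). g i (fst p) (snd p) < 0"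
      by (rule order_tendstoD) (simp add: g_neg)
  qed
  then obtain d where d: "d > 0" "\<And>p i. dist p (xbar, 0) < d \<Longrightarrow> g i (fst p) (snd p) < 0"
    unfolding eventually_nhds_metric by blast
  \<comment> \<open>Radius 1 / l keeps \<open>U\<close> inside the ball of the growth condition, and
    d / 2 leaves room for vectors \<open>w\<close> of norm at most d / 4, since d / 2 + d / 4 < d;
    hence \<delta> = d / 4 below. A ball is moreover open and convex.\<close>
  define U where "U = ball xbar (min (d / 2) (1 / l))"
  have xbar: "xbar \<in> U" using d l by (simp add: U_def)
  obtain c0 where c0: "c0 > 0" "\<And>v. c0 * norm v \<le> norm (L *v v)"
  proof -
    obtain K where K: "K ** L = mat 1" using L unfolding invertible_def by blast
    have "inj ((*v) L)"
      by (rule inj_on_inverseI[of _ "(*v) K"]) (simp add: matrix_vector_mul_assoc K)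
    then show ?thesis
      using linear_inj_bounded_below_pos[of "(*v) L"] that by auto
  qed
  \<comment> \<open>Far out the weight is below 1 by the growth limit. On the remaining ball of
    radius b the density is bounded by compactness, and \<eta> by its value at b through
    monotonicity.\<close>
  obtain B where B: "\<And>z. norm z ^ CARD('m) * f z * \<eta> (norm z) \<le> B"
  proof -
    have "\<forall>\<^sub>F z in at_infinity. norm z ^ CARD('m) * f z * \<eta> (norm z) < 1"
      using lim by (rule order_tendstoD) simp
    then obtain b where b: "\<And>z. b \<le> norm z \<Longrightarrow> norm z ^ CARD('m) * f z * \<eta> (norm z) < 1"
      unfolding eventually_at_infinity by blast
    have "compact (f ` cball 0 b)"
      by (intro compact_continuous_image continuous_on_subset[OF f_cont]) auto
    then have "\<exists>F. \<forall>y\<in>f ` cball 0 b. norm y \<le> F"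
      using compact_imp_bounded bounded_iff by metis
    then obtain F where F0: "\<forall>y\<in>f ` cball 0 b. norm y \<le> F" by blast
    have F: "norm (f z) \<le> F" if "norm z \<le> b" for z using F0 that by auto
    have "norm z ^ CARD('m) * f z * \<eta> (norm z) \<le> max 1 (b ^ CARD('m) * F * \<eta> b)" for z
    proof (cases "b \<le> norm z")
      case True
      then show ?thesis using b[OF True] by simp
    next
      case False
      then have "0 \<le> b" using norm_ge_zero[of z] by linarith
      with False have "norm z ^ CARD('m) * f z * \<eta> (norm z) \<le> b ^ CARD('m) * F * \<eta> b"
        using F[of z] f_nonneg[of z] \<eta>(2) monoD[OF \<eta>(1), of "norm z" b]
        by (intro mult_mono power_mono) auto
      then show ?thesis by simp
    qed
    then show ?thesis by (rule that)
  qed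
  have nn: "emeasure M {\<omega> \<in> space M. \<xi> \<omega> \<in> A} = (\<integral>\<^sup>+z. ennreal (f z) * indicator A z \<partial>lborel)"
    if "A \<in> sets borel" for A
    using distributed_emeasure[OF density, of A] that by (simp add: vimage_def Int_def conj_commute)
  have "(\<integral>\<^sup>+z. ennreal (f z) \<partial>lborel) = 1"
    using nn[of UNIV] M.emeasure_space_1 by simp
  then have f_int: "(\<integral>\<^sup>+z. ennreal (f z) \<partial>lborel) < \<infinity>" by simp
  interpret radial_growth g L U "d / 4" f \<eta> l c0 B
  proof unfold_locales
    fix i x and w :: "real^'m" assume "x \<in> U" "norm w \<le> d / 4"
    then have "dist (x, w) (xbar, 0) < d"
      using sqrt_sum_squares_le_sum_abs[of "dist x xbar" "dist w 0"] d(1)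
      by (simp add: dist_prod_def U_def dist_commute)
    from d(2)[OF this] show "g i x w < 0" by simp
  next
    fix i x and z :: "real^'m" assume "x \<in> U" and z: "g i x z = 0"
    then have "x \<in> cball xbar (1 / l)" by (simp add: U_def)
    from gr[OF this z] show "Dz i x z \<noteq> 0" "norm (Dx i x z) \<le> l * \<eta> (norm z) * norm (Dz i x z)" by auto
  qed (use g_qc d(1) L f_nonneg f_cont f_int c0 l \<eta>(2) B lim in \<open>auto simp: U_def\<close>)
  have \<phi>_eq: "ennreal (\<phi> x) = (\<integral>\<^sup>+z. ennreal (f z) * indicator {z. \<forall>i. g i x z \<le> 0} z \<partial>lborel)" for x
    using nn[OF level_sets(2)[of x]] by (simp add: \<phi>_def M.emeasure_eq_measure)
  have \<phi>_nonneg: "0 \<le> \<phi> x" for x by (simp add: \<phi>_def)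
  show ?thesis
  proof (intro exI[of _ U] conjI ballI impI)
    show "\<exists>\<epsilon>>0. \<exists>K. K-lipschitz_on (ball x \<epsilon>) \<phi>" if "x \<in> U" for x
      by (rule locally_lipschitz[OF \<phi>_eq \<phi>_nonneg that])
    show "limiting_subdifferential \<phi> x \<subseteq>
       uminus ` set_valued_integral uniform_sphere (F_set L (max_fun g) x)
         (\<lambda>v. \<Union>i\<in>T_set L g x v. {grad_integrand L f g x v i})" if "x \<in> U" for x
      by (rule limiting_subdifferential_subset[OF \<phi>_eq \<phi>_nonneg that])
  next
    assume unique: "\<forall>x\<in>U. AE v in uniform_sphere. v \<in> F_set L (max_fun g) x \<longrightarrow> card (T_set L g x v) = 1"
    show "C1_on U \<phi>" by (rule C1[OF \<phi>_eq \<phi>_nonneg bspec[OF unique]])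
    fix x assume x: "x \<in> U"
    show "set_integrable uniform_sphere (F_set L (max_fun g) x)
        (\<lambda>v. grad_integrand L f g x v (THE i. i \<in> T_set L g x v))"
      by (rule gradient(1)[OF \<phi>_eq \<phi>_nonneg bspec[OF unique] x])
    show "GDERIV \<phi> x :> - (LINT v:F_set L (max_fun g) x|uniform_sphere.
        grad_integrand L f g x v (THE i. i \<in> T_set L g x v))"
      by (rule gradient(2)[OF \<phi>_eq \<phi>_nonneg bspec[OF unique] x])
  qed (use xbar open_U in auto)
qed

end
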